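(* Let $N$ be a triply periodic network in $\mathbb R^3$ with lattice $\Lambda$, length $L$ and spanned volume $V$. Then $$\frac{L^3}{V}\ \ge\ \frac{27}{\sqrt2}.$$ Equality holds exactly when $N$ is, up to similarity of $\mathbb R^3$ and up to (unnecessary) vertices of degree $2$, the srs network, in which case the lattice $\Lambda$ is body-centred cubic.
   Context: An ($n$-periodic) network $N$ (triply periodic if $n=3$) is a connected simple graph immersed with straight edges of positive length into $\mathbb R^n$ such that: $N$ is invariant under a lattice $\Lambda\subset\mathbb R^n$ of rank $n$, and the quotient $N/\Lambda$ is a finite graph $\Gamma$, possibly with loops and multiple edges. "Immersed" means that for each vertex the restriction of the map to the union of the incident edges (the star of the vertex) is injective. A lattice of rank $n$ is $\{\sum_i a_i g_i: a_i\in\mathbb Z\}$ with $g_1,\dots,g_n\in\mathbb R^n$ linearly independent. The length is $L=L(N/\Lambda)$, the total edge length of the quotient, and the (spanned) volume is $V=V(\mathbb R^n/\Lambda)$, the volume of a fundamental domain of $\Lambda$. A Steiner network is a network all of whose vertices have degree $3$, such that at each vertex the three incident edges meet at $120^\circ$ angles (the three unit edge vectors sum to zero). The srs network is the Steiner network with quotient the complete graph $K_4$ and all six edge lengths (in the quotient) equal. It is unique up to similarity. Explicitly, with unit edge lengths: let $p_0=(0,0,0)$, $p_1=(1,0,0)$, $p_2=(-\frac12,\frac{\sqrt3}2,0)$, $p_3=(-\frac12,-\frac{\sqrt3}2,0)$, $g_1=(2,-\frac{2}{\sqrt3},-\sqrt{\frac23})$, $g_2=(0,\frac4{\sqrt3},-\sqrt{\frac23})$,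 $g_3=(-2,-\frac2{\sqrt3},-\sqrt{\frac23})$, and $\Lambda=\mathbb Zg_1+\mathbb Zg_2+\mathbb Zg_3$. The network has vertices $p_i+\Lambda$ ($0\le i\le 3$), and its edges are the $\Lambda$-translates of the segments $p_0p_1$, $p_0p_2$, $p_0p_3$, $p_1(p_2+g_1)$, $p_2(p_3+g_2)$, $p_3(p_1+g_3)$. Uniqueness is always understood up to vertices of degree $2$ with opposite incident edges, which may be inserted or removed without changing $L$. *)

theory Defs
  imports "HOL-Analysis.Analysis"
begin

definition lattice_basis :: "(real ^ 'n) set \<Rightarrow> ('n \<Rightarrow> real ^ 'n) \<Rightarrow> bool" where
  "lattice_basis \<Lambda> g \<longleftrightarrow>
     inj g \<and> independent (range g) \<and>
     \<Lambda> = {\<Sum>i\<in>UNIV. of_int (a i) *\<^sub>R g i | a :: 'n \<Rightarrow> int. True}"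

definition full_lattice :: "(real ^ 'n) set \<Rightarrow> bool" where
  "full_lattice \<Lambda> \<longleftrightarrow> (\<exists>g. lattice_basis \<Lambda> g)"

definition fundamental_parallelepiped :: "('n \<Rightarrow> real ^ 'n) \<Rightarrow> (real ^ 'n) set" where
  "fundamental_parallelepiped g =
     {\<Sum>i\<in>UNIV. t i *\<^sub>R g i | t :: 'n \<Rightarrow> real. \<forall>i. 0 \<le> t i \<and> t i < 1}"

text \<open>Two bases of a lattice differ by an integer matrix of determinant 1 or -1, so the value
  does not depend on the chosen basis.\<close>

definition covolume :: "(real ^ 'n) set \<Rightarrow> real" where
  "covolume \<Lambda> = measure lebesgue (fundamental_parallelepiped (SOME g. lattice_basis \<Lambda> g))"

text \<open>
  A network is an abstract graph with a map to Euclidean space: since the map is only an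
  immersion, edges may cross and distinct vertices may share a position. Hence the
  invariance under the lattice is an action on the abstract graph that lifts the translations.
\<close>

record ('v, 'n) network =
  verts :: "'v set"
  edges :: "'v set set"
  pos :: "'v \<Rightarrow> real ^ 'n"
  lattice :: "(real ^ 'n) set"
  act :: "real ^ 'n \<Rightarrow> 'v \<Rightarrow> 'v"

definition neighbours :: "('v, 'n::finite) network \<Rightarrow> 'v \<Rightarrow> 'v set" where
  "neighbours N v = {w. {v, w} \<in> edges N}"

definition vertex_orbit :: "('v, 'n::finite) network \<Rightarrow> 'v \<Rightarrow> 'v set" where
  "vertex_orbit N v = (\<lambda>g. act N g v) ` lattice N"

definition edge_orbit :: "('v, 'n::finite) network \<Rightarrow> 'v set \<Rightarrow> 'v set set" where
  "edge_orbit N e = (\<lambda>g. act N g ` e) ` lattice N"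

definition quotient_verts :: "('v, 'n::finite) network \<Rightarrow> 'v set set" where
  "quotient_verts N = vertex_orbit N ` verts N"

definition quotient_edges :: "('v, 'n::finite) network \<Rightarrow> 'v set set set" where
  "quotient_edges N = edge_orbit N ` edges N"

definition simple_graph :: "('v, 'n::finite) network \<Rightarrow> bool" where
  "simple_graph N \<longleftrightarrow>
     (\<forall>e\<in>edges N. \<exists>u\<in>verts N. \<exists>v\<in>verts N. u \<noteq> v \<and> e = {u, v})"

definition connected_graph :: "('v, 'n::finite) network \<Rightarrow> bool" where
  "connected_graph N \<longleftrightarrow> verts N \<noteq> {} \<and>
     (\<forall>u\<in>verts N. \<forall>v\<in>verts N. (u, v) \<in> {(x, y). {x, y} \<in> edges N}\<^sup>*)"

text \<open>The second conjunct is injectivity on the star of \<open>v\<close>: by the first one, the map is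
  injective on each single edge.\<close>

definition immersed :: "('v, 'n::finite) network \<Rightarrow> bool" where
  "immersed N \<longleftrightarrow>
     (\<forall>u v. {u, v} \<in> edges N \<longrightarrow> pos N u \<noteq> pos N v) \<and>
     (\<forall>v\<in>verts N. \<forall>u\<in>neighbours N v. \<forall>w\<in>neighbours N v. u \<noteq> w \<longrightarrow>
        closed_segment (pos N v) (pos N u) \<inter> closed_segment (pos N v) (pos N w) = {pos N v})"

definition lattice_invariant :: "('v, 'n::finite) network \<Rightarrow> bool" where
  "lattice_invariant N \<longleftrightarrow>
     (\<forall>v\<in>verts N. act N 0 v = v) \<and>
     (\<forall>g\<in>lattice N. \<forall>h\<in>lattice N. \<forall>v\<in>verts N. act N (g + h) v = act N g (act N h v)) \<and>
     (\<forall>g\<in>lattice N. \<forall>v\<in>verts N. act N g v \<in> verts N \<and> pos N (act N g v) = pos N v + g) \<and>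
     (\<forall>g\<in>lattice N. \<forall>e\<in>edges N. act N g ` e \<in> edges N)"

definition periodic_network :: "('v, 'n::finite) network \<Rightarrow> bool" where
  "periodic_network N \<longleftrightarrow>
     simple_graph N \<and> connected_graph N \<and> immersed N \<and>
     full_lattice (lattice N) \<and> lattice_invariant N \<and>
     finite (quotient_verts N) \<and> finite (quotient_edges N)"

definition edge_length :: "('v, 'n::finite) network \<Rightarrow> 'v set \<Rightarrow> real" where
  "edge_length N e = (THE l. \<exists>u v. e = {u, v} \<and> l = dist (pos N u) (pos N v))"

definition network_length :: "('v, 'n::finite) network \<Rightarrow> real" where
  "network_length N = (\<Sum>c\<in>quotient_edges N. edge_length N (SOME e. e \<in> c))"

definition network_volume :: "('v, 'n::finite) network \<Rightarrow> real" where
  "network_volume N = covolume (lattice N)"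

text \<open>Similarities may reverse the orientation. The lattice and its action are part of a
  network, so they are carried along by the linear part.\<close>

definition similar_networks ::
    "('v, 'n::finite) network \<Rightarrow> ('w, 'n) network \<Rightarrow> bool" where
  "similar_networks N M \<longleftrightarrow>
     (\<exists>c A b f. c > 0 \<and> orthogonal_transformation A \<and>
        bij_betw f (verts N) (verts M) \<and>
        edges M = (\<lambda>e. f ` e) ` edges N \<and>
        (\<forall>v\<in>verts N. pos M (f v) = c *\<^sub>R A (pos N v) + b) \<and>
        lattice M = (\<lambda>g. c *\<^sub>R A g) ` lattice N \<and>
        (\<forall>g\<in>lattice N. \<forall>v\<in>verts N. f (act N g v) = act M (c *\<^sub>R A g) (f v)))"

text \<open>
  \<open>removes_degree_two N M\<close>: \<open>M\<close> arises from \<open>N\<close> by deleting the lattice orbit of one vertex of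
  degree 2 with opposite incident edges, and merging each pair of incident edges into one. The
  neighbours lie outside the orbit unless the whole network is a line.
\<close>

definition removes_degree_two ::
    "('v, 'n::finite) network \<Rightarrow> ('v, 'n) network \<Rightarrow> bool" where
  "removes_degree_two N M \<longleftrightarrow>
     (\<exists>v\<in>verts N. \<exists>a b.
        neighbours N v = {a, b} \<and> pos N v \<in> open_segment (pos N a) (pos N b) \<and>
        a \<notin> vertex_orbit N v \<and> b \<notin> vertex_orbit N v \<and>
        M = N\<lparr>verts := verts N - vertex_orbit N v,
              edges := {e \<in> edges N. e \<inter> vertex_orbit N v = {}} \<union> edge_orbit N {a, b}\<rparr>)"

text \<open>Two networks agree up to similarity and up to inserting or removing vertices of degree 2
  if removals lead from them to similar networks.\<close>

definition essentially_similar ::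
    "('v, 'n::finite) network \<Rightarrow> ('w, 'n) network \<Rightarrow> bool" where
  "essentially_similar N M \<longleftrightarrow>
     (\<exists>N' M'. removes_degree_two\<^sup>*\<^sup>* N N' \<and> removes_degree_two\<^sup>*\<^sup>* M M' \<and> similar_networks N' M')"

definition srs_p :: "nat \<Rightarrow> real ^ 3" where
  "srs_p i = [vector [0, 0, 0], vector [1, 0, 0],
              vector [- 1 / 2, sqrt 3 / 2, 0], vector [- 1 / 2, - sqrt 3 / 2, 0]] ! i"

definition srs_g1 :: "real ^ 3" where
  "srs_g1 = vector [2, - 2 / sqrt 3, - sqrt (2 / 3)]"

definition srs_g2 :: "real ^ 3" where
  "srs_g2 = vector [0, 4 / sqrt 3, - sqrt (2 / 3)]"

definition srs_g3 :: "real ^ 3" where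
  "srs_g3 = vector [- 2, - 2 / sqrt 3, - sqrt (2 / 3)]"

definition srs_lattice :: "(real ^ 3) set" where
  "srs_lattice = {of_int a *\<^sub>R srs_g1 + of_int b *\<^sub>R srs_g2 + of_int c *\<^sub>R srs_g3 | a b c. True}"

definition srs_base_edges :: "(real ^ 3) set set" where
  "srs_base_edges =
     {{srs_p 0, srs_p 1}, {srs_p 0, srs_p 2}, {srs_p 0, srs_p 3},
      {srs_p 1, srs_p 2 + srs_g1}, {srs_p 2, srs_p 3 + srs_g2}, {srs_p 3, srs_p 1 + srs_g3}}"

definition srs :: "(real ^ 3, 3) network" where
  "srs = \<lparr>verts = {srs_p i + g | i g. i \<le> 3 \<and> g \<in> srs_lattice},
          edges = {(\<lambda>x. x + g) ` e | g e. g \<in> srs_lattice \<and> e \<in> srs_base_edges},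
          pos = (\<lambda>x. x),
          lattice = srs_lattice,
          act = (\<lambda>g x. x + g)\<rparr>"

definition body_centred_cubic :: "(real ^ 3) set \<Rightarrow> bool" where
  "body_centred_cubic \<Lambda> \<longleftrightarrow>
     (\<exists>c (A :: real ^ 3 \<Rightarrow> real ^ 3). c > 0 \<and> orthogonal_transformation A \<and>
        \<Lambda> = (\<lambda>x. c *\<^sub>R A x) ` ({x. \<forall>i. x $ i \<in> \<int>} \<union> {x. \<forall>i. x $ i - 1 / 2 \<in> \<int>}))"

end

theory Submission
  imports Defs
begin

text \<open>
  A spanning tree of the quotient graph together with three further edges whose shifts are linearly
  independent carries three fundamental cycles. Record for every edge \<open>c\<close> the vector \<open>v c\<close> of its
  coefficients in these cycles. Descendant sets of a tree are laminar, so after a unimodular change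
  of the cycles all \<open>v c\<close> are roots \<open>eps i - eps j\<close> of type \<open>A\<^sub>3\<close> or 0. If \<open>x c\<close> is the edge vector,
  then the periods \<open>l i = (\<Sum>c. v c $ i *\<^sub>R x c)\<close> lie in the lattice and are independent, whence
  \<open>V \<le> \<bar>det l\<bar>\<close>. A linear map \<open>B\<close> that sends all roots to unit vectors calibrates the length:
  \<open>L \<ge> (\<Sum>c. x c \<bullet> B (v c))\<close>, and the right-hand side depends on the periods only. It equals
  \<open>(p \<bullet> (l 2 + l 3) + q \<bullet> (l 1 + l 3) + r \<bullet> (l 1 + l 2)) / sqrt 2\<close> for an orthonormal frame
  \<open>p, q, r\<close>. Choosing the frame by Gram-Schmidt from \<open>l 2 + l 3, l 1 + l 3, l 1 + l 2\<close> makes the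
  product of the three terms \<open>2 * \<bar>det l\<bar>\<close>, and the inequality between the arithmetic and the
  geometric mean concludes.

  In the equality case every edge has the direction \<open>B (v c)\<close>, and all six classes of roots have the
  same total length. When no vertex of degree 2 can be removed, all degrees are at least 3 since the
  directions at a vertex are nonzero roots with sum 0. Counting leaves 4 vertices and 6 edges, one
  for each class of roots, and the vertices are directed triangles on the four indices; only the srs
  network fits.
\<close>

subsection \<open>Lattices\<close>

text \<open>The obstacle is that the quotient may be an arbitrarily large graph with any number of
  independent cycles. Only three cycles are kept; an edge on none of them has
  \<open>v c = 0\<close>, so it adds length and contributes nothing to the calibrated sum.
  Determinants of triples of coefficient vectors are 0 or \<plusminus>1, because tree paths are
  totally unimodular, and in dimension three this already forces the vectors into a single root
  system. Hence one map \<open>B\<close> serves every graph and no graphs are enumerated.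
  \<open>B\<close> sends the twelve nonzero roots to the directions from the centre of a cube to the
  midpoints of its edges. The three pairings are the diagonal of a triangular matrix, whence their
  product; the factor 2 is the determinant of the passage from \<open>l i\<close> to the pair sums.
  The constant comes from \<open>27 * (2 * |det l|) <= (sqrt 2 * L) ^ 3\<close>. The frame is free
  in the inequality, and in the equality case this freedom is used: Gram-Schmidt started from each
  of the three pair sums shows that these are orthogonal and of equal length.\<close>

lemma vector_matrix_rows:
  fixes g :: "'n::finite \<Rightarrow> real ^ 'n"
  shows "y v* (\<chi> i. g i) = (\<Sum>i\<in>UNIV. y $ i *\<^sub>R g i)"
  by (simp add: vec_eq_iff vector_matrix_mult_def mult.commute)

lemma matrix_mult_rows:
  fixes g :: "'n::finite \<Rightarrow> real ^ 'n" and A :: "real ^ 'n ^ 'n"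
  shows "A ** (\<chi> i. g i) = (\<chi> i. \<Sum>j\<in>UNIV. A $ i $ j *\<^sub>R g j)"
  by (simp add: vec_eq_iff matrix_matrix_mult_def)

lemma independent_family_iff_det:
  fixes g :: "'n::finite \<Rightarrow> real ^ 'n"
  shows "inj g \<and> independent (range g) \<longleftrightarrow> det (\<chi> i. g i) \<noteq> 0"
proof
  assume a: "inj g \<and> independent (range g)"
  have "span (range g) = UNIV"
    using a card_ge_dim_independent[of "range g" UNIV] by (auto simp: card_image)
  moreover have "rows (\<chi> i. g i) = range g"
    by (auto simp: rows_def row_def vec_eq_iff)
  ultimately show "det (\<chi> i. g i) \<noteq> 0"
    using invertible_det_nz matrix_left_invertible_span_rows invertible_left_inverse by metis
next
  assume d: "det (\<chi> i. g i) \<noteq> 0"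
  have i: "inj g"
  proof (rule injI, rule ccontr)
    fix i j assume "g i = g j" "i \<noteq> j"
    then have "det (\<chi> i. g i) = 0"
      using det_identical_rows[of i j "\<chi> i. g i"] by (auto simp: row_def vec_eq_iff)
    then show False using d by simp
  qed
  have "rows (\<chi> i. g i) = range g"
    by (auto simp: rows_def row_def vec_eq_iff)
  then have "independent (range g)"
    using d det_dependent_rows[of "\<chi> i. g i"] by (metis dependent_vec_eq)
  then show "inj g \<and> independent (range g)" using i by simp
qed

text \<open>Independence is split off from \<open>lattice_basis\<close>, so that arbitrary families
  of lattice vectors are covered too.\<close>

definition zspan :: "('n \<Rightarrow> real ^ 'n) \<Rightarrow> (real ^ 'n) set" where
  "zspan g = {\<Sum>i\<in>UNIV. of_int (a i) *\<^sub>R g i | a :: 'n \<Rightarrow> int. True}"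

lemma lattice_basis_iff:
  fixes g :: "'n::finite \<Rightarrow> real ^ 'n"
  shows "lattice_basis \<Lambda> g \<longleftrightarrow> det (\<chi> i. g i) \<noteq> 0 \<and> \<Lambda> = zspan g"
  using independent_family_iff_det[of g] by (auto simp: lattice_basis_def zspan_def)

lemma zspanE:
  assumes "x \<in> zspan g"
  obtains a :: "'n::finite \<Rightarrow> int" where "x = (\<Sum>i\<in>UNIV. of_int (a i) *\<^sub>R g i)"
  using assms by (auto simp: zspan_def)

lemma zspanI: "(\<Sum>i\<in>UNIV. of_int (a i) *\<^sub>R g i) \<in> zspan g"
  by (auto simp: zspan_def)

lemma zspan_add: "x \<in> zspan g \<Longrightarrow> y \<in> zspan g \<Longrightarrow> x + y \<in> zspan g"
  for g :: "'n::finite \<Rightarrow> real ^ 'n"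
proof -
  assume "x \<in> zspan g" "y \<in> zspan g"
  then obtain a b where "x = (\<Sum>i\<in>UNIV. of_int (a i) *\<^sub>R g i)" "y = (\<Sum>i\<in>UNIV. of_int (b i) *\<^sub>R g i)"
    by (auto elim!: zspanE)
  then have "x + y = (\<Sum>i\<in>UNIV. of_int (a i + b i) *\<^sub>R g i)"
    by (simp add: scaleR_add_left sum.distrib)
  then show "x + y \<in> zspan g" using zspanI[of "\<lambda>i. a i + b i" g] by simp
qed

lemma zspan_uminus: "x \<in> zspan g \<Longrightarrow> - x \<in> zspan g"
  for g :: "'n::finite \<Rightarrow> real ^ 'n"
proof -
  assume "x \<in> zspan g"
  then obtain a where "x = (\<Sum>i\<in>UNIV. of_int (a i) *\<^sub>R g i)"
    by (auto elim!: zspanE)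
  then have "- x = (\<Sum>i\<in>UNIV. of_int (- a i) *\<^sub>R g i)"
    by (simp add: sum_negf)
  then show "- x \<in> zspan g" by (auto simp: zspan_def simp del: of_int_minus)
qed

lemma zspan_zero: "0 \<in> zspan g"
  for g :: "'n::finite \<Rightarrow> real ^ 'n"
  unfolding zspan_def by (rule CollectI, rule exI[of _ "\<lambda>_. 0"]) simp

lemma zspan_base: "g i \<in> zspan g"
  for g :: "'n::finite \<Rightarrow> real ^ 'n"
proof -
  have "g i = (\<Sum>j\<in>UNIV. of_int (if j = i then 1 else 0) *\<^sub>R g j)"
    by (simp add: if_distrib[of "\<lambda>x. of_int x *\<^sub>R _"] sum.delta cong: if_cong)
  then show ?thesis using zspanI[of "\<lambda>j. if j = i then 1 else 0" g] by simp
qed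

lemma zspan_int_mult: "x \<in> zspan g \<Longrightarrow> of_int k *\<^sub>R x \<in> zspan g"
  for g :: "'n::finite \<Rightarrow> real ^ 'n"
proof -
  assume "x \<in> zspan g"
  then obtain a where "x = (\<Sum>i\<in>UNIV. of_int (a i) *\<^sub>R g i)"
    by (auto elim!: zspanE)
  then have "of_int k *\<^sub>R x = (\<Sum>i\<in>UNIV. of_int (k * a i) *\<^sub>R g i)"
    by (simp add: scaleR_sum_right)
  then show "of_int k *\<^sub>R x \<in> zspan g" by (auto simp: zspan_def simp del: of_int_mult)
qed

lemma zspan_sum: "(\<And>i. i \<in> I \<Longrightarrow> f i \<in> zspan g) \<Longrightarrow> (\<Sum>i\<in>I. f i) \<in> zspan g"
  for g :: "'n::finite \<Rightarrow> real ^ 'n"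
  by (induction I rule: infinite_finite_induct) (auto simp: zspan_zero zspan_add)

lemma zspan_least:
  fixes g :: "'n::finite \<Rightarrow> real ^ 'n"
  assumes "\<And>i. l i \<in> zspan g"
  shows "zspan l \<subseteq> zspan g"
  using assms by (auto simp: zspan_def[of l] intro!: zspan_sum zspan_int_mult)

section \<open>Sublattices and integral transition matrices\<close>

lemma det_int_matrix:
  fixes A :: "real ^ 'n ^ 'n"
  assumes "\<And>i j. A $ i $ j \<in> \<int>"
  shows "det A \<in> \<int>"
  unfolding det_def by (intro Ints_sum Ints_mult Ints_prod) (auto simp: assms)

lemma zspan_family_matrix:
  fixes g :: "'n::finite \<Rightarrow> real ^ 'n"
  assumes "\<And>i. l i \<in> zspan g"
  shows "\<exists>A :: real ^ 'n ^ 'n. (\<forall>i j. A $ i $ j \<in> \<int>) \<and> (\<chi> i. l i) = A ** (\<chi> i. g i)"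
proof -
  have "\<forall>i. \<exists>a :: 'n \<Rightarrow> int. l i = (\<Sum>j\<in>UNIV. of_int (a j) *\<^sub>R g j)"
    using assms by (auto elim!: zspanE)
  then obtain a :: "'n \<Rightarrow> 'n \<Rightarrow> int" where
    a: "\<And>i. l i = (\<Sum>j\<in>UNIV. of_int (a i j) *\<^sub>R g j)" by metis
  show ?thesis
    by (rule exI[of _ "\<chi> i j. of_int (a i j)"]) (auto simp: matrix_mult_rows a)
qed

text \<open>The transition matrix is integral. For independent \<open>g\<close>, the number
  \<open>k\<close> is up to sign the index of the sublattice spanned by \<open>l\<close>, and it is
  0 when \<open>l\<close> is dependent.\<close>

lemma zspan_det:
  fixes g :: "'n::finite \<Rightarrow> real ^ 'n"
  assumes "\<And>i. l i \<in> zspan g"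
  obtains k :: int where "det (\<chi> i. l i) = of_int k * det (\<chi> i. g i)"
proof -
  obtain A :: "real ^ 'n ^ 'n" where A: "\<And>i j. A $ i $ j \<in> \<int>"
    and lA: "(\<chi> i. l i) = A ** (\<chi> i. g i)" using zspan_family_matrix[of l g] assms by blast
  obtain k where "det A = of_int k" using det_int_matrix[of A] A by (auto elim: Ints_cases)
  then have "det (\<chi> i. l i) = of_int k * det (\<chi> i. g i)" by (simp only: lA det_mul)
  then show thesis by (rule that)
qed

text \<open>The integral transition matrix has determinant \<plusminus>1, so Cramer's rule gives an
  integral inverse.\<close>

lemma zspan_eq_if_det_eq:
  fixes g :: "'n::finite \<Rightarrow> real ^ 'n"
  assumes l: "\<And>i. l i \<in> zspan g" and nz: "det (\<chi> i. g i) \<noteq> 0"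
    and eq: "\<bar>det (\<chi> i. l i)\<bar> = \<bar>det (\<chi> i. g i)\<bar>"
  shows "zspan l = zspan g"
proof
  show "zspan l \<subseteq> zspan g" by (rule zspan_least[OF l])
  obtain A :: "real ^ 'n ^ 'n" where A: "\<And>i j. A $ i $ j \<in> \<int>"
    and lA: "(\<chi> i. l i) = A ** (\<chi> i. g i)" using zspan_family_matrix[of l g] l by blast
  have dA: "\<bar>det A\<bar> = 1" using eq nz by (simp add: lA det_mul abs_mult)
  show "zspan g \<subseteq> zspan l"
  proof (rule zspan_least)
    fix i
    let ?b = "axis i 1 :: real ^ 'n"
    \<comment> \<open>\<open>x\<close> is row \<open>i\<close> of the inverse of \<open>A\<close>;
      the transpose appears because Cramer's rule solves for columns.\<close>
    define x where "x = (\<chi> k. det (\<chi> i j. if j = k then ?b $ i else transpose A $ i $ j) / det (transpose A))"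
    have "det (transpose A) \<noteq> 0" using dA by (auto simp: det_transpose)
    then have x: "transpose A *v x = ?b" using cramer[of "transpose A" x ?b] x_def by blast
    have xi: "x $ k \<in> \<int>" for k
    proof -
      have "det (\<chi> i j. if j = k then ?b $ i else transpose A $ i $ j) \<in> \<int>"
        by (rule det_int_matrix) (auto simp: A transpose_def axis_def)
      moreover have "det (transpose A) = 1 \<or> det (transpose A) = -1"
        using dA by (auto simp: det_transpose)
      ultimately show ?thesis by (auto simp: x_def)
    qed
    then have "\<forall>k. \<exists>m::int. x $ k = of_int m" by (auto elim: Ints_cases)
    then obtain a :: "'n \<Rightarrow> int" where a: "\<And>k. x $ k = of_int (a k)" by metis
    have "x v* A = ?b" using x by simp
    then have "x v* (\<chi> i. l i) = ?b v* (\<chi> i. g i)"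
      by (simp add: lA flip: vector_matrix_mul_assoc)
    then have "(\<Sum>k\<in>UNIV. x $ k *\<^sub>R l k) = (\<Sum>k\<in>UNIV. ?b $ k *\<^sub>R g k)"
      by (simp add: vector_matrix_rows)
    also have "\<dots> = g i"
      by (simp add: axis_def if_distrib[of "\<lambda>x. x *\<^sub>R _"] cong: if_cong)
    finally have "g i = (\<Sum>k\<in>UNIV. of_int (a k) *\<^sub>R l k)" by (simp add: a)
    then show "g i \<in> zspan l" by (auto simp: zspan_def)
  qed
qed

section \<open>The covolume as a determinant\<close>

lemma measure_half_open_unit_cube:
  "(({x. \<forall>i. 0 \<le> x $ i \<and> x $ i < 1}) :: (real ^ 'n) set) \<in> lmeasurable"
  "measure lebesgue ({x. \<forall>i. 0 \<le> x $ i \<and> x $ i < 1} :: (real ^ 'n) set) = 1"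
proof -
  let ?C = "{x. \<forall>i. 0 \<le> x $ i \<and> x $ i < 1} :: (real ^ 'n) set"
  let ?I = "cbox 0 1 :: (real ^ 'n) set"
  have s1: "box 0 1 \<subseteq> ?C" "?C \<subseteq> ?I" by (auto simp: mem_box_cart less_imp_le)
  \<comment> \<open>The half-open cube differs from the closed one only by a part of the
    frontier.\<close>
  have n: "negligible (sym_diff ?I ?C)"
    by (rule negligible_subset[OF negligible_frontier_interval[of 0 "1::real^'n"]]) (use s1 in auto)
  then show m: "?C \<in> lmeasurable" using lmeasurable_negligible_symdiff[of ?I ?C] by simp
  have "measure lebesgue ?C = measure lebesgue ?I"
    using n measure_negligible_symdiff[of ?I ?C] by simp
  also have "\<dots> = 1" by (simp add: content_cbox_cart interval_eq_empty_cart)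
  finally show "measure lebesgue ?C = 1" .
qed

lemma measure_fundamental_parallelepiped:
  fixes g :: "'n::_ \<Rightarrow> real ^ 'n::{finite,wellorder}"
  shows "measure lebesgue (fundamental_parallelepiped g) = \<bar>det (\<chi> i. g i)\<bar>"
proof -
  let ?C = "{x. \<forall>i. 0 \<le> x $ i \<and> x $ i < 1} :: (real ^ 'n::_) set"
  let ?M = "transpose (\<chi> i. g i)"
  have e: "fundamental_parallelepiped g = (\<lambda>x. ?M *v x) ` ?C"
  proof (intro equalityI subsetI)
    fix y assume "y \<in> fundamental_parallelepiped g"
    then obtain t where t: "\<forall>i. 0 \<le> t i \<and> t i < 1" "y = (\<Sum>i\<in>UNIV. t i *\<^sub>R g i)"
      by (auto simp: fundamental_parallelepiped_def)
    then have "y = ?M *v (\<chi> i. t i)" by (simp add: vector_matrix_rows)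
    then show "y \<in> (\<lambda>x. ?M *v x) ` ?C" using t by auto
  next
    fix y assume "y \<in> (\<lambda>x. ?M *v x) ` ?C"
    then show "y \<in> fundamental_parallelepiped g"
      by (force simp: fundamental_parallelepiped_def vector_matrix_rows)
  qed
  have "measure lebesgue ((\<lambda>x. ?M *v x) ` ?C) = \<bar>det (matrix (\<lambda>x. ?M *v x))\<bar> * measure lebesgue ?C"
    by (rule measure_linear_image) (auto simp: measure_half_open_unit_cube simp del: transpose_matrix_vector)
  then show ?thesis
    unfolding e measure_half_open_unit_cube matrix_of_matrix_vector_mul det_transpose by simp
qed

text \<open>The basis hidden in \<open>covolume\<close> is arbitrary. Two bases of one lattice have
  determinants that are integer multiples of each other, with factors satisfying
  \<open>k * m = 1\<close>.\<close>

lemma covolume_eq_det: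
  fixes g :: "'n::_ \<Rightarrow> real ^ 'n::{finite,wellorder}"
  assumes "lattice_basis \<Lambda> g"
  shows "covolume \<Lambda> = \<bar>det (\<chi> i. g i)\<bar>"
proof -
  define h where "h = (SOME g. lattice_basis \<Lambda> g)"
  have h: "lattice_basis \<Lambda> h" unfolding h_def by (rule someI[where P="lattice_basis \<Lambda>", OF assms])
  have "zspan g = zspan h" using assms h by (auto simp: lattice_basis_iff)
  then obtain k m :: int where
    k: "det (\<chi> i. g i) = of_int k * det (\<chi> i. h i)" and
    m: "det (\<chi> i. h i) = of_int m * det (\<chi> i. g i)"
    using zspan_det[of g h] zspan_det[of h g] zspan_base by metis
  have nz: "det (\<chi> i. g i) \<noteq> 0" "det (\<chi> i. h i) \<noteq> 0"
    using assms h by (auto simp: lattice_basis_iff)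
  have "of_int (k * m) * det (\<chi> i. g i) = det (\<chi> i. g i)"
    using k m by simp
  then have "k * m = 1" using nz by (metis mult_cancel_right1 of_int_eq_1_iff)
  then have "\<bar>k\<bar> = 1" by (metis zmult_eq_1_iff abs_1 abs_minus)
  then have "\<bar>real_of_int k\<bar> = 1" by linarith
  then show ?thesis
    by (simp add: covolume_def h_def[symmetric] measure_fundamental_parallelepiped k abs_mult)
qed

lemma full_lattice_zspan:
  fixes \<Lambda> :: "(real ^ 'n::{finite,wellorder}) set"
  assumes "full_lattice \<Lambda>"
  obtains g where "\<Lambda> = zspan g" "det (\<chi> i. g i) \<noteq> 0" "covolume \<Lambda> = \<bar>det (\<chi> i. g i)\<bar>"
  using assms covolume_eq_det unfolding full_lattice_def lattice_basis_iff by metis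

lemma
  fixes \<Lambda> :: "(real ^ 'n::{finite,wellorder}) set"
  assumes "full_lattice \<Lambda>"
  shows full_lattice_zero: "0 \<in> \<Lambda>"
    and full_lattice_add: "\<And>x y. x \<in> \<Lambda> \<Longrightarrow> y \<in> \<Lambda> \<Longrightarrow> x + y \<in> \<Lambda>"
    and full_lattice_uminus: "\<And>x. x \<in> \<Lambda> \<Longrightarrow> - x \<in> \<Lambda>"
    and full_lattice_diff: "\<And>x y. x \<in> \<Lambda> \<Longrightarrow> y \<in> \<Lambda> \<Longrightarrow> x - y \<in> \<Lambda>"
    and full_lattice_span: "span \<Lambda> = UNIV"
    and covolume_pos: "covolume \<Lambda> > 0"
proof -
  obtain g where g: "\<Lambda> = zspan g" "det (\<chi> i. g i) \<noteq> 0" "covolume \<Lambda> = \<bar>det (\<chi> i. g i)\<bar>"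
    using full_lattice_zspan[OF assms] by metis
  show "0 \<in> \<Lambda>" "\<And>x y. x \<in> \<Lambda> \<Longrightarrow> y \<in> \<Lambda> \<Longrightarrow> x + y \<in> \<Lambda>"
    "\<And>x. x \<in> \<Lambda> \<Longrightarrow> - x \<in> \<Lambda>"
    by (auto simp: g(1) zspan_zero zspan_add zspan_uminus)
  show "x - y \<in> \<Lambda>" if "x \<in> \<Lambda>" "y \<in> \<Lambda>" for x y
    using zspan_add[of x g "- y"] zspan_uminus[of y g] that by (auto simp: g(1))
  have "inj g" "independent (range g)" using g(2) independent_family_iff_det by blast+
  then have "span (range g) = UNIV"
    using card_ge_dim_independent[of "range g" UNIV] by (auto simp: card_image)
  moreover have "range g \<subseteq> \<Lambda>" using zspan_base by (auto simp: g(1))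
  ultimately show "span \<Lambda> = UNIV" using span_mono by blast
  show "covolume \<Lambda> > 0" using g by simp
qed

text \<open>The determinant is a nonzero integer multiple of the covolume up to sign. This allows
  the periods of a network to generate a proper sublattice.\<close>

lemma covolume_le_det:
  fixes \<Lambda> :: "(real ^ 'n::{finite,wellorder}) set"
  assumes "full_lattice \<Lambda>" "\<And>i. l i \<in> \<Lambda>" "det (\<chi> i. l i) \<noteq> 0"
  shows "covolume \<Lambda> \<le> \<bar>det (\<chi> i. l i)\<bar>"
proof -
  obtain g where g: "\<Lambda> = zspan g" "det (\<chi> i. g i) \<noteq> 0" "covolume \<Lambda> = \<bar>det (\<chi> i. g i)\<bar>"
    using full_lattice_zspan[OF assms(1)] by metis
  obtain k :: int where k: "det (\<chi> i. l i) = of_int k * det (\<chi> i. g i)"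
    using zspan_det[of l g] assms(2) g(1) by metis
  then have "k \<noteq> 0" using assms(3) by auto
  then have "1 \<le> \<bar>real_of_int k\<bar>" by linarith
  then show ?thesis using g by (simp add: k abs_mult mult_le_cancel_right1)
qed

text \<open>The case of index 1: equality of volumes turns lattice vectors found in a network into
  generators.\<close>

lemma full_lattice_eq_zspan:
  fixes \<Lambda> :: "(real ^ 'n::{finite,wellorder}) set"
  assumes "full_lattice \<Lambda>" "\<And>i. l i \<in> \<Lambda>" "\<bar>det (\<chi> i. l i)\<bar> = covolume \<Lambda>"
  shows "\<Lambda> = zspan l"
proof -
  obtain g where g: "\<Lambda> = zspan g" "det (\<chi> i. g i) \<noteq> 0" "covolume \<Lambda> = \<bar>det (\<chi> i. g i)\<bar>"
    using full_lattice_zspan[OF assms(1)] by metis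
  show ?thesis using zspan_eq_if_det_eq[of l g] assms g by simp
qed

subsection \<open>The root system \<open>A\<^sub>3\<close>\<close>

text \<open>Index 0 gets the zero vector and 1, 2, 3 the standard basis: the model of the root
  system with four symmetric coordinates, with coordinate 0 dropped.\<close>

definition eps :: "nat \<Rightarrow> real ^ 3" where
  "eps i = vector [of_bool (i = 1), of_bool (i = 2), of_bool (i = 3)]"

definition A3 :: "(real ^ 3) set" where
  "A3 = {eps i - eps j | i j. i < 4 \<and> j < 4}"

lemma eps_nth [simp]:
  "eps i $ 1 = of_bool (i = 1)" "eps i $ 2 = of_bool (i = 2)" "eps i $ 3 = of_bool (i = 3)"
  by (simp_all add: eps_def)

lemma less_4_cases: "i < 4 \<longleftrightarrow> i = 0 \<or> i = 1 \<or> i = 2 \<or> i = (3::nat)"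
  by auto

text \<open>A root has at most one coordinate 1 and at most one coordinate -1. In this form
  membership can be checked by plain arithmetic.\<close>

lemma A3_iff:
  "v \<in> A3 \<longleftrightarrow> (\<forall>i. v $ i \<in> {-1, 0, 1}) \<and> v $ 1 * v $ 2 \<le> 0 \<and> v $ 1 * v $ 3 \<le> 0 \<and> v $ 2 * v $ 3 \<le> 0"
proof
  assume "v \<in> A3"
  then show "(\<forall>i. v $ i \<in> {-1, 0, 1}) \<and> v $ 1 * v $ 2 \<le> 0 \<and> v $ 1 * v $ 3 \<le> 0 \<and> v $ 2 * v $ 3 \<le> 0"
    by (auto simp: A3_def forall_3 less_4_cases)
next
  assume a: "(\<forall>i. v $ i \<in> {-1, 0, 1}) \<and> v $ 1 * v $ 2 \<le> 0 \<and> v $ 1 * v $ 3 \<le> 0 \<and> v $ 2 * v $ 3 \<le> 0"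
  have *: "v \<in> A3" if "i < 4" "j < 4" "v $ 1 = eps i $ 1 - eps j $ 1" "v $ 2 = eps i $ 2 - eps j $ 2"
    "v $ 3 = eps i $ 3 - eps j $ 3" for i j
    using that by (auto simp: A3_def vec_eq_iff forall_3 simp del: eps_nth)
  have vs: "v $ 1 \<in> {-1, 0, 1}" "v $ 2 \<in> {-1, 0, 1}" "v $ 3 \<in> {-1, 0, 1}"
    "v $ 1 * v $ 2 \<le> 0" "v $ 1 * v $ 3 \<le> 0" "v $ 2 * v $ 3 \<le> 0" using a by auto
  \<comment> \<open>The default 0 applies when no coordinate equals 1, and likewise below when none
    equals -1.\<close>
  define i :: nat where "i = (if v $ 1 = 1 then 1 else if v $ 2 = 1 then 2 else if v $ 3 = 1 then 3 else 0)"
  define j :: nat where "j = (if v $ 1 = -1 then 1 else if v $ 2 = -1 then 2 else if v $ 3 = -1 then 3 else 0)"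
  show "v \<in> A3"
  proof (rule *[of i j])
    show "i < 4" "j < 4" by (simp_all add: i_def j_def)
    show "v $ 1 = eps i $ 1 - eps j $ 1" "v $ 2 = eps i $ 2 - eps j $ 2" "v $ 3 = eps i $ 3 - eps j $ 3"
      using vs unfolding i_def j_def by (elim insertE emptyE; simp)+
  qed
qed

text \<open>The coordinates of a root \<open>eps i - eps j\<close> in the standard model, in which the four
  coordinates add up to 0.\<close>

definition bary :: "nat \<Rightarrow> real ^ 3 \<Rightarrow> real" where
  "bary m v = (if m = 0 then - (v $ 1 + v $ 2 + v $ 3) else if m = 1 then v $ 1
    else if m = 2 then v $ 2 else v $ 3)"

lemma bary_add: "bary m (v + w) = bary m v + bary m w"
  by (simp add: bary_def)

lemma bary_eps:
  assumes "i < 4" "j < 4" "m < 4"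
  shows "bary m (eps i - eps j) = of_bool (i = m) - of_bool (j = m)"
  using assms unfolding less_4_cases by (elim disjE; simp add: bary_def)

lemma eps_diff_eq_iff:
  assumes "i < 4" "j < 4" "k < 4" "l < 4" "i \<noteq> j"
  shows "eps i - eps j = eps k - eps l \<longleftrightarrow> i = k \<and> j = l"
proof
  assume "eps i - eps j = eps k - eps l"
  then have "of_bool (i = m) - of_bool (j = m) = (of_bool (k = m) - of_bool (l = m) :: real)" if "m < 4" for m
    using that assms bary_eps by metis
  from this[OF assms(1)] this[OF assms(2)] show "i = k \<and> j = l"
    using assms(5) by (auto simp: of_bool_def split: if_splits)
qed simp

text \<open>Reading \<open>eps i - eps j\<close> as the arrow from \<open>i\<close> to \<open>j\<close>, three roots with sum 0 form a directed triangle.\<close>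

lemma A3_zero_sum_triple:
  assumes "i < 4" "j < 4" "i \<noteq> j" "v \<in> A3" "w \<in> A3" "v \<noteq> 0" "w \<noteq> 0"
    and "eps i - eps j + v + w = 0"
  obtains k where "k < 4" "k \<noteq> i" "k \<noteq> j"
    "{v, w} = {eps j - eps k, eps k - eps i}"
proof -
  obtain a b c d where ab: "a < 4" "b < 4" "v = eps a - eps b" "c < 4" "d < 4" "w = eps c - eps d"
    using assms(4,5) by (auto simp: A3_def)
  have "a \<noteq> b" "c \<noteq> d" using assms ab by auto
  have s: "of_bool (i = m) - of_bool (j = m) + (of_bool (a = m) - of_bool (b = m))
      + (of_bool (c = m) - of_bool (d = m)) = (0::real)" if "m < 4" for m
  proof -
    have "bary m (eps i - eps j + v + w) = 0" by (simp only: assms(8)) (simp add: bary_def)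
    then show ?thesis using that assms(1,2) ab by (simp add: bary_add bary_eps del: eps_nth)
  qed
  \<comment> \<open>Coordinate \<open>i\<close> of the first root is 1, so another root has to end
    at \<open>i\<close>; in the same way another root has to start at \<open>j\<close>.\<close>
  have bd: "b = i \<or> d = i"
    using s[OF assms(1)] assms(3) by (auto simp: of_bool_def split: if_splits)
  have ac: "a = j \<or> c = j"
    using s[OF assms(2)] assms(3) by (auto simp: of_bool_def split: if_splits)
  \<comment> \<open>One root cannot cancel the first one alone, since the third would then be
    0.\<close>
  have n1: "\<not> (a = j \<and> b = i)"
    using s[OF ab(4)] \<open>c \<noteq> d\<close> by auto
  have n2: "\<not> (c = j \<and> d = i)"
    using s[OF ab(1)] \<open>a \<noteq> b\<close> by auto
  have "(a = j \<and> d = i \<and> b = c \<and> b \<noteq> i \<and> b \<noteq> j) \<or> (c = j \<and> b = i \<and> a = d \<and> a \<noteq> i \<and> a \<noteq> j)"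
  proof (cases "a = j")
    case True
    then have "d = i" "b \<noteq> i" "b \<noteq> j" using bd n1 \<open>a \<noteq> b\<close> by auto
    then show ?thesis using s[OF ab(2)] True by (auto simp: of_bool_def split: if_splits)
  next
    case False
    then have "c = j" "b = i" "a \<noteq> i" using ac bd n2 \<open>a \<noteq> b\<close> by auto
    then show ?thesis using s[OF ab(1)] False by (auto simp: of_bool_def split: if_splits)
  qed
  then show thesis using that[of b] that[of a] ab by (auto simp: insert_commute)
qed

text \<open>The hypotheses express, for sign vectors containing the standard basis, that all
  determinants of triples are \<open>0\<close> or \<open>\<plusminus>1\<close>.\<close>

lemma sign_vectors_to_A3:
  fixes K :: "(real ^ 3) set"
  assumes sgn: "\<And>k i. k \<in> K \<Longrightarrow> k $ i \<in> {-1, 0, 1}"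
    and pair: "\<And>k k' i j. k \<in> K \<Longrightarrow> k' \<in> K \<Longrightarrow> i \<noteq> j \<Longrightarrow> (k $ i * k $ j) * (k' $ i * k' $ j) \<ge> 0"
    and triple: "\<And>k k' k''. k \<in> K \<Longrightarrow> k' \<in> K \<Longrightarrow> k'' \<in> K \<Longrightarrow>
      k $ 3 = 0 \<Longrightarrow> k' $ 1 = 0 \<Longrightarrow> k'' $ 2 = 0 \<Longrightarrow>
      (k $ 1 * k $ 2) * (k' $ 2 * k' $ 3) * (k'' $ 1 * k'' $ 3) \<le> 0"
  shows "\<exists>W :: real ^ 3 ^ 3. (\<forall>i j. W $ i $ j \<in> \<int>) \<and> \<bar>det W\<bar> = 1 \<and> (\<forall>k\<in>K. W *v k \<in> A3)"
proof (cases "\<exists>e\<in>K. \<forall>i. e $ i \<noteq> 0")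
  case True
  then obtain e where e: "e \<in> K" "e $ 1 \<noteq> 0" "e $ 2 \<noteq> 0" "e $ 3 \<noteq> 0" by blast
  have e1: "e $ 1 = 1 \<or> e $ 1 = -1" "e $ 2 = 1 \<or> e $ 2 = -1" "e $ 3 = 1 \<or> e $ 3 = -1"
    using e sgn[of e] by auto
  \<comment> \<open>Multiplying by the signs of the full vector \<open>e\<close> makes the
    coordinates of each vector weakly of one sign, by \<open>pair\<close>.\<close>
  define u where "u k = (vector [e $ 1 * k $ 1, e $ 2 * k $ 2, e $ 3 * k $ 3] :: real ^ 3)" for k :: "real ^ 3"
  have u: "u k $ 1 = e $ 1 * k $ 1" "u k $ 2 = e $ 2 * k $ 2" "u k $ 3 = e $ 3 * k $ 3" for k
    by (simp_all add: u_def)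
  have us: "u k $ 1 \<in> {-1,0,1}" "u k $ 2 \<in> {-1,0,1}" "u k $ 3 \<in> {-1,0,1}"
    "u k $ 1 * u k $ 2 \<ge> 0" "u k $ 2 * u k $ 3 \<ge> 0" "u k $ 1 * u k $ 3 \<ge> 0"
    if "k \<in> K" for k
  proof -
    show "u k $ 1 \<in> {-1,0,1}" "u k $ 2 \<in> {-1,0,1}" "u k $ 3 \<in> {-1,0,1}"
      using sgn[OF that, of 1] sgn[OF that, of 2] sgn[OF that, of 3] e1 by (auto simp: u)
    have "u k $ 1 * u k $ 2 = (k $ 1 * k $ 2) * (e $ 1 * e $ 2)"
      "u k $ 2 * u k $ 3 = (k $ 2 * k $ 3) * (e $ 2 * e $ 3)"
      "u k $ 1 * u k $ 3 = (k $ 1 * k $ 3) * (e $ 1 * e $ 3)" by (simp_all add: u)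
    then show "u k $ 1 * u k $ 2 \<ge> 0" "u k $ 2 * u k $ 3 \<ge> 0" "u k $ 1 * u k $ 3 \<ge> 0"
      using pair[OF that e(1), of 1 2] pair[OF that e(1), of 2 3] pair[OF that e(1), of 1 3] by simp_all
  qed
  \<comment> \<open>Vectors with the three two-element supports would have determinant \<plusminus>2
    together, which \<open>triple\<close> excludes.\<close>
  have missing: "(\<forall>k\<in>K. u k $ 1 * u k $ 3 \<noteq> 0 \<longrightarrow> u k $ 2 \<noteq> 0) \<or>
      (\<forall>k\<in>K. u k $ 1 * u k $ 2 \<noteq> 0 \<longrightarrow> u k $ 3 \<noteq> 0) \<or>
      (\<forall>k\<in>K. u k $ 2 * u k $ 3 \<noteq> 0 \<longrightarrow> u k $ 1 \<noteq> 0)"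
  proof (rule ccontr)
    assume "\<not> ?thesis"
    then obtain k k' k'' where k: "k \<in> K" "k' \<in> K" "k'' \<in> K"
      "u k $ 1 * u k $ 2 \<noteq> 0" "u k $ 3 = 0" "u k' $ 2 * u k' $ 3 \<noteq> 0" "u k' $ 1 = 0"
      "u k'' $ 1 * u k'' $ 3 \<noteq> 0" "u k'' $ 2 = 0"
      by blast
    then have p: "u k $ 1 * u k $ 2 > 0" "u k' $ 2 * u k' $ 3 > 0" "u k'' $ 1 * u k'' $ 3 > 0"
      using us[of k] us[of k'] us[of k''] by (metis order_le_less)+
    have "(k $ 1 * k $ 2) * (k' $ 2 * k' $ 3) * (k'' $ 1 * k'' $ 3) \<le> 0"
      using k e by (intro triple) (auto simp: u)
    moreover have "(u k $ 1 * u k $ 2) * (u k' $ 2 * u k' $ 3) * (u k'' $ 1 * u k'' $ 3)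
        = (k $ 1 * k $ 2) * (k' $ 2 * k' $ 3) * (k'' $ 1 * k'' $ 3)"
      using e1 by (auto simp: u)
    ultimately show False using mult_pos_pos[OF mult_pos_pos[OF p(1,2)] p(3)] by linarith
  qed
  define D where "D = (vector [vector [e $ 1, 0, 0], vector [0, e $ 2, 0], vector [0, 0, e $ 3]] :: real ^ 3 ^ 3)"
  have Du: "D *v k = u k" for k
    by (simp add: D_def u_def vec_eq_iff matrix_vector_mult_def forall_3 sum_3)
  have D: "\<bar>det D\<bar> = 1" "\<And>i j. D $ i $ j \<in> \<int>"
  proof -
    show "\<bar>det D\<bar> = 1" using e1 by (auto simp: D_def det_3)
    show "D $ i $ j \<in> \<int>" for i j using e1 exhaust_3[of i] exhaust_3[of j] by (auto simp: D_def)
  qed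
  have finish: ?thesis if W: "\<And>i j. W $ i $ j \<in> \<int>" "\<bar>det W\<bar> = 1" "\<And>k. k \<in> K \<Longrightarrow> W *v u k \<in> A3" for W :: "real ^ 3 ^ 3"
  proof (rule exI[of _ "W ** D"], intro conjI allI ballI)
    show "(W ** D) $ i $ j \<in> \<int>" for i j
      using W(1) D(2) by (auto simp: matrix_matrix_mult_def sum_3 intro!: Ints_add Ints_mult)
    show "\<bar>det (W ** D)\<bar> = 1" using W(2) D(1) by (simp add: det_mul abs_mult)
    show "(W ** D) *v k \<in> A3" if "k \<in> K" for k
      using W(3)[OF that] by (simp add: Du flip: matrix_vector_mul_assoc)
  qed
  from missing show ?thesis
  proof (elim disjE)
    assume m: "\<forall>k\<in>K. u k $ 1 * u k $ 3 \<noteq> 0 \<longrightarrow> u k $ 2 \<noteq> 0"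
    \<comment> \<open>With the support {1, 3} missing, every support is an interval. Consecutive
      differences send the interval from \<open>a\<close> to \<open>b\<close> to
      \<open>eps b - eps (a - 1)\<close> up to sign. The other two cases only reorder the
      coordinates.\<close>
    let ?W = "vector [vector [1, -1, 0], vector [0, 1, -1], vector [0, 0, 1]] :: real ^ 3 ^ 3"
    show ?thesis
    proof (rule finish[of ?W])
      show "?W *v u k \<in> A3" if "k \<in> K" for k
        using us[OF that] m[rule_format, OF that]
        unfolding A3_iff by (auto simp: matrix_vector_mult_def forall_3 sum_3)
      show "?W $ i $ j \<in> \<int>" for i j using exhaust_3[of i] exhaust_3[of j] by auto
      show "\<bar>det ?W\<bar> = 1" by (simp add: det_3)
    qed
  next
    assume m: "\<forall>k\<in>K. u k $ 1 * u k $ 2 \<noteq> 0 \<longrightarrow> u k $ 3 \<noteq> 0"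
    let ?W = "vector [vector [1, 0, -1], vector [0, -1, 1], vector [0, 1, 0]] :: real ^ 3 ^ 3"
    show ?thesis
    proof (rule finish[of ?W])
      show "?W *v u k \<in> A3" if "k \<in> K" for k
        using us[OF that] m[rule_format, OF that]
        unfolding A3_iff by (auto simp: matrix_vector_mult_def forall_3 sum_3)
      show "?W $ i $ j \<in> \<int>" for i j using exhaust_3[of i] exhaust_3[of j] by auto
      show "\<bar>det ?W\<bar> = 1" by (simp add: det_3)
    qed
  next
    assume m: "\<forall>k\<in>K. u k $ 2 * u k $ 3 \<noteq> 0 \<longrightarrow> u k $ 1 \<noteq> 0"
    let ?W = "vector [vector [-1, 1, 0], vector [1, 0, -1], vector [0, 0, 1]] :: real ^ 3 ^ 3"
    show ?thesis
    proof (rule finish[of ?W])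
      show "?W *v u k \<in> A3" if "k \<in> K" for k
        using us[OF that] m[rule_format, OF that]
        unfolding A3_iff by (auto simp: matrix_vector_mult_def forall_3 sum_3)
      show "?W $ i $ j \<in> \<int>" for i j using exhaust_3[of i] exhaust_3[of j] by auto
      show "\<bar>det ?W\<bar> = 1" by (simp add: det_3)
    qed
  qed
next
  case False
  then have nofull: "k $ 1 = 0 \<or> k $ 2 = 0 \<or> k $ 3 = 0" if "k \<in> K" for k
    using that by (auto simp: forall_3)
  have both: "(\<forall>k\<in>K. k $ i * k $ j \<le> 0) \<or> (\<forall>k\<in>K. - (k $ i * k $ j) \<le> 0)" if "i \<noteq> j" for i j
  proof (rule ccontr)
    assume "\<not> ?thesis"
    then obtain k k' where "k \<in> K" "k' \<in> K" "k $ i * k $ j > 0" "k' $ i * k' $ j < 0"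
      by (auto simp: not_le)
    then show False using pair[of k k' i j] that mult_pos_neg[of "k $ i * k $ j" "k' $ i * k' $ j"] by simp
  qed
  \<comment> \<open>Without a full vector it suffices to change the signs of coordinates 2 and 3 in
    such a way that all products become at most 0.\<close>
  have "\<exists>s t :: real. s \<in> {-1, 1} \<and> t \<in> {-1, 1} \<and> (\<forall>k\<in>K. s * (k $ 1 * k $ 2) \<le> 0)
      \<and> (\<forall>k\<in>K. t * (k $ 1 * k $ 3) \<le> 0) \<and> (\<forall>k\<in>K. s * t * (k $ 2 * k $ 3) \<le> 0)" (is "\<exists>s t. ?P s t")
  proof (rule ccontr)
    assume n: "\<not> ?thesis"
    have ex: "\<exists>a::real. (a = 1 \<or> a = -1) \<and> (\<forall>k\<in>K. a * (k $ i * k $ j) \<le> 0)" if "i \<noteq> j" for i j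
      using both[OF that]
    proof
      assume "\<forall>k\<in>K. k $ i * k $ j \<le> 0"
      then show ?thesis by (intro exI[of _ 1]) simp
    next
      assume "\<forall>k\<in>K. - (k $ i * k $ j) \<le> 0"
      then show ?thesis by (intro exI[of _ "-1"]) simp
    qed
    obtain a b c :: real where abc: "a = 1 \<or> a = -1" "b = 1 \<or> b = -1" "c = 1 \<or> c = -1"
      "\<forall>k\<in>K. a * (k $ 1 * k $ 2) \<le> 0" "\<forall>k\<in>K. b * (k $ 2 * k $ 3) \<le> 0" "\<forall>k\<in>K. c * (k $ 1 * k $ 3) \<le> 0"
      using ex[of 1 2] ex[of 2 3] ex[of 1 3] by auto
    \<comment> \<open>\<open>?P\<close> couples the three pairs of coordinates: the sign for (2, 3)
      is the product of the other two. A pair whose product vanishes on all of \<open>K\<close> has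
      a free sign, so under \<open>n\<close> all three pairs must occur.\<close>
    have nP: "\<not> ?P (b * c) c" "\<not> ?P a (a * b)" "\<not> ?P a c" using n by blast+
    have "\<exists>k\<in>K. k $ 1 * k $ 2 \<noteq> 0"
    proof (rule ccontr)
      assume z: "\<not> ?thesis"
      have "b * c * c = b" "b * c \<in> {-1, 1}" "c \<in> {-1,1}" using abc(2,3) by auto
      then show False using nP(1) abc(5,6) z by auto
    qed
    moreover have "\<exists>k\<in>K. k $ 1 * k $ 3 \<noteq> 0"
    proof (rule ccontr)
      assume z: "\<not> ?thesis"
      have "a * (a * b) = b" "a * b \<in> {-1, 1}" "a \<in> {-1,1}" using abc(1,2) by auto
      then show False using nP(2) abc(4,5) z by auto
    qed
    moreover have "\<exists>k\<in>K. k $ 2 * k $ 3 \<noteq> 0"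
    proof (rule ccontr)
      assume z: "\<not> ?thesis"
      have "a \<in> {-1, 1}" "c \<in> {-1,1}" using abc(1,3) by auto
      then show False using nP(3) abc(4,6) z by auto
    qed
    ultimately have "(\<exists>k\<in>K. k $ 1 * k $ 2 \<noteq> 0) \<and> (\<exists>k\<in>K. k $ 2 * k $ 3 \<noteq> 0) \<and> (\<exists>k\<in>K. k $ 1 * k $ 3 \<noteq> 0)"
      by blast
    then obtain k k' k'' where k: "k \<in> K" "k' \<in> K" "k'' \<in> K" "k $ 1 * k $ 2 \<noteq> 0"
      "k' $ 2 * k' $ 3 \<noteq> 0" "k'' $ 1 * k'' $ 3 \<noteq> 0" by blast
    have z: "k $ 3 = 0" "k' $ 1 = 0" "k'' $ 2 = 0" using nofull k by auto
    define s r t where "s = - (k $ 1 * k $ 2)" and "r = - (k' $ 2 * k' $ 3)" and "t = - (k'' $ 1 * k'' $ 3)"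
    have st: "s \<in> {-1,1}" "t \<in> {-1,1}" "r \<in> {-1,1}"
      using k sgn[OF k(1), of 1] sgn[OF k(1), of 2] sgn[OF k(2), of 2] sgn[OF k(2), of 3]
        sgn[OF k(3), of 1] sgn[OF k(3), of 3] by (auto simp: s_def t_def r_def)
    \<comment> \<open>\<open>triple\<close> applies because no vector is full, and it couples the
      three signs exactly as \<open>?P\<close> demands.\<close>
    have "s * t * r \<ge> 0" using triple[OF k(1-3) z] by (simp add: s_def t_def r_def mult_ac)
    then have r: "r = s * t" using st by auto
    have "s * (h $ 1 * h $ 2) \<le> 0 \<and> t * (h $ 1 * h $ 3) \<le> 0 \<and> r * (h $ 2 * h $ 3) \<le> 0" if "h \<in> K" for h
      using pair[OF k(1) that, of 1 2] pair[OF k(2) that, of 2 3] pair[OF k(3) that, of 1 3]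
      by (auto simp: s_def t_def r_def)
    then have "?P s t" using st r by auto
    then show False using n by blast
  qed
  then obtain s t :: real where st: "s \<in> {-1, 1}" "t \<in> {-1, 1}" "\<And>k. k \<in> K \<Longrightarrow> s * (k $ 1 * k $ 2) \<le> 0"
      "\<And>k. k \<in> K \<Longrightarrow> t * (k $ 1 * k $ 3) \<le> 0" "\<And>k. k \<in> K \<Longrightarrow> s * t * (k $ 2 * k $ 3) \<le> 0" by blast
  let ?W = "vector [vector [1, 0, 0], vector [0, s, 0], vector [0, 0, t]] :: real ^ 3 ^ 3"
  have "?W *v k \<in> A3" if "k \<in> K" for k
  proof -
    have "s * k $ i \<in> {-1,0,1}" "t * k $ i \<in> {-1,0,1}" for i
      using sgn[OF that, of i] st(1,2) by auto
    then show ?thesis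
      using st(3-5)[OF that] sgn[OF that]
      unfolding A3_iff by (auto simp: matrix_vector_mult_def forall_3 sum_3 mult_ac)
  qed
  moreover have "?W $ i $ j \<in> \<int>" for i j
    using st(1,2) exhaust_3[of i] exhaust_3[of j] by auto
  moreover have "\<bar>det ?W\<bar> = 1" using st(1,2) by (auto simp: det_3)
  ultimately show ?thesis by blast
qed

subsection \<open>The calibration inequality\<close>

lemma amgm3:
  fixes a b c :: real
  assumes "a \<ge> 0" "b \<ge> 0" "c \<ge> 0"
  shows "27 * (a * b * c) \<le> (a + b + c) ^ 3"
    and "27 * (a * b * c) = (a + b + c) ^ 3 \<Longrightarrow> a = b \<and> b = c"
proof -
  \<comment> \<open>Both summands are nonnegative, and the first one vanishes only for
    \<open>a = b = c\<close>, which settles equality.\<close>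
  have e: "2 * ((a + b + c) ^ 3 - 27 * (a * b * c)) =
    (a + b + c) * ((a - b)\<^sup>2 + (b - c)\<^sup>2 + (c - a)\<^sup>2) + 6 * (a * (b - c)\<^sup>2 + b * (c - a)\<^sup>2 + c * (a - b)\<^sup>2)"
    by (simp add: power3_eq_cube power2_eq_square algebra_simps)
  have n: "(a + b + c) * ((a - b)\<^sup>2 + (b - c)\<^sup>2 + (c - a)\<^sup>2) \<ge> 0"
    "a * (b - c)\<^sup>2 + b * (c - a)\<^sup>2 + c * (a - b)\<^sup>2 \<ge> 0"
    using assms by auto
  have "0 \<le> 2 * ((a + b + c) ^ 3 - 27 * (a * b * c))" unfolding e using n by simp
  then show "27 * (a * b * c) \<le> (a + b + c) ^ 3" by (simp add: zero_le_mult_iff)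
  assume "27 * (a * b * c) = (a + b + c) ^ 3"
  then have "(a + b + c) * ((a - b)\<^sup>2 + (b - c)\<^sup>2 + (c - a)\<^sup>2)
      + 6 * (a * (b - c)\<^sup>2 + b * (c - a)\<^sup>2 + c * (a - b)\<^sup>2) = 0" unfolding e[symmetric] by simp
  then have "(a + b + c) * ((a - b)\<^sup>2 + (b - c)\<^sup>2 + (c - a)\<^sup>2) = 0"
    using n by (smt (verit))
  then consider "a + b + c = 0" | "(a - b)\<^sup>2 + (b - c)\<^sup>2 + (c - a)\<^sup>2 = 0" by auto
  then show "a = b \<and> b = c"
  proof cases
    case 1 then show ?thesis using assms by linarith
  next
    case 2
    then have "(a - b)\<^sup>2 = 0" "(b - c)\<^sup>2 = 0"
      using zero_le_power2[of "a - b"] zero_le_power2[of "b - c"] zero_le_power2[of "c - a"] by linarith+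
    then show ?thesis by simp
  qed
qed

definition orthonormal3 :: "real ^ 3 \<Rightarrow> real ^ 3 \<Rightarrow> real ^ 3 \<Rightarrow> bool" where
  "orthonormal3 p q r \<longleftrightarrow> p \<bullet> p = 1 \<and> q \<bullet> q = 1 \<and> r \<bullet> r = 1 \<and> p \<bullet> q = 0 \<and> p \<bullet> r = 0 \<and> q \<bullet> r = 0"

text \<open>In the Gram-Schmidt frame the matrix of \<open>x\<close>, \<open>y\<close>,
  \<open>z\<close> is triangular, so its determinant is up to sign the product of the three
  pairings. That \<open>p\<close> is parallel to \<open>x\<close> serves the equality case.\<close>

lemma gram_schmidt3:
  fixes x y z :: "real ^ 3"
  assumes "det (vector [x, y, z] :: real ^ 3 ^ 3) \<noteq> 0"
  obtains p q r where "orthonormal3 p q r" "p \<bullet> x = norm x" "p \<bullet> x > 0" "q \<bullet> y > 0" "r \<bullet> z > 0"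
    "(p \<bullet> x) * (q \<bullet> y) * (r \<bullet> z) = \<bar>det (vector [x, y, z] :: real ^ 3 ^ 3)\<bar>"
proof -
  let ?D = "det (vector [x, y, z] :: real ^ 3 ^ 3)"
  have D: "?D = cross3 x y \<bullet> z"
    by (metis dot_cross_det cross_triple inner_commute)
  have "x \<noteq> 0" using assms D by auto
  define p where "p = x /\<^sub>R norm x"
  have pp: "p \<bullet> p = 1" using \<open>x \<noteq> 0\<close> by (simp add: p_def dot_square_norm power2_eq_square)
  have px: "p \<bullet> x = norm x" using \<open>x \<noteq> 0\<close> by (simp add: p_def dot_square_norm power2_eq_square)
  have xp: "x = norm x *\<^sub>R p" using \<open>x \<noteq> 0\<close> by (simp add: p_def)
  define w where "w = y - (p \<bullet> y) *\<^sub>R p"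
  have pw: "p \<bullet> w = 0" by (simp add: w_def inner_diff_right pp)
  have xy: "cross3 x y = norm x *\<^sub>R cross3 p w"
  proof -
    have "cross3 x y = norm x *\<^sub>R cross3 p y" by (subst xp) (simp add: cross_mult_left)
    also have "cross3 p y = cross3 p w" by (simp add: w_def Cross3.right_diff_distrib cross_mult_right cross_refl)
    finally show ?thesis .
  qed
  have "w \<noteq> 0" using assms D xy by auto
  define q where "q = w /\<^sub>R norm w"
  have wq: "w = norm w *\<^sub>R q" using \<open>w \<noteq> 0\<close> by (simp add: q_def)
  have qq: "q \<bullet> q = 1" using \<open>w \<noteq> 0\<close> by (simp add: q_def dot_square_norm power2_eq_square)
  have pq: "p \<bullet> q = 0" using pw by (simp add: q_def)
  have qy: "q \<bullet> y = norm w"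
  proof -
    have "q \<bullet> y = q \<bullet> w" using pq by (simp add: w_def inner_diff_right inner_commute)
    also have "\<dots> = norm w" using qq by (subst wq) simp
    finally show ?thesis .
  qed
  define n where "n = cross3 p q"
  have nn: "n \<bullet> n = 1"
    using norm_cross_dot[of p q] pp qq pq by (simp add: n_def dot_square_norm power_mult_distrib)
  have pn: "p \<bullet> n = 0" "q \<bullet> n = 0" by (simp_all add: n_def dot_cross_self)
  have D2: "?D = norm x * norm w * (n \<bullet> z)"
    unfolding D xy by (subst wq) (simp add: n_def cross_mult_right)
  then have nz: "n \<bullet> z \<noteq> 0" using assms by auto
  \<comment> \<open>The orientation of the frame is free; this sign makes the last pairing
    positive.\<close>
  define r where "r = sgn (n \<bullet> z) *\<^sub>R n"
  have rz: "r \<bullet> z = \<bar>n \<bullet> z\<bar>" by (simp add: r_def abs_sgn mult.commute)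
  have rr: "r \<bullet> r = 1" using nz nn by (simp add: r_def sgn_mult_self_eq)
  show thesis
  proof (rule that[of p q r])
    show "orthonormal3 p q r" using pp qq rr pq pn by (simp add: orthonormal3_def r_def)
    show "p \<bullet> x = norm x" "p \<bullet> x > 0" using px \<open>x \<noteq> 0\<close> by auto
    show "q \<bullet> y > 0" using qy \<open>w \<noteq> 0\<close> by simp
    show "r \<bullet> z > 0" using rz nz by simp
    show "(p \<bullet> x) * (q \<bullet> y) * (r \<bullet> z) = \<bar>?D\<bar>"
      unfolding D2 px qy rz by (simp add: abs_mult)
  qed
qed

text \<open>Maps the nonzero roots to the twelve unit vectors \<open>(\<plusminus>p \<plusminus> q) / sqrt 2\<close>, \<open>(\<plusminus>p \<plusminus> r) / sqrt 2\<close>,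
  \<open>(\<plusminus>q \<plusminus> r) / sqrt 2\<close>.\<close>

definition frame :: "real ^ 3 \<Rightarrow> real ^ 3 \<Rightarrow> real ^ 3 \<Rightarrow> real ^ 3 \<Rightarrow> real ^ 3" where
  "frame p q r v = (v $ 1 / sqrt 2) *\<^sub>R (q + r) + (v $ 2 / sqrt 2) *\<^sub>R (p + r) + (v $ 3 / sqrt 2) *\<^sub>R (p + q)"

lemma frame_diff: "frame p q r (v - w) = frame p q r v - frame p q r w"
  by (simp add: frame_def algebra_simps diff_divide_distrib)

lemma frame_eq:
  "frame p q r v = (1 / sqrt 2) *\<^sub>R ((v $ 2 + v $ 3) *\<^sub>R p + (v $ 1 + v $ 3) *\<^sub>R q + (v $ 1 + v $ 2) *\<^sub>R r)"
  by (simp add: frame_def algebra_simps)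

lemma inner_frame:
  assumes "orthonormal3 p q r"
  shows "frame p q r v \<bullet> frame p q r v = ((v $ 2 + v $ 3)\<^sup>2 + (v $ 1 + v $ 3)\<^sup>2 + (v $ 1 + v $ 2)\<^sup>2) / 2"
proof -
  have "(a *\<^sub>R p + b *\<^sub>R q + c *\<^sub>R r) \<bullet> (a *\<^sub>R p + b *\<^sub>R q + c *\<^sub>R r) = a\<^sup>2 + b\<^sup>2 + c\<^sup>2" for a b c
    using assms by (simp add: orthonormal3_def inner_add_left inner_add_right inner_commute power2_eq_square)
  then show ?thesis unfolding frame_eq by (simp flip: power2_eq_square)
qed

lemma norm_frame_root:
  assumes "orthonormal3 p q r" "i < 4" "j < 4" "i \<noteq> j"
  shows "norm (frame p q r (eps i - eps j)) = 1"
  unfolding norm_eq_1 inner_frame[OF assms(1)]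
  using assms(2-4) unfolding less_4_cases by (elim disjE; simp)

lemma norm_frame_A3:
  assumes "orthonormal3 p q r" "v \<in> A3"
  shows "norm (frame p q r v) \<le> 1"
proof -
  obtain i j where ij: "i < 4" "j < 4" "v = eps i - eps j" using assms(2) by (auto simp: A3_def)
  show ?thesis
  proof (cases "i = j")
    case True then show ?thesis by (simp add: ij frame_def)
  next
    case False then show ?thesis using norm_frame_root[OF assms(1) ij(1,2)] ij(3) by simp
  qed
qed

lemma frame_inj:
  assumes "orthonormal3 p q r" "frame p q r v = 0"
  shows "v = 0"
proof -
  have "((v $ 2 + v $ 3)\<^sup>2 + (v $ 1 + v $ 3)\<^sup>2 + (v $ 1 + v $ 2)\<^sup>2) / 2 = 0"
    using inner_frame[OF assms(1), of v] assms(2) by simp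
  then have "(v $ 2 + v $ 3)\<^sup>2 = 0 \<and> (v $ 1 + v $ 3)\<^sup>2 = 0 \<and> (v $ 1 + v $ 2)\<^sup>2 = 0"
    by (simp add: add_nonneg_eq_0_iff del: power_eq_0_iff zero_eq_power2)
  then show "v = 0" by (simp add: vec_eq_iff forall_3)
qed

text \<open>By \<open>frame_eq\<close>, \<open>p\<close> has the coefficient
  \<open>v $ 2 + v $ 3\<close>, so the sum over all edges pairs it with \<open>l 2 + l 3\<close>;
  similarly for \<open>q\<close> and \<open>r\<close>.\<close>

lemma calibrated_sum:
  fixes x v :: "'e \<Rightarrow> real ^ 3"
  assumes l: "\<And>i. l i = (\<Sum>c\<in>E. v c $ i *\<^sub>R x c)"
  shows "(\<Sum>c\<in>E. x c \<bullet> frame p q r (v c)) =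
    (p \<bullet> (l 2 + l 3) + q \<bullet> (l 1 + l 3) + r \<bullet> (l 1 + l 2)) / sqrt 2"
proof -
  have "(\<Sum>c\<in>E. x c \<bullet> frame p q r (v c)) =
    (\<Sum>c\<in>E. (v c $ 2 *\<^sub>R x c) \<bullet> p + (v c $ 3 *\<^sub>R x c) \<bullet> p + ((v c $ 1 *\<^sub>R x c) \<bullet> q + (v c $ 3 *\<^sub>R x c) \<bullet> q)
      + ((v c $ 1 *\<^sub>R x c) \<bullet> r + (v c $ 2 *\<^sub>R x c) \<bullet> r)) / sqrt 2"
    unfolding sum_divide_distrib frame_eq
    by (intro sum.cong refl) (simp add: inner_add_right field_simps)
  also have "\<dots> = (p \<bullet> (l 2 + l 3) + q \<bullet> (l 1 + l 3) + r \<bullet> (l 1 + l 2)) / sqrt 2"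
    unfolding l by (simp add: sum.distrib inner_add_right inner_commute inner_sum_right)
  finally show ?thesis .
qed

text \<open>Cauchy-Schwarz on every edge, with calibrating vectors of norm at most 1. The frame is
  arbitrary here and is adapted to the periods later.\<close>

lemma calibration_le:
  fixes x v :: "'e \<Rightarrow> real ^ 3"
  assumes v: "\<And>c. c \<in> E \<Longrightarrow> v c \<in> A3" and l: "\<And>i. l i = (\<Sum>c\<in>E. v c $ i *\<^sub>R x c)"
    and o: "orthonormal3 p q r"
  shows "p \<bullet> (l 2 + l 3) + q \<bullet> (l 1 + l 3) + r \<bullet> (l 1 + l 2) \<le> sqrt 2 * (\<Sum>c\<in>E. norm (x c))"
proof -
  have "(\<Sum>c\<in>E. x c \<bullet> frame p q r (v c)) \<le> (\<Sum>c\<in>E. norm (x c))"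
  proof (rule sum_mono)
    fix c assume "c \<in> E"
    have "x c \<bullet> frame p q r (v c) \<le> norm (x c) * norm (frame p q r (v c))" by (rule norm_cauchy_schwarz)
    also have "\<dots> \<le> norm (x c) * 1" using norm_frame_A3[OF o v[OF \<open>c \<in> E\<close>]] by (intro mult_left_mono) auto
    finally show "x c \<bullet> frame p q r (v c) \<le> norm (x c)" by simp
  qed
  then show ?thesis unfolding calibrated_sum[OF l] by (simp add: divide_le_eq mult.commute)
qed

text \<open>Equality of the sums forces equality in Cauchy-Schwarz on every edge. In particular, a
  nonzero \<open>x c\<close> has a nonzero \<open>v c\<close>.\<close>

lemma calibration_eq:
  fixes x v :: "'e \<Rightarrow> real ^ 3"
  assumes fin: "finite E" and v: "\<And>c. c \<in> E \<Longrightarrow> v c \<in> A3"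
    and l: "\<And>i. l i = (\<Sum>c\<in>E. v c $ i *\<^sub>R x c)" and o: "orthonormal3 p q r"
    and eq: "p \<bullet> (l 2 + l 3) + q \<bullet> (l 1 + l 3) + r \<bullet> (l 1 + l 2) = sqrt 2 * (\<Sum>c\<in>E. norm (x c))"
    and c: "c \<in> E"
  shows "x c = norm (x c) *\<^sub>R frame p q r (v c)"
proof -
  let ?B = "\<lambda>c. frame p q r (v c)"
  have le: "x c \<bullet> ?B c \<le> norm (x c)" if "c \<in> E" for c
  proof -
    have "x c \<bullet> ?B c \<le> norm (x c) * norm (?B c)" by (rule norm_cauchy_schwarz)
    also have "\<dots> \<le> norm (x c) * 1" using norm_frame_A3[OF o v[OF that]] by (intro mult_left_mono) auto
    finally show ?thesis by simp
  qed
  have "(\<Sum>c\<in>E. norm (x c) - x c \<bullet> ?B c) = 0"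
    unfolding sum_subtractf calibrated_sum[OF l] using eq by simp
  then have "x c \<bullet> ?B c = norm (x c)"
    using sum_nonneg_eq_0_iff[OF fin, of "\<lambda>c. norm (x c) - x c \<bullet> ?B c"] le c by auto
  moreover have "?B c \<bullet> ?B c \<le> 1"
    using norm_frame_A3[OF o v[OF c]] by (simp add: dot_square_norm power_le_one)
  \<comment> \<open>The squared distance of \<open>x c\<close> from its claimed value is
    \<open>|x|^2 * (|B|^2 - 1)\<close>; this covers \<open>v c = 0\<close> as well.\<close>
  ultimately have "(x c - norm (x c) *\<^sub>R ?B c) \<bullet> (x c - norm (x c) *\<^sub>R ?B c) \<le> 0"
  proof -
    assume a: "x c \<bullet> ?B c = norm (x c)" and b: "?B c \<bullet> ?B c \<le> 1"
    have "(x c - norm (x c) *\<^sub>R ?B c) \<bullet> (x c - norm (x c) *\<^sub>R ?B c)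
      = x c \<bullet> x c - 2 * (norm (x c) * (x c \<bullet> ?B c)) + (norm (x c))\<^sup>2 * (?B c \<bullet> ?B c)"
      by (simp add: inner_diff_left inner_diff_right inner_commute power2_eq_square algebra_simps)
    also have "\<dots> = (norm (x c))\<^sup>2 * (?B c \<bullet> ?B c) - (norm (x c))\<^sup>2"
      unfolding a dot_square_norm by (simp add: power2_eq_square)
    also have "\<dots> \<le> 0" using b mult_left_mono[OF b, of "(norm (x c))\<^sup>2"] by simp
    finally show ?thesis .
  qed
  then have "x c - norm (x c) *\<^sub>R ?B c = 0" by (metis inner_eq_zero_iff inner_ge_zero order_antisym)
  then show ?thesis by simp
qed

text \<open>The 2 is the determinant of the passage from the \<open>l i\<close> to their pair sums.
  The cyclic versions let Gram-Schmidt start at any of the three sums.\<close>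

lemma det_pair_sums:
  fixes l :: "3 \<Rightarrow> real ^ 3"
  shows "det (vector [l 2 + l 3, l 1 + l 3, l 1 + l 2] :: real ^ 3 ^ 3) = 2 * det (\<chi> i. l i)"
    and "det (vector [l 1 + l 3, l 1 + l 2, l 2 + l 3] :: real ^ 3 ^ 3) = 2 * det (\<chi> i. l i)"
    and "det (vector [l 1 + l 2, l 2 + l 3, l 1 + l 3] :: real ^ 3 ^ 3) = 2 * det (\<chi> i. l i)"
  by (simp_all add: det_3 algebra_simps)

lemma orthonormal3_rotate: "orthonormal3 p q r \<Longrightarrow> orthonormal3 r p q"
  by (auto simp: orthonormal3_def inner_commute)

theorem calibration_inequality:
  fixes x v :: "'e \<Rightarrow> real ^ 3"
  assumes v: "\<And>c. c \<in> E \<Longrightarrow> v c \<in> A3" and l: "\<And>i. l i = (\<Sum>c\<in>E. v c $ i *\<^sub>R x c)"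
    and d: "det (\<chi> i. l i) \<noteq> 0"
  shows "27 / sqrt 2 * \<bar>det (\<chi> i. l i)\<bar> \<le> (\<Sum>c\<in>E. norm (x c)) ^ 3"
proof -
  let ?L = "\<Sum>c\<in>E. norm (x c)"
  obtain p q r where o: "orthonormal3 p q r" and pos: "p \<bullet> (l 2 + l 3) > 0" "q \<bullet> (l 1 + l 3) > 0" "r \<bullet> (l 1 + l 2) > 0"
    and pr: "(p \<bullet> (l 2 + l 3)) * (q \<bullet> (l 1 + l 3)) * (r \<bullet> (l 1 + l 2)) = \<bar>2 * det (\<chi> i. l i)\<bar>"
    using gram_schmidt3[of "l 2 + l 3" "l 1 + l 3" "l 1 + l 2", unfolded det_pair_sums] d by (metis mult_eq_0_iff zero_neq_numeral)
  \<comment> \<open>AM-GM for the three pairings. Dividing the whole chain by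
    \<open>2 * sqrt 2\<close> produces the constant \<open>27 / sqrt 2\<close>.\<close>
  have "27 * \<bar>2 * det (\<chi> i. l i)\<bar> \<le> (p \<bullet> (l 2 + l 3) + q \<bullet> (l 1 + l 3) + r \<bullet> (l 1 + l 2)) ^ 3"
    unfolding pr[symmetric] using pos by (intro amgm3) auto
  also have "\<dots> \<le> (sqrt 2 * ?L) ^ 3"
    using calibration_le[OF v l o] pos by (intro power_mono) auto
  also have "\<dots> = 2 * sqrt 2 * ?L ^ 3" by (simp add: power_mult_distrib power3_eq_cube)
  finally show ?thesis by (simp add: abs_mult field_simps)
qed

text \<open>Gram-Schmidt makes only its first frame vector parallel to the pair sum it starts from.
  Three runs with different starting vectors show that all pair sums have norm \<open>s\<close>; in
  the first frame each of them also has pairing \<open>s\<close>, so it is parallel to the frame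
  vector.\<close>

theorem calibration_equality:
  fixes x v :: "'e \<Rightarrow> real ^ 3"
  assumes fin: "finite E" and v: "\<And>c. c \<in> E \<Longrightarrow> v c \<in> A3"
    and l: "\<And>i. l i = (\<Sum>c\<in>E. v c $ i *\<^sub>R x c)" and d: "det (\<chi> i. l i) \<noteq> 0"
    and eq: "27 / sqrt 2 * \<bar>det (\<chi> i. l i)\<bar> = (\<Sum>c\<in>E. norm (x c)) ^ 3"
  obtains p q r s where "orthonormal3 p q r" "s > 0" "l 2 + l 3 = s *\<^sub>R p" "l 1 + l 3 = s *\<^sub>R q" "l 1 + l 2 = s *\<^sub>R r"
    "\<And>c. c \<in> E \<Longrightarrow> x c = norm (x c) *\<^sub>R frame p q r (v c)"
proof -
  let ?L = "\<Sum>c\<in>E. norm (x c)"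
  define s where "s = root 3 \<bar>2 * det (\<chi> i. l i)\<bar>"
  have s3: "s ^ 3 = \<bar>2 * det (\<chi> i. l i)\<bar>" by (simp add: s_def)
  have s0: "s > 0" using d by (simp add: s_def)
  have L3: "(sqrt 2 * ?L) ^ 3 = 27 * \<bar>2 * det (\<chi> i. l i)\<bar>"
    using eq by (simp add: power_mult_distrib power3_eq_cube abs_mult field_simps)
  \<comment> \<open>For every such frame the calibrated sum is squeezed between the geometric mean
    and the length, so AM-GM is sharp.\<close>
  have tight: "p \<bullet> (l 2 + l 3) = s \<and> q \<bullet> (l 1 + l 3) = s \<and> r \<bullet> (l 1 + l 2) = s
      \<and> p \<bullet> (l 2 + l 3) + q \<bullet> (l 1 + l 3) + r \<bullet> (l 1 + l 2) = sqrt 2 * ?L"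
    if o: "orthonormal3 p q r" and pos: "p \<bullet> (l 2 + l 3) > 0" "q \<bullet> (l 1 + l 3) > 0" "r \<bullet> (l 1 + l 2) > 0"
      and pr: "(p \<bullet> (l 2 + l 3)) * (q \<bullet> (l 1 + l 3)) * (r \<bullet> (l 1 + l 2)) = \<bar>2 * det (\<chi> i. l i)\<bar>" for p q r
  proof -
    let ?a = "p \<bullet> (l 2 + l 3)" and ?b = "q \<bullet> (l 1 + l 3)" and ?c = "r \<bullet> (l 1 + l 2)"
    have 1: "27 * (?a * ?b * ?c) \<le> (?a + ?b + ?c) ^ 3" using pos by (intro amgm3) auto
    have 2: "?a + ?b + ?c \<le> sqrt 2 * ?L" by (rule calibration_le[OF v l o])
    then have 3: "(?a + ?b + ?c) ^ 3 \<le> (sqrt 2 * ?L) ^ 3" using pos by (intro power_mono) auto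
    have e: "27 * (?a * ?b * ?c) = (?a + ?b + ?c) ^ 3" using 1 3 L3 pr by linarith
    then have ab: "?a = ?b \<and> ?b = ?c" using pos by (intro amgm3(2)) auto
    then have "?a ^ 3 = s ^ 3" using pr s3 by (simp add: power3_eq_cube)
    then have as: "?a = s" using pos s0 by (metis less_imp_le power_eq_imp_eq_base zero_less_numeral)
    have cube: "(?a + ?b + ?c) ^ 3 = (sqrt 2 * ?L) ^ 3" using e L3 pr by linarith
    have "0 \<le> ?a + ?b + ?c" "0 \<le> sqrt 2 * ?L" using 2 pos by linarith+
    then have "?a + ?b + ?c = sqrt 2 * ?L"
      using power_eq_imp_eq_base[OF cube] by simp
    then show ?thesis using as ab by auto
  qed
  obtain p q r where o: "orthonormal3 p q r" and n1: "p \<bullet> (l 2 + l 3) = norm (l 2 + l 3)"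
    and pos: "p \<bullet> (l 2 + l 3) > 0" "q \<bullet> (l 1 + l 3) > 0" "r \<bullet> (l 1 + l 2) > 0"
    and pr: "(p \<bullet> (l 2 + l 3)) * (q \<bullet> (l 1 + l 3)) * (r \<bullet> (l 1 + l 2)) = \<bar>2 * det (\<chi> i. l i)\<bar>"
    using gram_schmidt3[of "l 2 + l 3" "l 1 + l 3" "l 1 + l 2", unfolded det_pair_sums] d by (metis mult_eq_0_iff zero_neq_numeral)
  note t1 = tight[OF o pos pr]
  \<comment> \<open>This frame and the next one only contribute the norm of the pair sum they start
    from.\<close>
  obtain q' r' p' where o': "orthonormal3 q' r' p'" and n2: "q' \<bullet> (l 1 + l 3) = norm (l 1 + l 3)"
    and pos': "q' \<bullet> (l 1 + l 3) > 0" "r' \<bullet> (l 1 + l 2) > 0" "p' \<bullet> (l 2 + l 3) > 0"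
    and pr': "(q' \<bullet> (l 1 + l 3)) * (r' \<bullet> (l 1 + l 2)) * (p' \<bullet> (l 2 + l 3)) = \<bar>2 * det (\<chi> i. l i)\<bar>"
    using gram_schmidt3[of "l 1 + l 3" "l 1 + l 2" "l 2 + l 3", unfolded det_pair_sums] d by (metis mult_eq_0_iff zero_neq_numeral)
  note t2 = tight[OF orthonormal3_rotate[OF o'] pos'(3,1,2)]
  obtain r'' p'' q'' where o'': "orthonormal3 r'' p'' q''" and n3: "r'' \<bullet> (l 1 + l 2) = norm (l 1 + l 2)"
    and pos'': "r'' \<bullet> (l 1 + l 2) > 0" "p'' \<bullet> (l 2 + l 3) > 0" "q'' \<bullet> (l 1 + l 3) > 0"
    and pr'': "(r'' \<bullet> (l 1 + l 2)) * (p'' \<bullet> (l 2 + l 3)) * (q'' \<bullet> (l 1 + l 3)) = \<bar>2 * det (\<chi> i. l i)\<bar>"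
    using gram_schmidt3[of "l 1 + l 2" "l 2 + l 3" "l 1 + l 3", unfolded det_pair_sums] d by (metis mult_eq_0_iff zero_neq_numeral)
  note t3 = tight[OF orthonormal3_rotate[OF orthonormal3_rotate[OF o'']] pos''(2,3,1)]
  have N: "norm (l 2 + l 3) = s" "norm (l 1 + l 3) = s" "norm (l 1 + l 2) = s"
    using t1 t2 t3 n1 n2 n3 pr' pr'' by (auto simp: mult_ac)
  have par: "y = s *\<^sub>R u" if "u \<bullet> u = 1" "u \<bullet> y = s" "norm y = s" for u y :: "real ^ 3"
  proof -
    have "(y - s *\<^sub>R u) \<bullet> (y - s *\<^sub>R u) = (norm y)\<^sup>2 - 2 * s * (u \<bullet> y) + s\<^sup>2 * (u \<bullet> u)"
      by (simp only: power2_norm_eq_inner inner_diff_left inner_diff_right inner_scaleR_left inner_scaleR_right)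
        (simp add: inner_commute power2_eq_square algebra_simps)
    also have "\<dots> = 0" using that by (simp add: power2_eq_square)
    finally have "(y - s *\<^sub>R u) \<bullet> (y - s *\<^sub>R u) = 0" .
    then show ?thesis by simp
  qed
  show thesis
  proof (rule that[of p q r s])
    show "l 2 + l 3 = s *\<^sub>R p" "l 1 + l 3 = s *\<^sub>R q" "l 1 + l 2 = s *\<^sub>R r"
      using par N t1 o by (auto simp: orthonormal3_def)
    show "x c = norm (x c) *\<^sub>R frame p q r (v c)" if "c \<in> E" for c
      using t1 by (intro calibration_eq[OF fin v l o _ that]) auto
  qed (use o s0 in auto)
qed

text \<open>The matrix \<open>G\<close> with entries \<open>\<Sum> \<bar>x c\<bar> v\<^sub>i v\<^sub>j\<close> is determined by \<open>l\<^sub>i = \<Sum> G\<^sub>i\<^sub>j b\<^sub>j\<close>, and its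
  entries encode the six root masses.\<close>

theorem calibration_root_masses:
  fixes x v :: "'e \<Rightarrow> real ^ 3"
  assumes fin: "finite E" and v: "\<And>c. c \<in> E \<Longrightarrow> v c \<in> A3"
    and l: "\<And>i. l i = (\<Sum>c\<in>E. v c $ i *\<^sub>R x c)"
    and o: "orthonormal3 p q r" and ls: "l 2 + l 3 = s *\<^sub>R p" "l 1 + l 3 = s *\<^sub>R q" "l 1 + l 2 = s *\<^sub>R r"
    and x: "\<And>c. c \<in> E \<Longrightarrow> x c = norm (x c) *\<^sub>R frame p q r (v c)"
    and ij: "i < 4" "j < 4" "i \<noteq> j"
  shows "(\<Sum>c | c \<in> E \<and> (v c = eps i - eps j \<or> v c = eps j - eps i). norm (x c)) = s / (2 * sqrt 2)"
proof -
  define G where "G a b = (\<Sum>c\<in>E. norm (x c) * (v c $ a * v c $ b))" for a b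
  define \<kappa> where "\<kappa> = s / (2 * sqrt 2)"
  have lG: "l a = (G a 1 / sqrt 2) *\<^sub>R (q + r) + (G a 2 / sqrt 2) *\<^sub>R (p + r) + (G a 3 / sqrt 2) *\<^sub>R (p + q)" for a
  proof -
    have "l a = (\<Sum>c\<in>E. v c $ a *\<^sub>R (norm (x c) *\<^sub>R frame p q r (v c)))"
      unfolding l using x by (intro sum.cong) auto
    also have "\<dots> = (\<Sum>c\<in>E. (norm (x c) * (v c $ a * v c $ 1) / sqrt 2) *\<^sub>R (q + r) + (norm (x c) * (v c $ a * v c $ 2) / sqrt 2) *\<^sub>R (p + r)
      + (norm (x c) * (v c $ a * v c $ 3) / sqrt 2) *\<^sub>R (p + q))"
      unfolding frame_def by (intro sum.cong refl) (simp add: scaleR_add_right mult_ac)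
    finally show ?thesis
      by (simp add: sum.distrib G_def sum_divide_distrib flip: scaleR_sum_left)
  qed
  have l_eq: "l 1 = (s / 2) *\<^sub>R (q + r - p)" "l 2 = (s / 2) *\<^sub>R (p + r - q)" "l 3 = (s / 2) *\<^sub>R (p + q - r)"
  proof -
    have "2 *\<^sub>R l 1 = (l 1 + l 3) + (l 1 + l 2) - (l 2 + l 3)" by (simp add: scaleR_2)
    also have "\<dots> = s *\<^sub>R (q + r - p)" unfolding ls by (simp add: algebra_simps)
    finally show "l 1 = (s / 2) *\<^sub>R (q + r - p)" by (metis (no_types) scaleR_half_double scaleR_scaleR times_divide_eq_left mult_1 scaleR_2)
    have "2 *\<^sub>R l 2 = (l 2 + l 3) + (l 1 + l 2) - (l 1 + l 3)" by (simp add: scaleR_2)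
    also have "\<dots> = s *\<^sub>R (p + r - q)" unfolding ls by (simp add: algebra_simps)
    finally show "l 2 = (s / 2) *\<^sub>R (p + r - q)" by (metis (no_types) scaleR_half_double scaleR_scaleR times_divide_eq_left mult_1 scaleR_2)
    have "2 *\<^sub>R l 3 = (l 2 + l 3) + (l 1 + l 3) - (l 1 + l 2)" by (simp add: scaleR_2)
    also have "\<dots> = s *\<^sub>R (p + q - r)" unfolding ls by (simp add: algebra_simps)
    finally show "l 3 = (s / 2) *\<^sub>R (p + q - r)" by (metis (no_types) scaleR_half_double scaleR_scaleR times_divide_eq_left mult_1 scaleR_2)
  qed
  have pairs: "p \<bullet> l a = (G a 2 + G a 3) / sqrt 2 \<and> q \<bullet> l a = (G a 1 + G a 3) / sqrt 2 \<and> r \<bullet> l a = (G a 1 + G a 2) / sqrt 2" for a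
    unfolding lG using o by (simp add: orthonormal3_def inner_add_right inner_commute add_divide_distrib)
  have s2: "s = 2 * \<kappa> * sqrt 2" by (simp add: \<kappa>_def)
  have pl: "p \<bullet> l 1 = - s / 2" "q \<bullet> l 1 = s / 2" "r \<bullet> l 1 = s / 2"
    "p \<bullet> l 2 = s / 2" "q \<bullet> l 2 = - s / 2" "r \<bullet> l 2 = s / 2"
    "p \<bullet> l 3 = s / 2" "q \<bullet> l 3 = s / 2" "r \<bullet> l 3 = - s / 2"
    unfolding l_eq using o by (simp_all add: orthonormal3_def inner_add_right inner_diff_right inner_commute)
  have two: "(a :: real) / sqrt 2 = s / 2 \<longleftrightarrow> a = 2 * \<kappa>" "a / sqrt 2 = - s / 2 \<longleftrightarrow> a = - 2 * \<kappa>" for a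
    unfolding s2 by (auto simp: field_simps)
  have G: "G 1 1 = 3 * \<kappa>" "G 1 2 = - \<kappa>" "G 1 3 = - \<kappa>" "G 2 1 = - \<kappa>" "G 2 2 = 3 * \<kappa>" "G 2 3 = - \<kappa>"
    "G 3 1 = - \<kappa>" "G 3 2 = - \<kappa>" "G 3 3 = 3 * \<kappa>"
  proof -
    have "G 1 2 + G 1 3 = - 2 * \<kappa>" "G 1 1 + G 1 3 = 2 * \<kappa>" "G 1 1 + G 1 2 = 2 * \<kappa>"
      "G 2 2 + G 2 3 = 2 * \<kappa>" "G 2 1 + G 2 3 = - 2 * \<kappa>" "G 2 1 + G 2 2 = 2 * \<kappa>"
      "G 3 2 + G 3 3 = 2 * \<kappa>" "G 3 1 + G 3 3 = 2 * \<kappa>" "G 3 1 + G 3 2 = - 2 * \<kappa>"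
      using pairs[of 1] pairs[of 2] pairs[of 3] pl two by metis+
    then show "G 1 1 = 3 * \<kappa>" "G 1 2 = - \<kappa>" "G 1 3 = - \<kappa>" "G 2 1 = - \<kappa>" "G 2 2 = 3 * \<kappa>" "G 2 3 = - \<kappa>"
      "G 3 1 = - \<kappa>" "G 3 2 = - \<kappa>" "G 3 3 = 3 * \<kappa>" by linarith+
  qed
  define M where "M i j = (\<Sum>c | c \<in> E \<and> (v c = eps i - eps j \<or> v c = eps j - eps i). norm (x c))" for i j
  have M: "M i j = (\<Sum>c\<in>E. norm (x c) * of_bool (v c = eps i - eps j \<or> v c = eps j - eps i))" for i j
    unfolding M_def using fin by (simp add: sum.inter_filter[symmetric] of_bool_def if_distrib cong: if_cong)
  have pos: "M i j = \<kappa>" if "i = 0 \<and> j = 1 \<or> i = 0 \<and> j = 2 \<or> i = 0 \<and> j = 3 \<or> i = 1 \<and> j = 2 \<or> i = 1 \<and> j = 3 \<or> i = 2 \<and> j = 3" for i j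
  proof -
    have A: "v c $ 1 \<in> {-1, 0, 1} \<and> v c $ 2 \<in> {-1, 0, 1} \<and> v c $ 3 \<in> {-1, 0, 1} \<and> v c $ 1 * v c $ 2 \<le> 0
      \<and> v c $ 1 * v c $ 3 \<le> 0 \<and> v c $ 2 * v c $ 3 \<le> 0" if "c \<in> E" for c
      using v[OF that] unfolding A3_iff by blast
    \<comment> \<open>On roots and for \<open>a \<noteq> b\<close>, the product
      \<open>v $ a * v $ b\<close> is -1 on the class of \<open>a\<close>, \<open>b\<close> and 0
      elsewhere, while \<open>v $ a * (v $ 1 + v $ 2 + v $ 3)\<close> is 1 on the class of 0,
      \<open>a\<close> and 0 elsewhere.\<close>
    have 1: "M 0 1 = G 1 1 + G 1 2 + G 1 3" "M 0 2 = G 2 1 + G 2 2 + G 2 3" "M 0 3 = G 3 1 + G 3 2 + G 3 3"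
      "M 1 2 = - G 1 2" "M 1 3 = - G 1 3" "M 2 3 = - G 2 3"
      unfolding M G_def sum.distrib[symmetric] sum_negf[symmetric]
      by (intro sum.cong refl; drule A; elim conjE insertE emptyE; simp add: vec_eq_iff forall_3)+
    then show ?thesis using that G by auto
  qed
  have sym: "M i j = M j i" unfolding M_def by (rule sum.cong) auto
  have "M i j = \<kappa>"
    using ij pos[of i j] pos[of j i] sym unfolding less_4_cases by (elim disjE; simp)
  then show ?thesis by (simp add: M_def \<kappa>_def)
qed

subsection \<open>Periodic networks\<close>

text \<open>Segments from a common point overlap exactly when they have the same direction. This
  turns injectivity on stars into a statement about edge directions.\<close>

lemma closed_segment_Int_eq_iff:
  fixes v p q :: "'a::real_vector"
  assumes "p \<noteq> v"
  shows "closed_segment v p \<inter> closed_segment v q = {v} \<longleftrightarrow> \<not> (\<exists>t>0. p - v = t *\<^sub>R (q - v))"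
proof
  assume i: "closed_segment v p \<inter> closed_segment v q = {v}"
  show "\<not> (\<exists>t>0. p - v = t *\<^sub>R (q - v))"
  proof
    assume "\<exists>t>0. p - v = t *\<^sub>R (q - v)"
    then obtain t where t: "t > 0" "p - v = t *\<^sub>R (q - v)" by blast
    \<comment> \<open>Small enough for the common point to lie on both segments.\<close>
    define s where "s = min 1 (1 / t)"
    have s: "0 < s" "s \<le> 1" "s * t \<le> 1" "0 < s * t" using t(1) by (auto simp: s_def min_def field_simps)
    define x where "x = v + s *\<^sub>R (p - v)"
    have x2: "x = v + (s * t) *\<^sub>R (q - v)" by (simp add: x_def t(2))
    have "x = (1 - s) *\<^sub>R v + s *\<^sub>R p" by (simp add: x_def algebra_simps)
    then have "x \<in> closed_segment v p" using s by (auto simp: closed_segment_def intro!: exI[of _ s])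
    moreover have "x = (1 - s * t) *\<^sub>R v + (s * t) *\<^sub>R q" by (simp add: x2 algebra_simps)
    then have "x \<in> closed_segment v q" using s unfolding closed_segment_def by force
    ultimately
    have "x = v" using i by blast
    then show False using s assms by (simp add: x_def)
  qed
next
  assume n: "\<not> (\<exists>t>0. p - v = t *\<^sub>R (q - v))"
  have "x = v" if x: "x \<in> closed_segment v p" "x \<in> closed_segment v q" for x
  proof (rule ccontr)
    assume "x \<noteq> v"
    obtain s r where sr: "0 \<le> s" "s \<le> 1" "x = (1 - s) *\<^sub>R v + s *\<^sub>R p" "0 \<le> r" "r \<le> 1" "x = (1 - r) *\<^sub>R v + r *\<^sub>R q"
      using x by (auto simp: closed_segment_def)
    have 1: "x - v = s *\<^sub>R (p - v)" "x - v = r *\<^sub>R (q - v)"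
      by (simp add: sr(3) algebra_simps) (simp add: sr(6) algebra_simps)
    have "s > 0" "r > 0" using 1 sr(1,4) \<open>x \<noteq> v\<close> by (metis eq_iff_diff_eq_0 order_le_less scaleR_zero_left)+
    have "p - v = (1 / s) *\<^sub>R (s *\<^sub>R (p - v))" using \<open>s > 0\<close> by simp
    also have "\<dots> = (1 / s) *\<^sub>R (r *\<^sub>R (q - v))" using 1 by metis
    also have "\<dots> = (r / s) *\<^sub>R (q - v)" by simp
    finally show False using n \<open>s > 0\<close> \<open>r > 0\<close> by (metis divide_pos_pos)
  qed
  then show "closed_segment v p \<inter> closed_segment v q = {v}" by auto
qed

text \<open>Grown in the periodic graph and not in the quotient: its edges join the chosen
  representatives themselves, which makes their shifts zero. The last premise keeps one vertex per
  orbit.\<close>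

inductive tree :: "('v, 'n::finite) network \<Rightarrow> 'v \<Rightarrow> 'v set \<Rightarrow> ('v \<times> 'v) set \<Rightarrow> bool" for N r where
  root: "tree N r {r} {}"
| grow: "tree N r R F \<Longrightarrow> u \<in> R \<Longrightarrow> {u, w} \<in> edges N \<Longrightarrow> \<forall>a\<in>R. w \<notin> vertex_orbit N a \<Longrightarrow>
    tree N r (insert w R) (insert (u, w) F)"

section \<open>The lattice action on vertices and edges\<close>

locale periodic_net =
  fixes N :: "('v, 'n::{finite,wellorder}) network"
  assumes periodic: "periodic_network N"
begin

abbreviation "V \<equiv> verts N"
abbreviation "\<Lambda> \<equiv> lattice N"
abbreviation "E \<equiv> quotient_edges N"

lemma full: "full_lattice \<Lambda>"
  using periodic by (simp add: periodic_network_def)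

lemmas lattice_zero [simp] = full_lattice_zero[OF full]
  and lattice_add [simp] = full_lattice_add[OF full]
  and lattice_uminus [simp] = full_lattice_uminus[OF full]
  and lattice_diff [simp] = full_lattice_diff[OF full]

lemma invariant: "lattice_invariant N" and simple: "simple_graph N" and connected: "connected_graph N"
  and immersed: "immersed N" and finite_verts: "finite (quotient_verts N)" and finite_edges: "finite E"
  using periodic by (simp_all add: periodic_network_def)

lemma act_zero [simp]: "v \<in> V \<Longrightarrow> act N 0 v = v"
  and act_add: "g \<in> \<Lambda> \<Longrightarrow> h \<in> \<Lambda> \<Longrightarrow> v \<in> V \<Longrightarrow> act N (g + h) v = act N g (act N h v)"
  and act_verts [simp]: "g \<in> \<Lambda> \<Longrightarrow> v \<in> V \<Longrightarrow> act N g v \<in> V"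
  and pos_act [simp]: "g \<in> \<Lambda> \<Longrightarrow> v \<in> V \<Longrightarrow> pos N (act N g v) = pos N v + g"
  and act_edges: "g \<in> \<Lambda> \<Longrightarrow> e \<in> edges N \<Longrightarrow> act N g ` e \<in> edges N"
  using invariant by (simp_all add: lattice_invariant_def)

lemma act_act [simp]: "g \<in> \<Lambda> \<Longrightarrow> h \<in> \<Lambda> \<Longrightarrow> v \<in> V \<Longrightarrow> act N g (act N h v) = act N (g + h) v"
  by (simp add: act_add)

lemma act_eq_iff [simp]:
  assumes "g \<in> \<Lambda>" "h \<in> \<Lambda>" "v \<in> V"
  shows "act N g v = act N h v \<longleftrightarrow> g = h"
  using assms pos_act by (metis add_left_imp_eq)

lemma act_inj:
  assumes "g \<in> \<Lambda>" "u \<in> V" "v \<in> V"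
  shows "act N g u = act N g v \<longleftrightarrow> u = v"
proof
  assume "act N g u = act N g v"
  then have "act N (- g) (act N g u) = act N (- g) (act N g v)" by simp
  then show "u = v" using assms by simp
qed simp

lemma edge_verts:
  assumes "{u, w} \<in> edges N"
  shows "u \<in> V" "w \<in> V" "u \<noteq> w"
proof -
  obtain a b where "a \<in> V" "b \<in> V" "a \<noteq> b" "{u, w} = {a, b}"
    using simple assms unfolding simple_graph_def by blast
  then show "u \<in> V" "w \<in> V" "u \<noteq> w" by (auto simp: doubleton_eq_iff)
qed

lemma edgeE:
  assumes "e \<in> edges N"
  obtains u w where "e = {u, w}" "u \<in> V" "w \<in> V" "u \<noteq> w"
  using assms simple unfolding simple_graph_def by blast

lemma act_edge:
  assumes "g \<in> \<Lambda>" "{u, w} \<in> edges N"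
  shows "{act N g u, act N g w} \<in> edges N"
  using act_edges[OF assms] by simp

lemma pos_edge: "{u, w} \<in> edges N \<Longrightarrow> pos N u \<noteq> pos N w"
  using immersed by (auto simp: immersed_def)

lemma immersed_direction:
  assumes "{v, u} \<in> edges N" "{v, w} \<in> edges N" "t > 0" "pos N u - pos N v = t *\<^sub>R (pos N w - pos N v)"
  shows "u = w"
proof (rule ccontr)
  assume "u \<noteq> w"
  then have "closed_segment (pos N v) (pos N u) \<inter> closed_segment (pos N v) (pos N w) = {pos N v}"
    using immersed assms(1,2) edge_verts[OF assms(1)] unfolding immersed_def neighbours_def by blast
  then show False
    using closed_segment_Int_eq_iff[of "pos N u" "pos N v" "pos N w"] assms(3,4) pos_edge[OF assms(1)] by metis
qed

lemma mem_vertex_orbit: "w \<in> vertex_orbit N v \<longleftrightarrow> (\<exists>g\<in>\<Lambda>. w = act N g v)"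
  by (auto simp: vertex_orbit_def)

lemma vertex_orbit_self: "v \<in> V \<Longrightarrow> v \<in> vertex_orbit N v"
  unfolding mem_vertex_orbit by (rule bexI[of _ 0]) auto

lemma act_vertex_orbit:
  assumes "g \<in> \<Lambda>" "v \<in> V" "w \<in> V"
  shows "act N g w \<in> vertex_orbit N v \<longleftrightarrow> w \<in> vertex_orbit N v"
proof
  assume "act N g w \<in> vertex_orbit N v"
  then obtain h where h: "h \<in> \<Lambda>" "act N g w = act N h v" by (auto simp: mem_vertex_orbit)
  then have "act N (- g) (act N g w) = act N (- g) (act N h v)" by simp
  then have "w = act N (- g + h) v" using assms h(1) by simp
  then show "w \<in> vertex_orbit N v" using assms h lattice_add lattice_uminus unfolding mem_vertex_orbit by blast
next
  assume "w \<in> vertex_orbit N v"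
  then obtain h where "h \<in> \<Lambda>" "w = act N h v" by (auto simp: mem_vertex_orbit)
  then show "act N g w \<in> vertex_orbit N v" using assms unfolding mem_vertex_orbit by (intro bexI[of _ "g + h"]) auto
qed

lemma vertex_orbit_eq:
  assumes "v \<in> V" "w \<in> vertex_orbit N v"
  shows "vertex_orbit N w = vertex_orbit N v"
proof -
  obtain h where h: "h \<in> \<Lambda>" "w = act N h v" using assms by (auto simp: mem_vertex_orbit)
  have "x \<in> vertex_orbit N w" if x: "x \<in> vertex_orbit N v" for x
  proof -
    obtain g where g: "g \<in> \<Lambda>" "x = act N g v" using x by (auto simp: mem_vertex_orbit)
    then have "x = act N (g - h) w" using h assms by simp
    then show ?thesis unfolding mem_vertex_orbit using g h by (intro bexI[of _ "g - h"]) auto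
  qed
  moreover have "x \<in> vertex_orbit N v" if "x \<in> vertex_orbit N w" for x
    using that h assms by (auto simp: mem_vertex_orbit)
  ultimately show ?thesis by blast
qed

lemma mem_edge_orbit: "e' \<in> edge_orbit N e \<longleftrightarrow> (\<exists>g\<in>\<Lambda>. e' = act N g ` e)"
  by (auto simp: edge_orbit_def)

lemma edge_orbit_self:
  assumes "e \<in> edges N"
  shows "e \<in> edge_orbit N e"
proof -
  obtain u w where "e = {u, w}" "u \<in> V" "w \<in> V" using assms by (rule edgeE)
  then have "e = act N 0 ` e" by simp
  then show ?thesis unfolding mem_edge_orbit using lattice_zero by blast
qed

lemma edge_orbit_edges: "e \<in> edges N \<Longrightarrow> e' \<in> edge_orbit N e \<Longrightarrow> e' \<in> edges N"
  using act_edges by (auto simp: mem_edge_orbit)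

lemma edge_orbit_eq:
  assumes e: "e \<in> edges N" and e': "e' \<in> edge_orbit N e"
  shows "edge_orbit N e' = edge_orbit N e"
proof -
  obtain u w where uw: "e = {u, w}" "u \<in> V" "w \<in> V" using e by (rule edgeE)
  obtain h where h: "h \<in> \<Lambda>" "e' = act N h ` e" using e' by (auto simp: mem_edge_orbit)
  have "x \<in> edge_orbit N e'" if x: "x \<in> edge_orbit N e" for x
  proof -
    obtain g where g: "g \<in> \<Lambda>" "x = act N g ` e" using x by (auto simp: mem_edge_orbit)
    then have "x = act N (g - h) ` e'" using h uw by simp
    then show ?thesis unfolding mem_edge_orbit using g h by (intro bexI[of _ "g - h"]) auto
  qed
  moreover have "x \<in> edge_orbit N e" if x: "x \<in> edge_orbit N e'" for x
  proof -
    obtain g where g: "g \<in> \<Lambda>" "x = act N g ` e'" using x by (auto simp: mem_edge_orbit)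
    then have "x = act N (g + h) ` e" using h uw by simp
    then show ?thesis unfolding mem_edge_orbit using g h by (intro bexI[of _ "g + h"]) auto
  qed
  ultimately show ?thesis by blast
qed

lemma quotient_edge_eq:
  assumes "c \<in> E" "e \<in> c"
  shows "e \<in> edges N" "c = edge_orbit N e"
proof -
  obtain e' where "e' \<in> edges N" "c = edge_orbit N e'" using assms(1) by (auto simp: quotient_edges_def)
  then show "e \<in> edges N" "c = edge_orbit N e"
    using assms(2) edge_orbit_edges edge_orbit_eq by metis+
qed

lemma edge_length_pair: "edge_length N {u, w} = dist (pos N u) (pos N w)"
  unfolding edge_length_def
  by (rule the_equality) (auto simp: doubleton_eq_iff dist_commute)

lemma edge_length_act:
  assumes "e \<in> edges N" "g \<in> \<Lambda>"
  shows "edge_length N (act N g ` e) = edge_length N e"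
proof -
  obtain u w where "e = {u, w}" "u \<in> V" "w \<in> V" using assms(1) by (rule edgeE)
  then show ?thesis using assms by (simp add: edge_length_pair dist_norm)
qed

lemma edge_length_quotient:
  assumes "c \<in> E" "e \<in> c"
  shows "edge_length N (SOME e. e \<in> c) = edge_length N e"
proof -
  have "(SOME e. e \<in> c) \<in> c" using assms(2) by (rule someI)
  then have "(SOME e. e \<in> c) \<in> edge_orbit N e" using quotient_edge_eq[OF assms] by simp
  then obtain g where "g \<in> \<Lambda>" "(SOME e. e \<in> c) = act N g ` e" by (auto simp: mem_edge_orbit)
  then show ?thesis using edge_length_act quotient_edge_eq[OF assms] by simp
qed

lemma connectedD: "u \<in> V \<Longrightarrow> v \<in> V \<Longrightarrow> (u, v) \<in> {(x, y). {x, y} \<in> edges N}\<^sup>*"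
  using connected by (simp add: connected_graph_def)

lemma boundary_edge:
  assumes "u \<in> V" "v \<in> V" "P u" "\<not> P v"
  obtains x y where "{x, y} \<in> edges N" "P x" "\<not> P y"
proof -
  have "(u, v) \<in> {(x, y). {x, y} \<in> edges N}\<^sup>* \<Longrightarrow> P u \<Longrightarrow> \<not> P v \<Longrightarrow> \<exists>x y. {x, y} \<in> edges N \<and> P x \<and> \<not> P y"
    by (induction rule: converse_rtrancl_induct) auto
  then show thesis using connectedD assms that by blast
qed

subsection \<open>Spanning trees of orbit representatives\<close>

text \<open>The invariants need each other, so a single induction proves them all. The last one lets
  \<open>F\<close> be identified with a set of quotient edges.\<close>

lemma tree_basic:
  assumes "tree N r R F" "r \<in> V"
  shows "finite R \<and> R \<subseteq> V \<and> r \<in> R \<and> finite F \<and> F \<subseteq> R \<times> R \<and> card R = card F + 1 \<and>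
    (\<forall>(u, w)\<in>F. {u, w} \<in> edges N) \<and> (\<forall>a\<in>R. \<forall>b\<in>R. b \<in> vertex_orbit N a \<longrightarrow> a = b) \<and>
    inj_on (\<lambda>(u, w). edge_orbit N {u, w}) F"
  using assms
proof (induction rule: tree.induct)
  case root
  then show ?case by auto
next
  case (grow R F u w)
  then have IH: "finite R" "R \<subseteq> V" "r \<in> R" "finite F" "F \<subseteq> R \<times> R" "card R = card F + 1"
    "\<forall>(u, w)\<in>F. {u, w} \<in> edges N" "\<forall>a\<in>R. \<forall>b\<in>R. b \<in> vertex_orbit N a \<longrightarrow> a = b"
    "inj_on (\<lambda>(u, w). edge_orbit N {u, w}) F" by auto
  have w: "w \<in> V" "u \<in> V" using edge_verts[OF grow.hyps(3)] by auto
  have wR: "w \<notin> R" using grow.hyps(4) IH(2) vertex_orbit_self by blast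
  have sym: "a \<notin> vertex_orbit N w" if "a \<in> R" for a
    using grow.hyps(4) that vertex_orbit_eq[OF w(1), of a] vertex_orbit_self[OF w(1)] by auto
  have wF: "(u, w) \<notin> F" using IH(5) wR by auto
  \<comment> \<open>Otherwise \<open>w\<close> would be a translate of an end of an old tree edge,
    hence of a vertex of \<open>R\<close>.\<close>
  have "edge_orbit N {u, w} \<noteq> edge_orbit N {a, b}" if ab: "(a, b) \<in> F" for a b
  proof
    assume "edge_orbit N {u, w} = edge_orbit N {a, b}"
    then have "{u, w} \<in> edge_orbit N {a, b}" using edge_orbit_self[OF grow.hyps(3)] by simp
    then obtain g where "g \<in> \<Lambda>" "{u, w} = {act N g a, act N g b}" by (auto simp: mem_edge_orbit)
    then have "w \<in> vertex_orbit N a \<or> w \<in> vertex_orbit N b"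
      unfolding mem_vertex_orbit by (auto simp: doubleton_eq_iff)
    then show False using ab IH(5) grow.hyps(4) by auto
  qed
  then have "inj_on (\<lambda>(u, w). edge_orbit N {u, w}) (insert (u, w) F)"
    using IH(9) wF by (auto simp: inj_on_insert)
  moreover have "\<forall>a\<in>insert w R. \<forall>b\<in>insert w R. b \<in> vertex_orbit N a \<longrightarrow> a = b"
    using IH(8) sym grow.hyps(4) by auto
  ultimately show ?case using IH wR wF w grow.hyps by auto
qed

text \<open>\<open>D x\<close> is the set of descendants of the tree edge \<open>x\<close>.\<close>

lemma tree_descendants:
  assumes "tree N r R F" "r \<in> V"
  shows "\<exists>D :: 'v \<times> 'v \<Rightarrow> 'v set. (\<forall>x\<in>F. D x \<subseteq> R) \<and>
    (\<forall>x\<in>F. \<forall>y\<in>F. D x \<subseteq> D y \<or> D y \<subseteq> D x \<or> D x \<inter> D y = {}) \<and>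
    (\<forall>a\<in>R. \<forall>p :: 'v \<Rightarrow> (real, 'n) vec. p a - p r = (\<Sum>x\<in>F. of_bool (a \<in> D x) *\<^sub>R (p (snd x) - p (fst x))))"
  using assms
proof (induction rule: tree.induct)
  case root
  then show ?case by auto
next
  case (grow R F u w)
  then obtain D :: "'v \<times> 'v \<Rightarrow> 'v set" where D: "\<forall>x\<in>F. D x \<subseteq> R"
    "\<forall>x\<in>F. \<forall>y\<in>F. D x \<subseteq> D y \<or> D y \<subseteq> D x \<or> D x \<inter> D y = {}"
    "\<forall>a\<in>R. \<forall>p :: 'v \<Rightarrow> (real, 'n) vec. p a - p r = (\<Sum>x\<in>F. of_bool (a \<in> D x) *\<^sub>R (p (snd x) - p (fst x)))"
    by blast
  have B: "finite R" "R \<subseteq> V" "finite F" "F \<subseteq> R \<times> R"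
    using tree_basic[OF grow.hyps(1) grow.prems] by auto
  have wR: "w \<notin> R" using grow.hyps(4) B(2) vertex_orbit_self by blast
  have wF: "(u, w) \<notin> F" using B(4) wR by auto
  \<comment> \<open>The leaf \<open>w\<close> joins the descendants of exactly those edges that lie
    above its parent \<open>u\<close>, and is the only descendant of its own edge. The path to
    \<open>w\<close> is thus the path to \<open>u\<close> and one more edge.\<close>
  define D' where "D' x = (if x = (u, w) then {w} else if u \<in> D x then insert w (D x) else D x)" for x
  have 1: "\<forall>x\<in>insert (u, w) F. D' x \<subseteq> insert w R" using D(1) by (auto simp: D'_def)
  have nw: "w \<notin> D x" if "x \<in> F" for x using D(1) that wR by auto
  have ne: "x \<noteq> (u, w)" if "x \<in> F" for x using that wF by auto
  have sub: "D' x \<subseteq> D' y \<or> D' y \<subseteq> D' x \<or> D' x \<inter> D' y = {}" if "x \<in> F" "y \<in> F" for x y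
    using D(2)[rule_format, OF that] nw[OF that(1)] nw[OF that(2)] ne that by (auto simp: D'_def)
  have 2: "\<forall>x\<in>insert (u, w) F. \<forall>y\<in>insert (u, w) F. D' x \<subseteq> D' y \<or> D' y \<subseteq> D' x \<or> D' x \<inter> D' y = {}"
    using sub nw ne by (auto simp: D'_def)
  have 3: "p a - p r = (\<Sum>x\<in>insert (u, w) F. of_bool (a \<in> D' x) *\<^sub>R (p (snd x) - p (fst x)))"
    if a: "a \<in> insert w R" for a and p :: "'v \<Rightarrow> (real, 'n) vec"
  proof (cases "a = w")
    case True
    have "(\<Sum>x\<in>insert (u, w) F. of_bool (a \<in> D' x) *\<^sub>R (p (snd x) - p (fst x)))
      = p w - p u + (\<Sum>x\<in>F. of_bool (a \<in> D' x) *\<^sub>R (p (snd x) - p (fst x)))"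
      using B(3) wF by (simp add: True D'_def)
    also have "(\<Sum>x\<in>F. of_bool (a \<in> D' x) *\<^sub>R (p (snd x) - p (fst x)))
      = (\<Sum>x\<in>F. of_bool (u \<in> D x) *\<^sub>R (p (snd x) - p (fst x)))"
      using ne nw by (intro sum.cong refl) (auto simp: True D'_def)
    also have "\<dots> = p u - p r" using D(3) grow.hyps(2) by simp
    finally show ?thesis by (simp add: True)
  next
    case False
    then have "(\<Sum>x\<in>insert (u, w) F. of_bool (a \<in> D' x) *\<^sub>R (p (snd x) - p (fst x)))
      = (\<Sum>x\<in>F. of_bool (a \<in> D' x) *\<^sub>R (p (snd x) - p (fst x)))"
      using B(3) wF by (simp add: D'_def)
    also have "\<dots> = (\<Sum>x\<in>F. of_bool (a \<in> D x) *\<^sub>R (p (snd x) - p (fst x)))"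
      using ne False by (intro sum.cong refl) (auto simp: D'_def)
    also have "\<dots> = p a - p r" using D(3) a False by simp
    finally show ?thesis by simp
  qed
  show ?case by (rule exI[of _ D'], intro conjI 1 2 ballI allI 3)
qed

text \<open>A tree with the largest number of representatives meets all orbits: an edge leaving its
  translates could be moved back by the lattice and attached.\<close>

lemma spanning_tree:
  obtains r R F where "tree N r R F" "r \<in> V" "\<And>v. v \<in> V \<Longrightarrow> \<exists>a\<in>R. v \<in> vertex_orbit N a"
proof -
  obtain r where r: "r \<in> V" using connected by (auto simp: connected_graph_def)
  let ?P = "\<lambda>R. \<exists>F. tree N r R F"
  have bound: "card R \<le> card (quotient_verts N)" if "?P R" for R
  proof (rule card_inj_on_le[of "vertex_orbit N"])
    have R: "R \<subseteq> V" "\<forall>a\<in>R. \<forall>b\<in>R. b \<in> vertex_orbit N a \<longrightarrow> a = b" using that tree_basic[OF _ r] by blast+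
    show "inj_on (vertex_orbit N) R"
    proof (rule inj_onI)
      fix x y assume "x \<in> R" "y \<in> R" "vertex_orbit N x = vertex_orbit N y"
      then have "y \<in> vertex_orbit N x" using vertex_orbit_self R(1) by blast
      then show "x = y" using R(2) \<open>x \<in> R\<close> \<open>y \<in> R\<close> by blast
    qed
    show "vertex_orbit N ` R \<subseteq> quotient_verts N" using R(1) by (auto simp: quotient_verts_def)
  qed (rule finite_verts)
  have "?P {r}" using tree.root[of N r] by (rule exI)
  then obtain R where R: "?P R" "\<And>R'. ?P R' \<Longrightarrow> card R' \<le> card R"
    using ex_has_greatest_nat[of ?P "{r}" card "card (quotient_verts N) + 1"] bound by (auto simp: less_Suc_eq_le)
  then obtain F where F: "tree N r R F" by blast
  note B = tree_basic[OF F r]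
  have "\<exists>a\<in>R. v \<in> vertex_orbit N a" if v: "v \<in> V" for v
  proof (rule ccontr)
    assume n: "\<not> ?thesis"
    have "\<exists>a\<in>R. r \<in> vertex_orbit N a" using B vertex_orbit_self[OF r] by blast
    then obtain x y where xy: "{x, y} \<in> edges N" "\<exists>a\<in>R. x \<in> vertex_orbit N a" "\<not> (\<exists>a\<in>R. y \<in> vertex_orbit N a)"
      using boundary_edge[of r v "\<lambda>x. \<exists>a\<in>R. x \<in> vertex_orbit N a"] r v n by blast
    then obtain u g where u: "u \<in> R" "g \<in> \<Lambda>" "x = act N g u" by (auto simp: mem_vertex_orbit)
    have uV: "u \<in> V" and yV: "y \<in> V" using u B edge_verts[OF xy(1)] by auto
    define w where "w = act N (- g) y"
    have "{u, w} \<in> edges N"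
      using act_edge[OF lattice_uminus[OF u(2)] xy(1)] u uV by (simp add: w_def)
    moreover have new: "\<forall>a\<in>R. w \<notin> vertex_orbit N a"
      using xy(3) act_vertex_orbit[of "- g" _ y] u(2) yV B by (auto simp: w_def)
    ultimately have "tree N r (insert w R) (insert (u, w) F)" using tree.grow[OF F u(1)] by blast
    then have "card (insert w R) \<le> card R" using R(2) by blast
    moreover have "w \<notin> R" using new B vertex_orbit_self by blast
    ultimately show False using B by simp
  qed
  then show thesis using that F r by blast
qed

end

text \<open>\<open>s c\<close> and \<open>t c\<close> are the ends of the quotient edge \<open>c\<close> and \<open>h c\<close> is its shift; \<open>T\<close> is a
  spanning tree, and \<open>D c\<close> is the set of descendants of the tree edge \<open>c\<close>.\<close>

locale net_quotient = periodic_net N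
  for N :: "('v, 'n::{finite,wellorder}) network" +
  fixes R :: "'v set" and s t :: "'v set set \<Rightarrow> 'v" and h :: "'v set set \<Rightarrow> (real, 'n) vec"
  assumes finite_R: "finite R" and R_V: "R \<subseteq> verts N"
    and cover: "\<And>v. v \<in> verts N \<Longrightarrow> \<exists>a\<in>R. v \<in> vertex_orbit N a"
    and distinct: "\<And>a b. a \<in> R \<Longrightarrow> b \<in> R \<Longrightarrow> b \<in> vertex_orbit N a \<Longrightarrow> a = b"
    and s_R: "\<And>c. c \<in> quotient_edges N \<Longrightarrow> s c \<in> R" and t_R: "\<And>c. c \<in> quotient_edges N \<Longrightarrow> t c \<in> R"
    and h_lattice: "\<And>c. c \<in> quotient_edges N \<Longrightarrow> h c \<in> lattice N"
    and end_edge: "\<And>c. c \<in> quotient_edges N \<Longrightarrow> {s c, act N (h c) (t c)} \<in> c"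

locale net_tree = net_quotient N R s t h
  for N :: "('v, 'n::{finite,wellorder}) network" and R s t h +
  fixes T :: "'v set set set" and r :: 'v and D :: "'v set set \<Rightarrow> 'v set"
  assumes T_E: "T \<subseteq> quotient_edges N" and h_T: "\<And>c. c \<in> T \<Longrightarrow> h c = 0"
    and card_R: "card R = card T + 1" and r_R: "r \<in> R"
    and laminar: "\<And>c d. c \<in> T \<Longrightarrow> d \<in> T \<Longrightarrow> D c \<subseteq> D d \<or> D d \<subseteq> D c \<or> D c \<inter> D d = {}"
    and tree_path: "\<And>a (p :: 'v \<Rightarrow> (real, 'n) vec). a \<in> R \<Longrightarrow>
      p a - p r = (\<Sum>c\<in>T. of_bool (a \<in> D c) *\<^sub>R (p (t c) - p (s c)))"

theorem (in periodic_net) net_tree_exists: "\<exists>R s t h T r D. net_tree N R s t h T r D"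
proof -
  obtain r R F where F: "tree N r R F" "r \<in> V" and cov: "\<And>v. v \<in> V \<Longrightarrow> \<exists>a\<in>R. v \<in> vertex_orbit N a"
    using spanning_tree by metis
  note B = tree_basic[OF F]
  obtain D0 :: "'v \<times> 'v \<Rightarrow> 'v set" where
    D0: "\<forall>x\<in>F. \<forall>y\<in>F. D0 x \<subseteq> D0 y \<or> D0 y \<subseteq> D0 x \<or> D0 x \<inter> D0 y = {}"
    "\<forall>a\<in>R. \<forall>p :: 'v \<Rightarrow> (real, 'n) vec. p a - p r = (\<Sum>x\<in>F. of_bool (a \<in> D0 x) *\<^sub>R (p (snd x) - p (fst x)))"
    using tree_descendants[OF F] by blast
  define \<phi> where "\<phi> = (\<lambda>(u, w). edge_orbit N {u, w})"
  have inj: "inj_on \<phi> F" using B by (simp add: \<phi>_def)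
  define T where "T = \<phi> ` F"
  define \<psi> where "\<psi> = the_inv_into F \<phi>"
  have \<psi>: "\<psi> (\<phi> x) = x" if "x \<in> F" for x using the_inv_into_f_f[OF inj that] by (simp add: \<psi>_def)
  have ex: "\<exists>u w k. u \<in> R \<and> w \<in> R \<and> k \<in> \<Lambda> \<and> {u, act N k w} \<in> c" if "c \<in> E" for c
  proof -
    obtain e where e: "e \<in> edges N" "c = edge_orbit N e" using \<open>c \<in> E\<close> by (auto simp: quotient_edges_def)
    obtain x y where xy: "e = {x, y}" "x \<in> V" "y \<in> V" using e(1) by (rule edgeE)
    obtain u g where u: "u \<in> R" "g \<in> \<Lambda>" "x = act N g u" using cov[OF xy(2)] by (auto simp: mem_vertex_orbit)
    obtain w k where w: "w \<in> R" "k \<in> \<Lambda>" "y = act N k w" using cov[OF xy(3)] by (auto simp: mem_vertex_orbit)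
    have V: "u \<in> V" "w \<in> V" using u w B by auto
    have "act N (- g) ` e = {u, act N (- g + k) w}" using u w V by (simp add: xy(1))
    then have "{u, act N (- g + k) w} \<in> c" unfolding e(2) mem_edge_orbit using u(2) lattice_uminus by metis
    then show ?thesis using u w lattice_add lattice_uminus by blast
  qed
  \<comment> \<open>Tree edges take their ends and orientation from \<open>F\<close>, with shift 0;
    for the other edges any representatives will do.\<close>
  have "\<exists>u w k. u \<in> R \<and> w \<in> R \<and> k \<in> \<Lambda> \<and> {u, act N k w} \<in> c \<and> (c \<in> T \<longrightarrow> k = 0 \<and> (u, w) = \<psi> c)" if c: "c \<in> E" for c
  proof (cases "c \<in> T")
    case False
    then show ?thesis using ex[OF c] by blast
  next
    case True
    then obtain u w where uw: "(u, w) \<in> F" "c = \<phi> (u, w)" by (auto simp: T_def)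
    have "{u, w} \<in> edges N" "u \<in> R" "w \<in> R" "w \<in> V" using uw B by auto
    then have "{u, act N 0 w} \<in> c" using uw(2) edge_orbit_self by (simp add: \<phi>_def)
    then show ?thesis using \<psi>[OF uw(1)] uw(2) \<open>u \<in> R\<close> \<open>w \<in> R\<close> lattice_zero
      by (intro exI[of _ u] exI[of _ w] exI[of _ 0]) simp
  qed
  then obtain s t h where sth: "\<And>c. c \<in> E \<Longrightarrow> s c \<in> R" "\<And>c. c \<in> E \<Longrightarrow> t c \<in> R" "\<And>c. c \<in> E \<Longrightarrow> h c \<in> \<Lambda>"
    "\<And>c. c \<in> E \<Longrightarrow> {s c, act N (h c) (t c)} \<in> c" "\<And>c. c \<in> E \<Longrightarrow> c \<in> T \<Longrightarrow> h c = 0 \<and> (s c, t c) = \<psi> c"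
    by metis
  have TE: "T \<subseteq> E" using B by (auto simp: T_def \<phi>_def quotient_edges_def)
  have card: "card R = card T + 1" using B card_image[OF inj] by (simp add: T_def)
  have "net_tree N R s t h T r (\<lambda>c. D0 (\<psi> c))"
  proof
    show "D0 (\<psi> c) \<subseteq> D0 (\<psi> d) \<or> D0 (\<psi> d) \<subseteq> D0 (\<psi> c) \<or> D0 (\<psi> c) \<inter> D0 (\<psi> d) = {}" if "c \<in> T" "d \<in> T" for c d
    proof -
      obtain x y where "x \<in> F" "c = \<phi> x" "y \<in> F" "d = \<phi> y" using \<open>c \<in> T\<close> \<open>d \<in> T\<close> by (auto simp: T_def)
      then show ?thesis using D0(1) \<psi> by simp
    qed
    show "p a - p r = (\<Sum>c\<in>T. of_bool (a \<in> D0 (\<psi> c)) *\<^sub>R (p (t c) - p (s c)))" if "a \<in> R" for a and p :: "'v \<Rightarrow> (real, 'n) vec"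
    proof -
      have "(\<Sum>c\<in>T. of_bool (a \<in> D0 (\<psi> c)) *\<^sub>R (p (t c) - p (s c)))
        = (\<Sum>x\<in>F. of_bool (a \<in> D0 (\<psi> (\<phi> x))) *\<^sub>R (p (t (\<phi> x)) - p (s (\<phi> x))))"
        unfolding T_def by (rule sum.reindex_cong[OF inj]) auto
      also have "\<dots> = (\<Sum>x\<in>F. of_bool (a \<in> D0 x) *\<^sub>R (p (snd x) - p (fst x)))"
      proof (rule sum.cong[OF refl])
        fix x assume x: "x \<in> F"
        then have "\<phi> x \<in> T" by (auto simp: T_def)
        then have "(s (\<phi> x), t (\<phi> x)) = x" using sth(5) TE \<psi>[OF x] by auto
        then have "s (\<phi> x) = fst x" "t (\<phi> x) = snd x" by (metis fst_conv snd_conv)+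
        then show "of_bool (a \<in> D0 (\<psi> (\<phi> x))) *\<^sub>R (p (t (\<phi> x)) - p (s (\<phi> x))) = of_bool (a \<in> D0 x) *\<^sub>R (p (snd x) - p (fst x))"
          by (simp add: \<psi>[OF x])
      qed
      finally show ?thesis using D0(2) that by simp
    qed
  qed (use B cov sth TE card in auto)
  then show ?thesis by blast
qed

subsection \<open>Fundamental cycles\<close>

text \<open>\<open>k Z (a, b)\<close> tells how the tree path between the ends of a chord crosses
  the tree edge with descendant set \<open>Z\<close>. When both chords cross both edges, nested sets
  give equal signs and disjoint sets opposite signs, whichever chord is taken.\<close>

lemma laminar_pair:
  assumes "X \<subseteq> Y \<or> Y \<subseteq> X \<or> X \<inter> Y = {}"
  defines "k \<equiv> \<lambda>Z (a, b). of_bool (a \<in> Z) - of_bool (b \<in> Z) :: real"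
  shows "(k X x * k X y) * (k Y x * k Y y) \<ge> 0"
proof -
  obtain a b c d where xy: "x = (a, b)" "y = (c, d)" by fastforce
  show ?thesis unfolding k_def xy
    using assms(1) by (cases "a \<in> X"; cases "b \<in> X"; cases "c \<in> X"; cases "d \<in> X") auto
qed

text \<open>A positive product would give a matrix of crossing signs with determinant \<plusminus>2.
  The pairs are first oriented so that few sign patterns remain; each of these contradicts
  laminarity at the six ends.\<close>

lemma laminar_triple:
  assumes "X \<subseteq> Y \<or> Y \<subseteq> X \<or> X \<inter> Y = {}" "Y \<subseteq> Z \<or> Z \<subseteq> Y \<or> Y \<inter> Z = {}" "X \<subseteq> Z \<or> Z \<subseteq> X \<or> X \<inter> Z = {}"
  defines "k \<equiv> \<lambda>Z (a, b). of_bool (a \<in> Z) - of_bool (b \<in> Z) :: real"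
  assumes zero: "k X z = 0" "k Y x = 0" "k Z y = 0"
  shows "(k X x * k X y) * (k Y y * k Y z) * (k Z x * k Z z) \<le> 0"
proof (rule ccontr)
  assume n: "\<not> ?thesis"
  have vals: "k W w \<in> {-1, 0, 1}" for W w by (cases w) (auto simp: k_def)
  have nz: "k X x \<noteq> 0" "k X y \<noteq> 0" "k Y y \<noteq> 0" "k Y z \<noteq> 0" "k Z x \<noteq> 0" "k Z z \<noteq> 0"
    using n by auto
  have sw: "k W (b, a) = - k W (a, b)" for W a b by (simp add: k_def)
  have oriented: "\<exists>a b. w \<in> {(a, b), (b, a)} \<and> k W (a, b) = 1" if "k W w \<noteq> 0" for w W
  proof -
    obtain a b where w: "w = (a, b)" by fastforce
    have "k W (a, b) = 1 \<or> k W (b, a) = 1" using that vals[of W w] sw[of W a b] w by auto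
    then show ?thesis using w by blast
  qed
  obtain a b where ab: "x \<in> {(a, b), (b, a)}" "k X (a, b) = 1" using oriented[OF nz(1)] by blast
  obtain c d where cd: "y \<in> {(c, d), (d, c)}" "k X (c, d) = 1" using oriented[OF nz(2)] by blast
  obtain e f where ef: "z \<in> {(e, f), (f, e)}" "k Y (c, d) * k Y (e, f) = 1"
  proof -
    obtain e f where z: "z = (e, f)" by fastforce
    have "k Y (c, d) \<noteq> 0" using nz(3) cd(1) sw[of Y c d] by auto
    then have "k Y (c, d) * k Y (e, f) = 1 \<or> k Y (c, d) * k Y (f, e) = 1"
      using nz(4) vals[of Y "(c, d)"] vals[of Y "(e, f)"] sw[of Y e f] z by auto
    then show thesis using that z by auto
  qed
  have "(k X x * k X y) * (k Y y * k Y z) * (k Z x * k Z z)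
    = (k X (a, b) * k X (c, d)) * (k Y (c, d) * k Y (e, f)) * (k Z (a, b) * k Z (e, f))"
    using ab(1) cd(1) ef(1) sw[of X a b] sw[of Z a b] sw[of X c d] sw[of Y c d] sw[of Y e f] sw[of Z e f]
    by (elim insertE emptyE; simp)
  then have pos: "k Z (a, b) * k Z (e, f) > 0" using n ab(2) cd(2) ef(2) by simp
  have zero': "k X (e, f) = 0" "k Y (a, b) = 0" "k Z (c, d) = 0"
    using zero ab(1) cd(1) ef(1) sw[of X e f] sw[of Y a b] sw[of Z c d] by auto
  have X: "a \<in> X" "b \<notin> X" "c \<in> X" "d \<notin> X" "e \<in> X \<longleftrightarrow> f \<in> X"
    using ab(2) cd(2) zero'(1) by (auto simp: k_def of_bool_def split: if_splits)
  have Y: "(c \<in> Y \<and> d \<notin> Y \<and> e \<in> Y \<and> f \<notin> Y) \<or> (c \<notin> Y \<and> d \<in> Y \<and> e \<notin> Y \<and> f \<in> Y)" "a \<in> Y \<longleftrightarrow> b \<in> Y"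
    using ef(2) zero'(2) by (auto simp: k_def of_bool_def split: if_splits)
  have Z: "(a \<in> Z \<and> b \<notin> Z \<and> e \<in> Z \<and> f \<notin> Z) \<or> (a \<notin> Z \<and> b \<in> Z \<and> e \<notin> Z \<and> f \<in> Z)" "c \<in> Z \<longleftrightarrow> d \<in> Z"
    using pos zero'(3) by (auto simp: k_def of_bool_def split: if_splits)
  \<comment> \<open>Laminarity read off at the six ends only, which turns the rest into
    propositional logic.\<close>
  have L: "(a \<notin> X \<or> a \<in> Y) \<and> (b \<notin> X \<or> b \<in> Y) \<and> (c \<notin> X \<or> c \<in> Y) \<and> (d \<notin> X \<or> d \<in> Y) \<and> (e \<notin> X \<or> e \<in> Y) \<and> (f \<notin> X \<or> f \<in> Y)
    \<or> (a \<notin> Y \<or> a \<in> X) \<and> (b \<notin> Y \<or> b \<in> X) \<and> (c \<notin> Y \<or> c \<in> X) \<and> (d \<notin> Y \<or> d \<in> X) \<and> (e \<notin> Y \<or> e \<in> X) \<and> (f \<notin> Y \<or> f \<in> X)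
    \<or> (a \<notin> X \<or> a \<notin> Y) \<and> (b \<notin> X \<or> b \<notin> Y) \<and> (c \<notin> X \<or> c \<notin> Y) \<and> (d \<notin> X \<or> d \<notin> Y) \<and> (e \<notin> X \<or> e \<notin> Y) \<and> (f \<notin> X \<or> f \<notin> Y)"
    if "X \<subseteq> Y \<or> Y \<subseteq> X \<or> X \<inter> Y = {}" for X Y :: "'a set" using that by blast
  from X Y Z L[OF assms(1)] L[OF assms(2)] L[OF assms(3)] show False
    by argo
qed

section \<open>Quotient edges with chosen ends and shifts\<close>

context net_quotient
begin

definition edge_vec :: "'v set set \<Rightarrow> (real, 'n) vec" where
  "edge_vec c = pos N (t c) + h c - pos N (s c)"

lemma s_V [simp]: "c \<in> E \<Longrightarrow> s c \<in> V" and t_V [simp]: "c \<in> E \<Longrightarrow> t c \<in> V"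
  using s_R t_R R_V by auto

lemma end_edge': "c \<in> E \<Longrightarrow> {s c, act N (h c) (t c)} \<in> edges N"
  using quotient_edge_eq end_edge by blast

lemma quotient_edge_orbit: "c \<in> E \<Longrightarrow> c = edge_orbit N {s c, act N (h c) (t c)}"
  using quotient_edge_eq end_edge by blast

lemma norm_edge_vec: "c \<in> E \<Longrightarrow> norm (edge_vec c) = edge_length N (SOME e. e \<in> c)"
  by (simp add: edge_length_quotient[OF _ end_edge] edge_length_pair edge_vec_def dist_norm norm_minus_commute h_lattice)

lemma network_length_eq: "network_length N = (\<Sum>c\<in>E. norm (edge_vec c))"
  unfolding network_length_def by (rule sum.cong) (simp_all add: norm_edge_vec)

lemma edge_vec_nonzero: "c \<in> E \<Longrightarrow> edge_vec c \<noteq> 0"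
  using pos_edge[OF end_edge', of c] by (auto simp: edge_vec_def h_lattice)

lemma rep_unique:
  assumes "a \<in> R" "b \<in> R" "g \<in> \<Lambda>" "k \<in> \<Lambda>" "act N g a = act N k b"
  shows "a = b" "g = k"
proof -
  have V: "a \<in> V" "b \<in> V" using assms R_V by auto
  have "act N (- g) (act N g a) = act N (- g) (act N k b)" using assms(5) by simp
  then have "a = act N (- g + k) b" using assms(1-4) V by simp
  then have "a \<in> vertex_orbit N b" using assms(3,4) unfolding mem_vertex_orbit by (intro bexI[of _ "- g + k"]) auto
  then show "a = b" using distinct[of b a] assms by simp
  then show "g = k" using assms V by simp
qed

lemma edge_form:
  assumes "{u, w} \<in> edges N"
  obtains c g where "c \<in> E" "g \<in> \<Lambda>" "{u, w} \<in> c"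
    "(u = act N g (s c) \<and> w = act N (g + h c) (t c)) \<or> (w = act N g (s c) \<and> u = act N (g + h c) (t c))"
proof -
  define c where "c = edge_orbit N {u, w}"
  have c: "c \<in> E" using assms by (auto simp: c_def quotient_edges_def)
  have uc: "{u, w} \<in> c" unfolding c_def by (rule edge_orbit_self[OF assms])
  then have "{u, w} \<in> edge_orbit N {s c, act N (h c) (t c)}" using quotient_edge_orbit[OF c] by simp
  then obtain g where g: "g \<in> \<Lambda>" "{u, w} = act N g ` {s c, act N (h c) (t c)}" by (auto simp: mem_edge_orbit)
  then have "{u, w} = {act N g (s c), act N (g + h c) (t c)}" using c h_lattice by simp
  then show thesis using that[OF c g(1) uc] by (auto simp: doubleton_eq_iff)
qed

end

context net_tree
begin

lemma finite_T: "finite T"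
  using T_E finite_edges finite_subset by blast

text \<open>Tree edges have shift 0, so the translates of representatives by lattice vectors in the
  span of the chord shifts are closed under adjacency. By connectedness they are all vertices, and
  every lattice vector lies in the span.\<close>

lemma chord_shifts_span: "span (h ` (E - T)) = UNIV"
proof -
  let ?S = "span (h ` (E - T))"
  have "\<Lambda> \<subseteq> ?S"
  proof (rule subsetI, rule ccontr)
    fix g assume g: "g \<in> \<Lambda>" "g \<notin> ?S"
    let ?P = "\<lambda>v. \<exists>a\<in>R. \<exists>k\<in>\<Lambda>. v = act N k a \<and> k \<in> ?S"
    have r: "r \<in> V" using r_R R_V by auto
    have 1: "?P r" using r r_R by (intro bexI[of _ r] bexI[of _ 0]) (auto simp: span_zero)
    have 2: "\<not> ?P (act N g r)" using rep_unique(2)[OF r_R _ g(1)] g(2) by metis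
    obtain x y where xy: "{x, y} \<in> edges N" "?P x" "\<not> ?P y"
      by (rule boundary_edge[of r "act N g r" ?P, OF r act_verts[OF g(1) r] 1 2], rule that)
    obtain a k where a: "a \<in> R" "k \<in> \<Lambda>" "x = act N k a" "k \<in> ?S" using xy(2) by blast
    obtain c m where c: "c \<in> E" "m \<in> \<Lambda>"
      "(x = act N m (s c) \<and> y = act N (m + h c) (t c)) \<or> (y = act N m (s c) \<and> x = act N (m + h c) (t c))"
      using edge_form[OF xy(1)] by metis
    have hc: "h c \<in> ?S" using h_T c(1) by (cases "c \<in> T") (auto simp: span_zero span_base)
    have mh: "m + h c \<in> \<Lambda>" using c h_lattice by simp
    from c(3) show False
    proof
      assume c3: "x = act N m (s c) \<and> y = act N (m + h c) (t c)"
      then have "k = m" using rep_unique(2)[of a "s c" k m] a s_R c by auto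
      then have "m + h c \<in> ?S" using a(4) hc span_add by blast
      then have "?P y" using c3 t_R[OF c(1)] mh by blast
      then show False using xy(3) by simp
    next
      assume c3: "y = act N m (s c) \<and> x = act N (m + h c) (t c)"
      then have "k = m + h c" using rep_unique(2)[of a "t c" k "m + h c"] a t_R c mh by auto
      then have "m \<in> ?S" using span_diff[OF a(4) hc] by simp
      then have "?P y" using c3 s_R[OF c(1)] c(2) by blast
      then show False using xy(3) by simp
    qed
  qed
  then have "span \<Lambda> \<subseteq> ?S" by (metis span_mono span_span)
  then show ?thesis using full_lattice_span[OF full] by auto
qed

lemma independent_chords:
  obtains ch :: "'n \<Rightarrow> 'v set set" where "inj ch" "\<And>i. ch i \<in> E - T" "det (\<chi> i. h (ch i)) \<noteq> 0"
proof -
  obtain B where B: "B \<subseteq> h ` (E - T)" "independent B" "span B = UNIV"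
    using maximal_independent_subset[of "h ` (E - T)"] chord_shifts_span
    by (metis span_mono span_span top.extremum_uniqueI)
  have "card B = CARD('n)" using B(2,3) dim_eq_card[of B UNIV] by (simp add: dim_span)
  moreover have "finite B" using B(2) independent_imp_finite by blast
  ultimately obtain f :: "'n \<Rightarrow> (real, 'n) vec" where f: "bij_betw f UNIV B"
    using finite_same_card_bij[of "UNIV :: 'n set" B] by auto
  then have "f i \<in> h ` (E - T)" for i using B(1) by (auto simp: bij_betw_def)
  then have "\<forall>i. \<exists>c\<in>E - T. h c = f i" by (metis imageE)
  then obtain ch where ch: "\<And>i. ch i \<in> E - T" "\<And>i. h (ch i) = f i" by metis
  have "inj ch" using f ch(2) by (metis bij_betw_imp_inj_on injD injI)
  moreover have "det (\<chi> i. h (ch i)) \<noteq> 0"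
    using independent_family_iff_det[of f] f B(2) by (simp add: ch(2) bij_betw_def)
  ultimately show thesis using that ch(1) by blast
qed

text \<open>Cycle \<open>i\<close> runs along the chord \<open>ch i\<close> and back through the
  tree. The first item is stated for every potential \<open>p\<close>: positions yield the periods,
  and indicator functions yield the balance at a vertex. The last item is Euler's formula in the
  case that the chosen chords are the only ones.\<close>

theorem fundamental_cycles:
  obtains k :: "'v set set \<Rightarrow> (real, 'n) vec" where
    "\<And>(p :: 'v \<Rightarrow> (real, 'n) vec) i. (\<Sum>c\<in>E. k c $ i *\<^sub>R (p (t c) - p (s c))) = 0"
    "det (\<chi> i. \<Sum>c\<in>E. k c $ i *\<^sub>R h c) \<noteq> 0"
    "\<And>c i. k c $ i \<in> {-1, 0, 1}"
    "\<And>c d i j. c \<in> E \<Longrightarrow> d \<in> E \<Longrightarrow> i \<noteq> j \<Longrightarrow> (k c $ i * k c $ j) * (k d $ i * k d $ j) \<ge> 0"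
    "\<And>c d e i j l. c \<in> E \<Longrightarrow> d \<in> E \<Longrightarrow> e \<in> E \<Longrightarrow> i \<noteq> j \<Longrightarrow> j \<noteq> l \<Longrightarrow> i \<noteq> l \<Longrightarrow>
       k c $ l = 0 \<Longrightarrow> k d $ i = 0 \<Longrightarrow> k e $ j = 0 \<Longrightarrow>
       (k c $ i * k c $ j) * (k d $ j * k d $ l) * (k e $ i * k e $ l) \<le> 0"
    "(\<forall>c\<in>E. k c \<noteq> 0) \<longrightarrow> card E + 1 = card R + CARD('n)"
proof -
  obtain ch :: "'n \<Rightarrow> 'v set set" where ch: "inj ch" "\<And>i. ch i \<in> E - T" "det (\<chi> i. h (ch i)) \<noteq> 0"
    by (rule independent_chords, rule that)
  define ends where "ends i = (s (ch i), t (ch i))" for i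
  define \<alpha> where "\<alpha> = (\<lambda>Z (a :: 'v, b). of_bool (a \<in> Z) - of_bool (b \<in> Z) :: real)"
  \<comment> \<open>On a tree edge: the root path to the start of the chord minus the root path to
    its end. Chords that were not chosen get 0.\<close>
  define k :: "'v set set \<Rightarrow> (real, 'n) vec" where
    "k c = (\<chi> i. if c \<in> T then \<alpha> (D c) (ends i) else of_bool (c = ch i))" for c
  have kT: "k c $ i = \<alpha> (D c) (ends i)" if "c \<in> T" for c i using that by (simp add: k_def)
  have kC: "k c $ i = of_bool (c = ch i)" if "c \<notin> T" for c i using that by (simp add: k_def)
  have vals: "k c $ i \<in> {-1, 0, 1}" for c i by (auto simp: k_def \<alpha>_def ends_def)
  \<comment> \<open>A chord lies on at most one of the cycles, so the sign conditions are a matter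
    of tree edges only.\<close>
  have kC2: "k c $ i * k c $ j = 0" if "c \<notin> T" "i \<noteq> j" for c i j
    using that ch(1) by (auto simp: kC inj_eq)
  have split: "(\<Sum>c\<in>E. f c) = (\<Sum>c\<in>T. f c) + (\<Sum>c\<in>E - T. f c)" for f :: "'v set set \<Rightarrow> (real, 'n) vec"
    using sum.subset_diff[OF T_E finite_edges, of f] by (simp add: add.commute)
  have chord: "(\<Sum>c\<in>E - T. k c $ i *\<^sub>R f c) = f (ch i)" for f :: "'v set set \<Rightarrow> (real, 'n) vec" and i
  proof -
    have "(\<Sum>c\<in>E - T. k c $ i *\<^sub>R f c) = (\<Sum>c\<in>E - T. if c = ch i then f c else 0)"
      by (intro sum.cong refl) (auto simp: kC)
    then show ?thesis using ch(2)[of i] finite_edges by simp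
  qed
  show thesis
  proof (rule that[of k])
    fix p :: "'v \<Rightarrow> (real, 'n) vec" and i
    have R: "s (ch i) \<in> R" "t (ch i) \<in> R" using ch(2)[of i] s_R t_R by auto
    have "(\<Sum>c\<in>T. k c $ i *\<^sub>R (p (t c) - p (s c)))
      = (p (s (ch i)) - p r) - (p (t (ch i)) - p r)"
      unfolding tree_path[OF R(1)] tree_path[OF R(2)] sum_subtractf[symmetric]
      by (intro sum.cong refl) (simp add: kT \<alpha>_def ends_def scaleR_diff_left)
    then show "(\<Sum>c\<in>E. k c $ i *\<^sub>R (p (t c) - p (s c))) = 0"
      unfolding split chord by simp
  next
    have "(\<Sum>c\<in>T. k c $ i *\<^sub>R h c) = 0" for i by (intro sum.neutral ballI) (simp add: h_T)
    then show "det (\<chi> i. \<Sum>c\<in>E. k c $ i *\<^sub>R h c) \<noteq> 0"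
      unfolding split chord using ch(3) by simp
  next
    show "k c $ i \<in> {-1, 0, 1}" for c i by (rule vals)
  next
    fix c d i j assume "c \<in> E" "d \<in> E" "i \<noteq> (j :: 'n)"
    show "(k c $ i * k c $ j) * (k d $ i * k d $ j) \<ge> 0"
    proof (cases "c \<in> T \<and> d \<in> T")
      case True
      then show ?thesis using laminar_pair[OF laminar, of c d] by (simp add: kT \<alpha>_def)
    next
      case False
      then have "k c $ i * k c $ j = 0 \<or> k d $ i * k d $ j = 0" using kC2 \<open>i \<noteq> j\<close> by blast
      then show ?thesis by (metis mult_zero_left mult_zero_right order_refl)
    qed
  next
    fix c d e i j l
    assume ne: "i \<noteq> (j :: 'n)" "j \<noteq> l" "i \<noteq> l" and z: "k c $ l = 0" "k d $ i = 0" "k e $ j = 0"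
    show "(k c $ i * k c $ j) * (k d $ j * k d $ l) * (k e $ i * k e $ l) \<le> 0"
    proof (cases "c \<in> T \<and> d \<in> T \<and> e \<in> T")
      case True
      then show ?thesis
        using laminar_triple[OF laminar laminar laminar, of c d e "ends l" "ends i" "ends j"] z
        by (simp add: kT \<alpha>_def)
    next
      case False
      then have "k c $ i * k c $ j = 0 \<or> k d $ j * k d $ l = 0 \<or> k e $ i * k e $ l = 0" using kC2 ne by blast
      then show ?thesis by (metis mult_zero_left mult_zero_right order_refl)
    qed
  next
    show "(\<forall>c\<in>E. k c \<noteq> 0) \<longrightarrow> card E + 1 = card R + CARD('n)"
    proof
      assume nz: "\<forall>c\<in>E. k c \<noteq> 0"
      have "E - T = range ch"
      proof
        show "range ch \<subseteq> E - T" using ch(2) by auto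
        show "E - T \<subseteq> range ch"
        proof
          fix c assume c: "c \<in> E - T"
          then have "k c \<noteq> 0" using nz by simp
          then obtain i where "k c $ i \<noteq> 0" by (auto simp: vec_eq_iff)
          then show "c \<in> range ch" using c by (auto simp: kC)
        qed
      qed
      then have "card (E - T) = CARD('n)" using card_image[OF ch(1)] by simp
      then have "card E = card T + CARD('n)"
        using card_Diff_subset[OF finite_T T_E] card_mono[OF finite_edges T_E] by simp
      then show "card E + 1 = card R + CARD('n)" using card_R by simp
    qed
  qed
qed

end

subsection \<open>The length inequality\<close>

text \<open>\<open>v c\<close> is the coefficient vector after the unimodular change of cycles.
  \<open>flow\<close> is the balance at all vertices, tested against an arbitrary potential;
  \<open>card_E\<close> is Euler's formula for cycle rank three.\<close>

locale net_flow = net_quotient N R s t h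
  for N :: "('v, 3) network" and R s t h +
  fixes v :: "'v set set \<Rightarrow> real ^ 3"
  assumes v_A3: "\<And>c. c \<in> quotient_edges N \<Longrightarrow> v c \<in> A3"
    and flow: "\<And>(p :: 'v \<Rightarrow> real ^ 3) i. (\<Sum>c\<in>quotient_edges N. v c $ i *\<^sub>R (p (t c) - p (s c))) = 0"
    and det_periods: "det (\<chi> i. \<Sum>c\<in>quotient_edges N. v c $ i *\<^sub>R h c) \<noteq> 0"
    and card_E: "(\<And>c. c \<in> quotient_edges N \<Longrightarrow> v c \<noteq> 0) \<Longrightarrow> card (quotient_edges N) = card R + 2"

theorem net_flow_exists:
  fixes N :: "('v, 3) network"
  assumes "periodic_network N"
  shows "\<exists>R s t h v. net_flow N R s t h v"
proof -
  interpret periodic_net N by unfold_locales (rule assms)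
  obtain R s t h T r D where nt: "net_tree N R s t h T r D" using net_tree_exists by blast
  interpret net_tree N R s t h T r D by (rule nt)
  obtain k :: "'v set set \<Rightarrow> real ^ 3" where
    k: "\<And>(p :: 'v \<Rightarrow> real ^ 3) i. (\<Sum>c\<in>E. k c $ i *\<^sub>R (p (t c) - p (s c))) = 0"
    "det (\<chi> i. \<Sum>c\<in>E. k c $ i *\<^sub>R h c) \<noteq> 0"
    "\<And>c i. k c $ i \<in> {-1, 0, 1}"
    "\<And>c d i j. c \<in> E \<Longrightarrow> d \<in> E \<Longrightarrow> i \<noteq> j \<Longrightarrow> (k c $ i * k c $ j) * (k d $ i * k d $ j) \<ge> 0"
    "\<And>c d e i j l. c \<in> E \<Longrightarrow> d \<in> E \<Longrightarrow> e \<in> E \<Longrightarrow> i \<noteq> j \<Longrightarrow> j \<noteq> l \<Longrightarrow> i \<noteq> l \<Longrightarrow>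
       k c $ l = 0 \<Longrightarrow> k d $ i = 0 \<Longrightarrow> k e $ j = 0 \<Longrightarrow>
       (k c $ i * k c $ j) * (k d $ j * k d $ l) * (k e $ i * k e $ l) \<le> 0"
    "(\<forall>c\<in>E. k c \<noteq> 0) \<longrightarrow> card E + 1 = card R + CARD(3)"
    by (rule fundamental_cycles, rule that)
  have "\<exists>W :: real ^ 3 ^ 3. (\<forall>i j. W $ i $ j \<in> \<int>) \<and> \<bar>det W\<bar> = 1 \<and> (\<forall>x\<in>k ` E. W *v x \<in> A3)"
  proof (rule sign_vectors_to_A3)
    show "x $ i \<in> {-1, 0, 1}" if "x \<in> k ` E" for x i using that k(3) by auto
    show "(x $ i * x $ j) * (y $ i * y $ j) \<ge> 0" if "x \<in> k ` E" "y \<in> k ` E" "i \<noteq> j" for x y i j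
      using that k(4) by auto
    show "(x $ 1 * x $ 2) * (y $ 2 * y $ 3) * (z $ 1 * z $ 3) \<le> 0"
      if "x \<in> k ` E" "y \<in> k ` E" "z \<in> k ` E" "x $ 3 = 0" "y $ 1 = 0" "z $ 2 = 0" for x y z
      using that k(5)[of _ _ _ 1 2 3] by auto
  qed
  then obtain W :: "real ^ 3 ^ 3" where W: "\<bar>det W\<bar> = 1" "\<And>c. c \<in> E \<Longrightarrow> W *v k c \<in> A3" by auto
  define v where "v c = W *v k c" for c
  have vs: "(\<Sum>c\<in>E. v c $ i *\<^sub>R f c) = (\<Sum>j\<in>UNIV. W $ i $ j *\<^sub>R (\<Sum>c\<in>E. k c $ j *\<^sub>R f c))"
    for f :: "'v set set \<Rightarrow> real ^ 3" and i
  proof -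
    have "(\<Sum>c\<in>E. v c $ i *\<^sub>R f c) = (\<Sum>c\<in>E. \<Sum>j\<in>UNIV. W $ i $ j *\<^sub>R (k c $ j *\<^sub>R f c))"
      by (intro sum.cong refl) (simp add: v_def matrix_vector_mult_def scaleR_sum_left)
    also have "\<dots> = (\<Sum>j\<in>UNIV. \<Sum>c\<in>E. W $ i $ j *\<^sub>R (k c $ j *\<^sub>R f c))" by (rule sum.swap)
    finally show ?thesis by (simp add: scaleR_sum_right)
  qed
  have "net_flow N R s t h v"
  proof
    show "v c \<in> A3" if "c \<in> E" for c using W(2)[OF that] by (simp add: v_def)
    show "(\<Sum>c\<in>E. v c $ i *\<^sub>R (p (t c) - p (s c))) = 0" for p :: "'v \<Rightarrow> real ^ 3" and i
      unfolding vs k(1) by simp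
    have "(\<chi> i. \<Sum>c\<in>E. v c $ i *\<^sub>R h c) = W ** (\<chi> i. \<Sum>c\<in>E. k c $ i *\<^sub>R h c)"
      unfolding vs matrix_mult_rows by simp
    then show "det (\<chi> i. \<Sum>c\<in>E. v c $ i *\<^sub>R h c) \<noteq> 0"
      using W(1) k(2) by (auto simp: det_mul)
    assume "\<And>c. c \<in> E \<Longrightarrow> v c \<noteq> 0"
    then have "k c \<noteq> 0" if "c \<in> E" for c using that by (force simp: v_def)
    then show "card E = card R + 2" using k(6) by simp
  qed
  then show ?thesis by blast
qed

context net_flow
begin

definition period :: "3 \<Rightarrow> real ^ 3" where
  "period i = (\<Sum>c\<in>E. v c $ i *\<^sub>R edge_vec c)"

text \<open>The positions cancel along closed cycles by \<open>flow\<close>, and only the shifts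
  remain.\<close>

lemma period_eq: "period i = (\<Sum>c\<in>E. v c $ i *\<^sub>R h c)"
proof -
  have "period i = (\<Sum>c\<in>E. v c $ i *\<^sub>R (pos N (t c) - pos N (s c)) + v c $ i *\<^sub>R h c)"
    unfolding period_def edge_vec_def by (intro sum.cong refl) (simp add: algebra_simps)
  then show ?thesis by (simp add: sum.distrib flow)
qed

lemma period_lattice: "period i \<in> \<Lambda>"
proof -
  have "v c $ i *\<^sub>R h c \<in> \<Lambda>" if "c \<in> E" for c
  proof -
    have "v c $ i \<in> {-1, 0, 1}" using v_A3[OF that] unfolding A3_iff by blast
    then show ?thesis using h_lattice[OF that] by auto
  qed
  note summand = this
  have "(\<Sum>c\<in>C. v c $ i *\<^sub>R h c) \<in> \<Lambda>" if "C \<subseteq> E" for C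
    using finite_subset[OF that finite_edges] that by (induction C rule: finite_induct) (auto simp: summand)
  then show ?thesis unfolding period_eq by blast
qed

lemma det_period: "det (\<chi> i. period i) \<noteq> 0"
  using det_periods by (simp add: period_eq)

lemma volume_le: "network_volume N \<le> \<bar>det (\<chi> i. period i)\<bar>"
  unfolding network_volume_def by (rule covolume_le_det[OF full period_lattice det_period])

lemma volume_pos: "network_volume N > 0"
  unfolding network_volume_def by (rule covolume_pos[OF full])

lemma length_ge_det: "27 / sqrt 2 * \<bar>det (\<chi> i. period i)\<bar> \<le> network_length N ^ 3"
  unfolding network_length_eq
  by (rule calibration_inequality[of E v period edge_vec, OF v_A3 period_def det_period])

end

theorem length_volume_inequality:
  fixes N :: "('v, 3) network"
  assumes "periodic_network N"
  shows "27 / sqrt 2 \<le> network_length N ^ 3 / network_volume N" "network_volume N > 0"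
proof -
  obtain R s t h v where "net_flow N R s t h v" using net_flow_exists[OF assms] by blast
  then interpret net_flow N R s t h v .
  show "network_volume N > 0" by (rule volume_pos)
  have "27 / sqrt 2 * network_volume N \<le> 27 / sqrt 2 * \<bar>det (\<chi> i. period i)\<bar>"
    using volume_le by (intro mult_left_mono) auto
  also have "\<dots> \<le> network_length N ^ 3" by (rule length_ge_det)
  finally show "27 / sqrt 2 \<le> network_length N ^ 3 / network_volume N"
    using volume_pos by (simp add: pos_le_divide_eq)
qed

text \<open>The equality case: \<open>edge_vec_frame\<close> says that the calibration is sharp on every edge.\<close>

locale net_min = net_flow N R s t h v
  for N :: "('v, 3) network" and R s t h v +
  fixes p q r :: "real ^ 3" and \<kappa> :: real
  assumes kappa_pos: "\<kappa> > 0"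
    and ortho: "orthonormal3 p q r"
    and edge_vec_frame: "\<And>c. c \<in> quotient_edges N \<Longrightarrow> edge_vec c = norm (edge_vec c) *\<^sub>R frame p q r (v c)"
    and mass: "\<And>i j. i < 4 \<Longrightarrow> j < 4 \<Longrightarrow> i \<noteq> j \<Longrightarrow>
      (\<Sum>c | c \<in> quotient_edges N \<and> (v c = eps i - eps j \<or> v c = eps j - eps i). norm (edge_vec c)) = \<kappa>"
    and volume_kappa: "network_volume N = 8 * sqrt 2 * \<kappa> ^ 3"

theorem net_min_exists:
  fixes N :: "('v, 3) network"
  assumes "periodic_network N" and eq: "network_length N ^ 3 / network_volume N = 27 / sqrt 2"
  shows "\<exists>R s t h v p q r \<kappa>. net_min N R s t h v p q r \<kappa>"
proof -
  obtain R s t h v where nf: "net_flow N R s t h v" using net_flow_exists[OF assms(1)] by blast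
  interpret net_flow N R s t h v by (rule nf)
  have L: "network_length N ^ 3 = 27 / sqrt 2 * network_volume N"
    using eq volume_pos by (simp add: field_simps)
  have "27 / sqrt 2 * \<bar>det (\<chi> i. period i)\<bar> \<le> 27 / sqrt 2 * network_volume N"
    using length_ge_det L by simp
  then have "\<bar>det (\<chi> i. period i)\<bar> \<le> network_volume N" by (simp add: divide_le_cancel)
  \<comment> \<open>Equality leaves no room for a proper sublattice: the periods have index 1 in the
    lattice.\<close>
  then have vol: "network_volume N = \<bar>det (\<chi> i. period i)\<bar>" using volume_le by simp
  have eq': "27 / sqrt 2 * \<bar>det (\<chi> i. period i)\<bar> = (\<Sum>c\<in>E. norm (edge_vec c)) ^ 3"
    using L vol by (simp add: network_length_eq)
  obtain p q r \<sigma> where P: "orthonormal3 p q r" "\<sigma> > 0" "period 2 + period 3 = \<sigma> *\<^sub>R p" "period 1 + period 3 = \<sigma> *\<^sub>R q"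
    "period 1 + period 2 = \<sigma> *\<^sub>R r" "\<And>c. c \<in> E \<Longrightarrow> edge_vec c = norm (edge_vec c) *\<^sub>R frame p q r (v c)"
    by (rule calibration_equality[of E v period edge_vec, OF finite_edges v_A3 period_def det_period eq']) blast+
  \<comment> \<open>The common mass of the six classes found in
    \<open>calibration_root_masses\<close>.\<close>
  define \<kappa> where "\<kappa> = \<sigma> / (2 * sqrt 2)"
  have "net_min N R s t h v p q r \<kappa>"
  proof
    show "\<kappa> > 0" using P(2) by (simp add: \<kappa>_def)
    show "orthonormal3 p q r" by (rule P(1))
    show "edge_vec c = norm (edge_vec c) *\<^sub>R frame p q r (v c)" if "c \<in> E" for c by (rule P(6)[OF that])
    show "(\<Sum>c | c \<in> E \<and> (v c = eps i - eps j \<or> v c = eps j - eps i). norm (edge_vec c)) = \<kappa>"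
      if "i < 4" "j < 4" "i \<noteq> j" for i j
      unfolding \<kappa>_def
      by (rule calibration_root_masses[of E v period edge_vec, OF finite_edges v_A3 period_def P(1,3,4,5) P(6) that])
    have "det (vector [p, q, r] :: real ^ 3 ^ 3) = 1 \<or> det (vector [p, q, r] :: real ^ 3 ^ 3) = -1"
    proof -
      have "orthogonal_matrix (vector [p, q, r] :: real ^ 3 ^ 3)"
        using P(1) unfolding orthogonal_matrix_def matrix_left_right_inverse[of _ "vector [p, q, r]"]
        by (simp add: orthonormal3_def vec_eq_iff forall_3 matrix_matrix_mult_def transpose_def mat_def
            sum_3 inner_vec_def mult.commute)
      then show ?thesis by (rule det_orthogonal_matrix)
    qed
    \<comment> \<open>The pair sums are \<open>\<sigma>\<close> times an orthonormal frame, so the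
      volume is \<open>\<sigma> ^ 3 / 2\<close>.\<close>
    moreover have "2 * det (\<chi> i. period i) = \<sigma> ^ 3 * det (vector [p, q, r] :: real ^ 3 ^ 3)"
      unfolding det_pair_sums(1)[symmetric] P by (simp add: det_3 power3_eq_cube algebra_simps)
    then have "\<bar>2 * det (\<chi> i. period i)\<bar> = \<sigma> ^ 3 * \<bar>det (vector [p, q, r] :: real ^ 3 ^ 3)\<bar>"
      using P(2) by (simp add: abs_mult)
    ultimately have "2 * \<bar>det (\<chi> i. period i)\<bar> = \<sigma> ^ 3" by (auto simp: abs_mult)
    moreover have "\<sigma> = 2 * sqrt 2 * \<kappa>" by (simp add: \<kappa>_def)
    then have "\<sigma> ^ 3 = 16 * sqrt 2 * \<kappa> ^ 3" by (simp add: power_mult_distrib power3_eq_cube)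
    ultimately show "network_volume N = 8 * sqrt 2 * \<kappa> ^ 3" using vol by linarith
  qed
  then show ?thesis by blast
qed

subsection \<open>Removing vertices of degree 2\<close>

locale removal = periodic_net N
  for N :: "('v, 'n::{finite,wellorder}) network" +
  fixes v a b :: 'v
  assumes v: "v \<in> verts N" and nbrs: "neighbours N v = {a, b}"
    and opposite: "pos N v \<in> open_segment (pos N a) (pos N b)"
    and a: "a \<notin> vertex_orbit N v" and b: "b \<notin> vertex_orbit N v"
begin

abbreviation "Ov \<equiv> vertex_orbit N v"

definition M :: "('v, 'n) network" where
  "M = N\<lparr>verts := V - Ov, edges := {e \<in> edges N. e \<inter> Ov = {}} \<union> edge_orbit N {a, b}\<rparr>"

lemma M_simps [simp]:
  "verts M = V - Ov" "edges M = {e \<in> edges N. e \<inter> Ov = {}} \<union> edge_orbit N {a, b}"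
  "pos M = pos N" "lattice M = \<Lambda>" "act M = act N"
  by (simp_all add: M_def)

lemma orbit_M [simp]: "edge_orbit M = edge_orbit N" "vertex_orbit M = vertex_orbit N"
  by (simp_all add: fun_eq_iff edge_orbit_def vertex_orbit_def)

lemma va: "{v, a} \<in> edges N" and vb: "{v, b} \<in> edges N"
  using nbrs by (auto simp: neighbours_def)

lemma aV [simp]: "a \<in> V" and bV [simp]: "b \<in> V" and ab: "a \<noteq> b"
  using edge_verts[OF va] edge_verts[OF vb] opposite by auto

lemma between_coords:
  obtains u where "0 < u" "u < 1" "pos N v = (1 - u) *\<^sub>R pos N a + u *\<^sub>R pos N b"
  using opposite by (auto simp: in_segment)

lemma nbrs_orbit:
  assumes "g \<in> \<Lambda>" "{act N g v, w} \<in> edges N"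
  shows "w = act N g a \<or> w = act N g b"
proof -
  have w: "w \<in> V" using edge_verts[OF assms(2)] by simp
  have "{act N (- g) (act N g v), act N (- g) w} \<in> edges N"
    by (rule act_edge) (use assms in auto)
  then have "{v, act N (- g) w} \<in> edges N" using v assms(1) by simp
  then have "act N (- g) w = a \<or> act N (- g) w = b" using nbrs by (auto simp: neighbours_def)
  then have "act N g (act N (- g) w) = act N g a \<or> act N g (act N (- g) w) = act N g b" by auto
  then show ?thesis using assms(1) w by simp
qed

text \<open>At either end a merged edge points in the direction of the old edge it replaces, so the
  removal changes no direction at the remaining vertices.\<close>

lemma new_ends:
  assumes "{u, w} \<in> edge_orbit N {a, b}"
  obtains g where "g \<in> \<Lambda>" "u = act N g a \<and> w = act N g b \<or> u = act N g b \<and> w = act N g a"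
    "{u, act N g v} \<in> edges N"
    "\<exists>t>0. pos N (act N g v) - pos N u = t *\<^sub>R (pos N w - pos N u)"
proof -
  obtain g where g: "g \<in> \<Lambda>" "{u, w} = {act N g a, act N g b}" using assms by (auto simp: mem_edge_orbit)
  then have uw: "u = act N g a \<and> w = act N g b \<or> u = act N g b \<and> w = act N g a" by (auto simp: doubleton_eq_iff)
  have e: "{u, act N g v} \<in> edges N"
    using uw act_edge[OF g(1) va] act_edge[OF g(1) vb] by (auto simp: insert_commute)
  obtain \<tau> where \<tau>: "0 < \<tau>" "\<tau> < 1" "pos N v = (1 - \<tau>) *\<^sub>R pos N a + \<tau> *\<^sub>R pos N b" by (rule between_coords)
  have 1: "pos N v - pos N a = \<tau> *\<^sub>R (pos N b - pos N a)" "pos N v - pos N b = (1 - \<tau>) *\<^sub>R (pos N a - pos N b)"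
    unfolding \<tau>(3) by (simp_all add: algebra_simps)
  have "\<exists>t>0. pos N (act N g v) - pos N u = t *\<^sub>R (pos N w - pos N u)"
    using uw
  proof
    assume "u = act N g a \<and> w = act N g b"
    then show ?thesis using 1(1) \<tau> g(1) v by (intro exI[of _ \<tau>]) simp
  next
    assume "u = act N g b \<and> w = act N g a"
    then show ?thesis using 1(2) \<tau> g(1) v by (intro exI[of _ "1 - \<tau>"]) simp
  qed
  then show thesis using that g(1) uw e by blast
qed

lemma outside_orbit: "g \<in> \<Lambda> \<Longrightarrow> act N g a \<notin> Ov" "g \<in> \<Lambda> \<Longrightarrow> act N g b \<notin> Ov"
  using act_vertex_orbit[of g v a] act_vertex_orbit[of g v b] a b v by auto

text \<open>An old edge with the same ends would have the direction of the edge to the removed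
  vertex, against immersion. Without this, merging could make two edges coincide.\<close>

lemma new_not_old:
  assumes "e \<in> edge_orbit N {a, b}"
  shows "e \<notin> edges N"
proof
  assume e: "e \<in> edges N"
  obtain u w where uw: "e = {u, w}" "u \<in> V" "w \<in> V" using e by (rule edgeE)
  have uwo: "{u, w} \<in> edge_orbit N {a, b}" using assms uw by simp
  obtain g where g: "g \<in> \<Lambda>" "u = act N g a \<and> w = act N g b \<or> u = act N g b \<and> w = act N g a"
    "{u, act N g v} \<in> edges N"
    "\<exists>t>0. pos N (act N g v) - pos N u = t *\<^sub>R (pos N w - pos N u)"
    by (rule new_ends[OF uwo])
  then have "act N g v = w" using immersed_direction[of u "act N g v" w] e uw by auto
  then have "w \<in> Ov" using g(1) by (auto simp: mem_vertex_orbit)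
  then show False using g(2) outside_orbit[OF g(1)] by auto
qed

lemma simple_M: "simple_graph M"
  unfolding simple_graph_def
proof
  fix e assume e: "e \<in> edges M"
  show "\<exists>u\<in>verts M. \<exists>w\<in>verts M. u \<noteq> w \<and> e = {u, w}"
  proof (cases "e \<in> edge_orbit N {a, b}")
    case True
    then obtain g where g: "g \<in> \<Lambda>" "e = {act N g a, act N g b}" by (auto simp: mem_edge_orbit)
    then show ?thesis using outside_orbit[OF g(1)] ab act_inj[OF g(1) aV bV]
      by (intro bexI[of _ "act N g a"] bexI[of _ "act N g b"]) auto
  next
    case False
    then have "e \<in> edges N" "e \<inter> Ov = {}" using e by auto
    then show ?thesis by (elim edgeE) auto
  qed
qed

text \<open>The form of \<open>new_ends\<close> that covers all edges of \<open>M\<close>; its last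
  clause allows the edge of \<open>M\<close> to be recovered from the old one.\<close>

lemma old_direction:
  assumes "{u, w} \<in> edges M"
  obtains w' t where "{u, w'} \<in> edges N" "t > 0" "pos N w' - pos N u = t *\<^sub>R (pos N w - pos N u)"
    "w' = w \<and> w \<notin> Ov \<or> (\<exists>g\<in>\<Lambda>. w' = act N g v \<and> (u = act N g a \<and> w = act N g b \<or> u = act N g b \<and> w = act N g a))"
proof (cases "{u, w} \<in> edge_orbit N {a, b}")
  case True
  then show thesis using new_ends[OF True] that by metis
next
  case False
  then have "{u, w} \<in> edges N" "w \<notin> Ov" using assms by auto
  then show thesis using that[of w 1] by simp
qed

lemma immersed_M: "immersed M"
  unfolding immersed_def
proof (intro conjI allI impI ballI)
  show ne: "pos M u \<noteq> pos M w" if e: "{u, w} \<in> edges M" for u w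
  proof -
    obtain w' t where "{u, w'} \<in> edges N" "t > 0" "pos N w' - pos N u = t *\<^sub>R (pos N w - pos N u)"
      using old_direction[OF e] by metis
    then show ?thesis using pos_edge[of u w'] by auto
  qed
  fix u w1 w2 assume n: "w1 \<in> neighbours M u" "w2 \<in> neighbours M u" "w1 \<noteq> w2"
  then have e: "{u, w1} \<in> edges M" "{u, w2} \<in> edges M" by (simp_all only: neighbours_def mem_Collect_eq)
  obtain x1 t1 where x1: "{u, x1} \<in> edges N" "t1 > 0" "pos N x1 - pos N u = t1 *\<^sub>R (pos N w1 - pos N u)"
    "x1 = w1 \<and> w1 \<notin> Ov \<or> (\<exists>g\<in>\<Lambda>. x1 = act N g v \<and> (u = act N g a \<and> w1 = act N g b \<or> u = act N g b \<and> w1 = act N g a))"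
    by (rule old_direction[OF e(1)])
  obtain x2 t2 where x2: "{u, x2} \<in> edges N" "t2 > 0" "pos N x2 - pos N u = t2 *\<^sub>R (pos N w2 - pos N u)"
    "x2 = w2 \<and> w2 \<notin> Ov \<or> (\<exists>g\<in>\<Lambda>. x2 = act N g v \<and> (u = act N g a \<and> w2 = act N g b \<or> u = act N g b \<and> w2 = act N g a))"
    by (rule old_direction[OF e(2)])
  have "\<not> (\<exists>t>0. pos N w1 - pos N u = t *\<^sub>R (pos N w2 - pos N u))"
  proof
    assume "\<exists>t>0. pos N w1 - pos N u = t *\<^sub>R (pos N w2 - pos N u)"
    then obtain t where t: "t > 0" "pos N w1 - pos N u = t *\<^sub>R (pos N w2 - pos N u)" by blast
    have "pos N x1 - pos N u = (t1 * t / t2) *\<^sub>R (pos N x2 - pos N u)"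
      unfolding x1(3) x2(3) t(2) using x2(2) by simp
    then have x: "x1 = x2" using immersed_direction[OF x1(1) x2(1), of "t1 * t / t2"] x1(2) x2(2) t(1) by simp
    have orb: "act N g v \<in> Ov" if "g \<in> \<Lambda>" for g using that by (auto simp: mem_vertex_orbit)
    have uq: "g = k" if "g \<in> \<Lambda>" "k \<in> \<Lambda>" "act N g v = act N k v" for g k using that v by simp
    have ac: "act N g a \<noteq> act N g b" if "g \<in> \<Lambda>" for g using act_inj[OF that aV bV] ab by simp
    \<comment> \<open>One old edge at \<open>u\<close> cannot stem from two edges of
      \<open>M\<close>: kept ends lie outside \<open>Ov\<close>, and \<open>act N g a\<close>
      differs from \<open>act N g b\<close>.\<close>
    show False using x1(4) x2(4) x n(3) orb uq ac by metis
  qed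
  then show "closed_segment (pos M u) (pos M w1) \<inter> closed_segment (pos M u) (pos M w2) = {pos M u}"
    using closed_segment_Int_eq_iff[of "pos N w1" "pos N u" "pos N w2"] ne[OF e(1)] by simp
qed

lemma connected_M: "connected_graph M"
proof -
  \<comment> \<open>Each removed vertex is sent to its neighbour in the orbit of \<open>a\<close>.
    Old edges then go to edges of \<open>M\<close> or to single vertices, so paths survive.\<close>
  define \<pi> where "\<pi> x = (if x \<in> Ov then act N (SOME g. g \<in> \<Lambda> \<and> x = act N g v) a else x)" for x
  have \<pi>_orbit: "\<pi> (act N g v) = act N g a" if g: "g \<in> \<Lambda>" for g
  proof -
    have "(SOME k. k \<in> \<Lambda> \<and> act N g v = act N k v) = g" by (rule some_equality) (use g v in auto)
    moreover have "act N g v \<in> Ov" using g by (auto simp: mem_vertex_orbit)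
    ultimately show ?thesis by (simp add: \<pi>_def)
  qed
  have \<pi>_out: "\<pi> x = x" if "x \<notin> Ov" for x using that by (simp add: \<pi>_def)
  let ?S = "{(x, y). {x, y} \<in> edges M}\<^sup>*"
  have new: "(act N g a, act N g b) \<in> ?S" "(act N g b, act N g a) \<in> ?S" if "g \<in> \<Lambda>" for g
  proof -
    have "{act N g a, act N g b} \<in> edges M" using that by (auto simp: mem_edge_orbit)
    then show "(act N g a, act N g b) \<in> ?S" "(act N g b, act N g a) \<in> ?S"
      by (auto simp: insert_commute simp del: M_simps)
  qed
  have step: "(\<pi> x, \<pi> y) \<in> ?S" if e: "{x, y} \<in> edges N" for x y
  proof (cases "x \<in> Ov")
    case True
    then obtain g where g: "g \<in> \<Lambda>" "x = act N g v" by (auto simp: mem_vertex_orbit)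
    then have "y = act N g a \<or> y = act N g b" using nbrs_orbit e by blast
    then show ?thesis using \<pi>_orbit[OF g(1)] \<pi>_out outside_orbit[OF g(1)] new[OF g(1)] g(2) by auto
  next
    case xO: False
    show ?thesis
    proof (cases "y \<in> Ov")
      case True
      then obtain g where g: "g \<in> \<Lambda>" "y = act N g v" by (auto simp: mem_vertex_orbit)
      then have "x = act N g a \<or> x = act N g b" using nbrs_orbit e by (metis insert_commute)
      then show ?thesis using \<pi>_orbit[OF g(1)] \<pi>_out outside_orbit[OF g(1)] new[OF g(1)] g(2) by auto
    next
      case False
      then have "{x, y} \<in> edges M" using xO e by simp
      then show ?thesis using xO False \<pi>_out by (auto simp del: M_simps)
    qed
  qed
  have path: "(x, y) \<in> {(x, y). {x, y} \<in> edges N}\<^sup>* \<Longrightarrow> (\<pi> x, \<pi> y) \<in> ?S" for x y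
  proof (induction rule: rtrancl_induct)
    case (step y z)
    then show ?case using \<open>\<And>x y. {x, y} \<in> edges N \<Longrightarrow> (\<pi> x, \<pi> y) \<in> ?S\<close>[of y z] by (auto intro: rtrancl_trans)
  qed auto
  have "(x, y) \<in> ?S" if "x \<in> verts M" "y \<in> verts M" for x y
    using path[OF connectedD[of x y]] that \<pi>_out by simp
  moreover have "a \<in> verts M" using a by simp
  ultimately show ?thesis unfolding connected_graph_def by blast
qed

lemma lattice_invariant_M: "lattice_invariant M"
  unfolding lattice_invariant_def M_simps
proof (intro conjI ballI)
  fix g e assume g: "g \<in> \<Lambda>" and e: "e \<in> {e \<in> edges N. e \<inter> Ov = {}} \<union> edge_orbit N {a, b}"
  show "act N g ` e \<in> {e \<in> edges N. e \<inter> Ov = {}} \<union> edge_orbit N {a, b}"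
  proof (cases "e \<in> edge_orbit N {a, b}")
    case True
    then obtain k where k: "k \<in> \<Lambda>" "e = {act N k a, act N k b}" by (auto simp: mem_edge_orbit)
    then have "act N g ` e = act N (g + k) ` {a, b}" using g by simp
    then show ?thesis using g k(1) lattice_add unfolding mem_edge_orbit Un_iff by blast
  next
    case False
    then have e: "e \<in> edges N" "e \<inter> Ov = {}" using e by auto
    then have "act N g ` e \<inter> Ov = {}" using act_vertex_orbit[OF g v] by (elim edgeE) auto
    then show ?thesis using act_edges[OF g e(1)] by simp
  qed
qed (use act_vertex_orbit[OF _ v] in \<open>auto simp: v\<close>)

lemma quotient_edges_M:
  "quotient_edges M = (E - {edge_orbit N {v, a}, edge_orbit N {v, b}}) \<union> {edge_orbit N {a, b}}"
proof -
  have meets: "edge_orbit N e = edge_orbit N {v, a} \<or> edge_orbit N e = edge_orbit N {v, b} \<longleftrightarrow> e \<inter> Ov \<noteq> {}"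
    if e: "e \<in> edges N" for e
  proof
    assume "edge_orbit N e = edge_orbit N {v, a} \<or> edge_orbit N e = edge_orbit N {v, b}"
    then have "e \<in> edge_orbit N {v, a} \<or> e \<in> edge_orbit N {v, b}" using edge_orbit_self[OF e] by auto
    then obtain g where "g \<in> \<Lambda>" "act N g v \<in> e" by (auto simp: mem_edge_orbit)
    moreover from this have "act N g v \<in> Ov" by (auto simp: mem_vertex_orbit)
    ultimately show "e \<inter> Ov \<noteq> {}" by blast
  next
    assume "e \<inter> Ov \<noteq> {}"
    then obtain g where g: "g \<in> \<Lambda>" "act N g v \<in> e" by (auto simp: mem_vertex_orbit)
    obtain w where w: "e = {act N g v, w}" using g(2) e by (elim edgeE) auto
    then have "w = act N g a \<or> w = act N g b" using nbrs_orbit g(1) e by blast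
    then have "e = act N g ` {v, a} \<or> e = act N g ` {v, b}" using w by auto
    then have "e \<in> edge_orbit N {v, a} \<or> e \<in> edge_orbit N {v, b}" using g(1) by (auto simp: mem_edge_orbit)
    then show "edge_orbit N e = edge_orbit N {v, a} \<or> edge_orbit N e = edge_orbit N {v, b}"
      using edge_orbit_eq[OF va] edge_orbit_eq[OF vb] by blast
  qed
  have new: "edge_orbit N e = edge_orbit N {a, b}" if e: "e \<in> edge_orbit N {a, b}" for e
  proof -
    obtain g where g: "g \<in> \<Lambda>" "e = act N g ` {a, b}" using e by (auto simp: mem_edge_orbit)
    have 1: "act N k ` e = act N (k + g) ` {a, b}" if "k \<in> \<Lambda>" for k using that g by simp
    have 2: "act N k ` {a, b} = act N (k - g) ` e" if "k \<in> \<Lambda>" for k using that g by simp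
    show ?thesis
    proof (intro equalityI subsetI)
      fix x assume "x \<in> edge_orbit N e"
      then show "x \<in> edge_orbit N {a, b}" using 1 g(1) lattice_add unfolding mem_edge_orbit by metis
    next
      fix x assume "x \<in> edge_orbit N {a, b}"
      then show "x \<in> edge_orbit N e" using 2 g(1) lattice_diff unfolding mem_edge_orbit by metis
    qed
  qed
  have self: "{a, b} \<in> edge_orbit N {a, b}" unfolding mem_edge_orbit by (rule bexI[of _ 0]) auto
  have "quotient_edges M = edge_orbit N ` {e \<in> edges N. e \<inter> Ov = {}} \<union> edge_orbit N ` edge_orbit N {a, b}"
    by (simp add: quotient_edges_def image_Un)
  also have "edge_orbit N ` edge_orbit N {a, b} = {edge_orbit N {a, b}}" using new self by blast
  also have "edge_orbit N ` {e \<in> edges N. e \<inter> Ov = {}} = E - {edge_orbit N {v, a}, edge_orbit N {v, b}}"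
    using meets unfolding quotient_edges_def by blast
  finally show ?thesis .
qed

text \<open>Two edge classes are replaced by one whose length is their sum. For the sums to match,
  the old classes must differ and the merged one must really be new.\<close>

lemma network_length_M: "network_length M = network_length N"
proof -
  let ?a = "edge_orbit N {v, a}" and ?b = "edge_orbit N {v, b}" and ?c = "edge_orbit N {a, b}"
  have len: "edge_length M = edge_length N" by (simp add: fun_eq_iff edge_length_def)
  have ne: "?a \<noteq> ?b"
  proof
    assume "?a = ?b"
    then have "{v, b} \<in> ?a" using edge_orbit_self[OF vb] by simp
    then obtain g where g: "g \<in> \<Lambda>" "{v, b} = {act N g v, act N g a}" by (auto simp: mem_edge_orbit)
    have "b \<noteq> act N g v" using b g(1) by (auto simp: mem_vertex_orbit)
    then have "v = act N g v" "b = act N g a" using g(2) by (auto simp: doubleton_eq_iff)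
    then have "g = 0" using act_eq_iff[of g 0 v] g(1) v by simp
    then show False using \<open>b = act N g a\<close> ab by simp
  qed
  have in_E: "?a \<in> E" "?b \<in> E" using va vb by (auto simp: quotient_edges_def)
  have c: "?c \<notin> E"
  proof
    assume "?c \<in> E"
    moreover have "{a, b} \<in> ?c" unfolding mem_edge_orbit by (rule bexI[of _ 0]) auto
    ultimately have "{a, b} \<in> edges N" using quotient_edge_eq by blast
    then show False using new_not_old \<open>{a, b} \<in> ?c\<close> by blast
  qed
  let ?l = "\<lambda>c. edge_length N (SOME e. e \<in> c)"
  have lc: "?l ?c = dist (pos N a) (pos N b)"
  proof -
    have "{a, b} \<in> ?c" unfolding mem_edge_orbit by (rule bexI[of _ 0]) auto
    then have "(SOME e. e \<in> ?c) \<in> ?c" by (rule someI)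
    then obtain g where g: "g \<in> \<Lambda>" "(SOME e. e \<in> ?c) = {act N g a, act N g b}" by (auto simp: mem_edge_orbit)
    show ?thesis unfolding g(2) using g(1) by (simp add: edge_length_pair)
  qed
  have la: "?l ?a = dist (pos N v) (pos N a)" "?l ?b = dist (pos N v) (pos N b)"
    using edge_length_quotient[OF in_E(1) edge_orbit_self[OF va]]
      edge_length_quotient[OF in_E(2) edge_orbit_self[OF vb]] by (simp_all add: edge_length_pair)
  have "network_length M = ?l ?c + (\<Sum>c\<in>E - {?a, ?b}. ?l c)"
    unfolding network_length_def quotient_edges_M len using c finite_edges by simp
  moreover have "network_length N = ?l ?a + (?l ?b + (\<Sum>c\<in>E - {?a, ?b}. ?l c))"
    unfolding network_length_def using in_E ne finite_edges
    by (simp add: sum.remove[of E ?a] sum.remove[of "E - {?a}" ?b] Diff_insert2[of E ?a "{?b}"])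
  moreover have "dist (pos N a) (pos N b) = dist (pos N v) (pos N a) + dist (pos N v) (pos N b)"
    using opposite between_mem_segment[of "pos N a" "pos N b" "pos N v"]
    by (simp add: open_segment_def between dist_commute)
  ultimately show ?thesis using lc la by simp
qed

lemma periodic_M: "periodic_network M"
  unfolding periodic_network_def
proof (intro conjI simple_M connected_M immersed_M lattice_invariant_M)
  show "full_lattice (lattice M)" using full by simp
  have "quotient_verts M \<subseteq> quotient_verts N" by (auto simp: quotient_verts_def)
  then show "finite (quotient_verts M)" using finite_verts finite_subset by blast
  show "finite (quotient_edges M)" unfolding quotient_edges_M using finite_edges by simp
qed

lemma card_quotient_verts_M: "card (quotient_verts M) < card (quotient_verts N)"
proof (rule psubset_card_mono[OF finite_verts])
  have "Ov \<in> quotient_verts N" using v by (auto simp: quotient_verts_def)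
  moreover have "Ov \<notin> quotient_verts M"
  proof
    assume "Ov \<in> quotient_verts M"
    then obtain u where "u \<in> V" "u \<notin> Ov" "Ov = vertex_orbit N u" by (auto simp: quotient_verts_def)
    then show False using vertex_orbit_self by blast
  qed
  moreover have "quotient_verts M \<subseteq> quotient_verts N" by (auto simp: quotient_verts_def)
  ultimately show "quotient_verts M \<subset> quotient_verts N" by blast
qed

lemma removes_M: "removes_degree_two N M"
  unfolding removes_degree_two_def M_def using v nbrs opposite a b by blast

end

theorem removes_degree_two_invariants:
  fixes N :: "('v, 'n::{finite,wellorder}) network"
  assumes "periodic_network N" "removes_degree_two N N'"
  shows "periodic_network N'" "lattice N' = lattice N" "network_length N' = network_length N"
proof -
  obtain v a b where r: "v \<in> verts N" "neighbours N v = {a, b}" "pos N v \<in> open_segment (pos N a) (pos N b)"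
    "a \<notin> vertex_orbit N v" "b \<notin> vertex_orbit N v"
    "N' = N\<lparr>verts := verts N - vertex_orbit N v,
              edges := {e \<in> edges N. e \<inter> vertex_orbit N v = {}} \<union> edge_orbit N {a, b}\<rparr>"
    using assms(2) unfolding removes_degree_two_def by blast
  interpret removal N v a b by unfold_locales (use assms(1) r in auto)
  have "N' = M" using r(6) by (simp add: M_def)
  then show "periodic_network N'" "lattice N' = lattice N" "network_length N' = network_length N"
    using periodic_M network_length_M by simp_all
qed

theorem removals_invariants:
  fixes N :: "('v, 'n::{finite,wellorder}) network"
  assumes "periodic_network N" "removes_degree_two\<^sup>*\<^sup>* N N'"
  shows "periodic_network N' \<and> lattice N' = lattice N \<and> network_length N' = network_length N"
  using assms(2)
proof (induction rule: rtranclp_induct)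
  case (step y z)
  then show ?case using removes_degree_two_invariants[of y z] by simp
qed (use assms(1) in auto)

text \<open>Each removal loses one of the finitely many vertex orbits.\<close>

theorem removals_terminate:
  fixes N :: "('v, 'n::{finite,wellorder}) network"
  assumes "periodic_network N"
  shows "\<exists>N'. removes_degree_two\<^sup>*\<^sup>* N N' \<and> (\<nexists>N''. removes_degree_two N' N'')"
  using assms
proof (induction "card (quotient_verts N)" arbitrary: N rule: less_induct)
  case less
  show ?case
  proof (cases "\<exists>N''. removes_degree_two N N''")
    case False
    then show ?thesis by blast
  next
    case True
    then obtain v a b where r: "v \<in> verts N" "neighbours N v = {a, b}" "pos N v \<in> open_segment (pos N a) (pos N b)"
      "a \<notin> vertex_orbit N v" "b \<notin> vertex_orbit N v"
      unfolding removes_degree_two_def by blast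
    interpret removal N v a b by unfold_locales (use less.prems r in auto)
    obtain N' where "removes_degree_two\<^sup>*\<^sup>* M N'" "\<nexists>N''. removes_degree_two N' N''"
      using less.hyps[OF card_quotient_verts_M periodic_M] by blast
    then show ?thesis using removes_M by (meson converse_rtranclp_into_rtranclp)
  qed
qed

subsection \<open>Networks of minimal length\<close>

context net_min
begin

text \<open>The half-edge \<open>(c, True)\<close> leaves \<open>s c\<close>, and \<open>(c, False)\<close> leaves \<open>t c\<close>.\<close>

abbreviation "HE \<equiv> E \<times> (UNIV :: bool set)"

definition src :: "'v set set \<times> bool \<Rightarrow> 'v" where
  "src \<eta> = (if snd \<eta> then s (fst \<eta>) else t (fst \<eta>))"

definition tgt :: "'v set set \<times> bool \<Rightarrow> 'v" where
  "tgt \<eta> = (if snd \<eta> then t (fst \<eta>) else s (fst \<eta>))"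

definition shift :: "'v set set \<times> bool \<Rightarrow> real ^ 3" where
  "shift \<eta> = (if snd \<eta> then h (fst \<eta>) else - h (fst \<eta>))"

definition out :: "'v set set \<times> bool \<Rightarrow> real ^ 3" where
  "out \<eta> = (if snd \<eta> then v (fst \<eta>) else - v (fst \<eta>))"

definition rev :: "'v set set \<times> bool \<Rightarrow> 'v set set \<times> bool" where
  "rev \<eta> = (fst \<eta>, \<not> snd \<eta>)"

definition nb :: "'v set set \<times> bool \<Rightarrow> 'v" where
  "nb \<eta> = act N (shift \<eta>) (tgt \<eta>)"

definition H :: "'v \<Rightarrow> ('v set set \<times> bool) set" where
  "H u = {\<eta> \<in> HE. src \<eta> = u}"

lemma rev_simps [simp]: "src (rev \<eta>) = tgt \<eta>" "tgt (rev \<eta>) = src \<eta>" "shift (rev \<eta>) = - shift \<eta>"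
  "out (rev \<eta>) = - out \<eta>" "rev (rev \<eta>) = \<eta>" "\<eta> \<in> HE \<Longrightarrow> rev \<eta> \<in> HE" "rev \<eta> \<noteq> \<eta>"
  by (cases \<eta>; simp add: rev_def src_def tgt_def shift_def out_def)+

lemma half_edge [simp]:
  assumes "\<eta> \<in> HE"
  shows "src \<eta> \<in> R" "tgt \<eta> \<in> R" "shift \<eta> \<in> \<Lambda>" "src \<eta> \<in> V" "tgt \<eta> \<in> V"
  using assms s_R t_R h_lattice by (auto simp: src_def tgt_def shift_def)

lemma nb_edge:
  assumes "\<eta> \<in> HE"
  shows "{src \<eta>, nb \<eta>} \<in> edges N" "{src \<eta>, nb \<eta>} \<in> fst \<eta>"
proof -
  obtain c d where cd: "\<eta> = (c, d)" "c \<in> E" using assms by auto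
  show "{src \<eta>, nb \<eta>} \<in> fst \<eta>"
  proof (cases d)
    case True
    then show ?thesis using end_edge[OF cd(2)] by (simp add: cd nb_def src_def tgt_def shift_def)
  next
    case False
    have "{src \<eta>, nb \<eta>} = act N (- h c) ` {s c, act N (h c) (t c)}"
      using False cd(2) by (simp add: cd(1) nb_def src_def tgt_def shift_def h_lattice insert_commute)
    then have "{src \<eta>, nb \<eta>} \<in> edge_orbit N {s c, act N (h c) (t c)}"
      unfolding mem_edge_orbit using h_lattice[OF cd(2)] by (metis lattice_uminus)
    then show ?thesis using quotient_edge_orbit[OF cd(2)] by (simp add: cd(1))
  qed
  then show "{src \<eta>, nb \<eta>} \<in> edges N" using quotient_edge_eq[of c] cd by simp
qed

text \<open>Edges have positive length, so a sharp calibration rules out \<open>v c = 0\<close>: a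
  minimal network has neither bridges nor further chords.\<close>

lemma v_nonzero: "c \<in> E \<Longrightarrow> v c \<noteq> 0"
  using edge_vec_frame[of c] edge_vec_nonzero[of c] by (auto simp: frame_def)

lemma frame_uminus: "frame p q r (- x) = - frame p q r x"
  using frame_diff[of p q r 0 x] by (simp add: frame_def)

lemma pos_nb:
  assumes "\<eta> \<in> HE"
  shows "pos N (nb \<eta>) - pos N (src \<eta>) = norm (edge_vec (fst \<eta>)) *\<^sub>R frame p q r (out \<eta>)"
proof -
  obtain c d where cd: "\<eta> = (c, d)" "c \<in> E" using assms by auto
  have "pos N (nb \<eta>) - pos N (src \<eta>) = (if d then edge_vec c else - edge_vec c)"
    using cd(2) by (simp add: cd(1) nb_def src_def tgt_def shift_def edge_vec_def h_lattice)
  then show ?thesis using edge_vec_frame[OF cd(2)] by (simp add: cd(1) out_def frame_uminus)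
qed

lemma norm_edge_vec_pos: "\<eta> \<in> HE \<Longrightarrow> norm (edge_vec (fst \<eta>)) > 0"
  using edge_vec_nonzero by auto

lemma out_A3: "\<eta> \<in> HE \<Longrightarrow> out \<eta> \<in> A3" "\<eta> \<in> HE \<Longrightarrow> out \<eta> \<noteq> 0"
proof -
  assume e: "\<eta> \<in> HE"
  then have v: "v (fst \<eta>) \<in> A3" by (auto intro: v_A3)
  then have "- v (fst \<eta>) \<in> A3" by (force simp: A3_def)
  then show "out \<eta> \<in> A3" using v by (simp add: out_def)
  show "out \<eta> \<noteq> 0" using v_nonzero e by (auto simp: out_def)
qed

lemma nb_surj:
  assumes "u \<in> R" "{u, w} \<in> edges N"
  obtains \<eta> where "\<eta> \<in> H u" "nb \<eta> = w"
proof -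
  obtain c g where c: "c \<in> E" "g \<in> \<Lambda>"
    "(u = act N g (s c) \<and> w = act N (g + h c) (t c)) \<or> (w = act N g (s c) \<and> u = act N (g + h c) (t c))"
    using edge_form[OF assms(2)] by metis
  have u: "u = act N 0 u" using assms(1) R_V by auto
  from c(3) show thesis
  proof
    assume 1: "u = act N g (s c) \<and> w = act N (g + h c) (t c)"
    then have "act N 0 u = act N g (s c)" using u by simp
    then have "u = s c" "0 = g" using rep_unique[of u "s c" 0 g] assms(1) s_R c by auto
    then show thesis using that[of "(c, True)"] c(1) 1 by (simp add: H_def src_def nb_def tgt_def shift_def)
  next
    assume 1: "w = act N g (s c) \<and> u = act N (g + h c) (t c)"
    then have "act N 0 u = act N (g + h c) (t c)" using u by simp
    then have "u = t c" "0 = g + h c" using rep_unique[of u "t c" 0 "g + h c"] assms(1) t_R c h_lattice by auto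
    then have "g = - h c" by (simp add: eq_neg_iff_add_eq_0)
    then show thesis using that[of "(c, False)"] c(1) 1 \<open>u = t c\<close> by (simp add: H_def src_def nb_def tgt_def shift_def)
  qed
qed

lemma finite_HE: "finite HE"
  using finite_edges by simp

lemma finite_H [simp]: "finite (H u)"
  using finite_HE by (simp add: H_def)

text \<open>Kirchhoff's law: \<open>flow\<close> applied to the indicator of \<open>u\<close>. A
  loop enters with both of its half-edges and cancels.\<close>

lemma sum_out: "(\<Sum>\<eta>\<in>H u. out \<eta>) = 0"
proof -
  have "(\<Sum>\<eta>\<in>H u. out \<eta>) $ i = 0" for i
  proof -
    let ?p = "\<lambda>x. if x = u then axis 1 1 else (0 :: real ^ 3)"
    have "0 = (\<Sum>c\<in>E. v c $ i *\<^sub>R (?p (t c) - ?p (s c))) $ 1"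
      by (simp only: flow[of i ?p] zero_index)
    also have "\<dots> = (\<Sum>c\<in>E. v c $ i * (of_bool (t c = u) - of_bool (s c = u)))"
      unfolding sum_component by (intro sum.cong refl) (simp add: axis_def)
    also have "\<dots> = - (\<Sum>c\<in>E. \<Sum>d\<in>UNIV. if src (c, d) = u then out (c, d) $ i else 0)"
      unfolding sum_negf[symmetric] by (intro sum.cong refl) (auto simp: UNIV_bool src_def out_def)
    also have "\<dots> = - (\<Sum>\<eta>\<in>HE. if src \<eta> = u then out \<eta> $ i else 0)"
      unfolding sum.cartesian_product by (intro arg_cong[where f = uminus] sum.cong refl) auto
    also have "\<dots> = - (\<Sum>\<eta>\<in>H u. out \<eta> $ i)"
      unfolding H_def using finite_HE by (simp add: sum.inter_filter)
    finally show ?thesis by (simp add: sum_component)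
  qed
  then show ?thesis by (simp add: vec_eq_iff)
qed

lemma card_HE: "(\<Sum>u\<in>R. card (H u)) = 2 * card E"
proof -
  have "card (\<Union>u\<in>R. H u) = (\<Sum>u\<in>R. card (H u))"
  proof (rule card_UN_disjoint[OF finite_R])
    show "\<forall>u\<in>R. finite (H u)" by simp
    show "\<forall>u\<in>R. \<forall>w\<in>R. u \<noteq> w \<longrightarrow> H u \<inter> H w = {}" by (auto simp: H_def)
  qed
  moreover have "(\<Union>u\<in>R. H u) = HE" using half_edge(1) by (auto simp: H_def)
  ultimately show ?thesis by (simp add: card_cartesian_product)
qed

lemma card_E_eq: "card E = card R + 2"
  using card_E v_nonzero by blast

lemma neighbours_eq: "u \<in> R \<Longrightarrow> neighbours N u = nb ` H u"
proof (intro equalityI subsetI)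
  fix w assume "u \<in> R" "w \<in> neighbours N u"
  then show "w \<in> nb ` H u" using nb_surj[of u w] by (auto simp: neighbours_def)
next
  fix w assume "w \<in> nb ` H u"
  then show "w \<in> neighbours N u" using nb_edge(1) by (auto simp: neighbours_def H_def)
qed

text \<open>Connectedness of the quotient graph, expressed by half-edges.\<close>

lemma closed_set_of_reps:
  assumes "Q \<subseteq> R" "u \<in> Q" and closed: "\<And>w \<eta>. w \<in> Q \<Longrightarrow> \<eta> \<in> H w \<Longrightarrow> tgt \<eta> \<in> Q"
  shows "Q = R"
proof (rule ccontr)
  assume "Q \<noteq> R"
  then obtain w where w: "w \<in> R" "w \<notin> Q" using assms(1) by blast
  let ?P = "\<lambda>x. \<exists>a\<in>Q. x \<in> vertex_orbit N a"
  have V: "u \<in> V" "w \<in> V" using assms w R_V by auto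
  have 1: "?P u" using assms(2) vertex_orbit_self[OF V(1)] by blast
  have 2: "\<not> ?P w" using distinct w assms(1) by blast
  obtain x y where xy: "{x, y} \<in> edges N" "?P x" "\<not> ?P y"
    by (rule boundary_edge[of u w ?P, OF V 1 2], rule that)
  then obtain a g where a: "a \<in> Q" "g \<in> \<Lambda>" "x = act N g a" by (auto simp: mem_vertex_orbit)
  have aR: "a \<in> R" "a \<in> V" using a assms(1) R_V by auto
  have y: "y \<in> V" using edge_verts[OF xy(1)] by simp
  have "{a, act N (- g) y} \<in> edges N"
    using act_edge[OF lattice_uminus[OF a(2)] xy(1)] a aR by simp
  then obtain \<eta> where \<eta>: "\<eta> \<in> H a" "nb \<eta> = act N (- g) y" using nb_surj aR(1) by blast
  then have "\<eta> \<in> HE" by (simp add: H_def)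
  then have "nb \<eta> \<in> vertex_orbit N (tgt \<eta>)" using half_edge[of \<eta>] unfolding nb_def mem_vertex_orbit by blast
  then have "y \<in> vertex_orbit N (tgt \<eta>)"
    using act_vertex_orbit[of "- g" "tgt \<eta>" y] \<eta>(2) a(2) y half_edge[OF \<open>\<eta> \<in> HE\<close>] by simp
  then show False using xy(3) closed[OF a(1) \<eta>(1)] by blast
qed

lemma H_nonempty:
  assumes "u \<in> R"
  shows "H u \<noteq> {}"
proof
  assume e: "H u = {}"
  have "{u} = R" by (rule closed_set_of_reps[of _ u]) (use assms e in auto)
  then have "(\<Sum>u\<in>R. card (H u)) = 0" using e by auto
  then show False using card_HE card_E_eq by simp
qed

lemma class_nonempty:
  assumes "i < 4" "j < 4" "i \<noteq> j"
  obtains c where "c \<in> E" "v c = eps i - eps j \<or> v c = eps j - eps i"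
proof -
  have "{c. c \<in> E \<and> (v c = eps i - eps j \<or> v c = eps j - eps i)} \<noteq> {}"
    using mass[OF assms] kappa_pos by (metis less_irrefl sum.empty)
  then show thesis using that by blast
qed

end

locale net_min_reduced = net_min N R s t h v p q r \<kappa>
  for N :: "('v, 3) network" and R s t h v p q r \<kappa> +
  assumes irreducible: "\<nexists>M. removes_degree_two N M"
begin

text \<open>A single nonzero root does not sum to 0, and two roots have to be opposite, which makes
  the vertex removable once loops are excluded.\<close>

lemma card_H_ge:
  assumes u: "u \<in> R"
  shows "card (H u) \<ge> 3"
proof (rule ccontr)
  assume "\<not> ?thesis"
  moreover have "card (H u) \<noteq> 0" using H_nonempty[OF u] by simp
  ultimately consider "card (H u) = 1" | "card (H u) = 2" by linarith
  then show False
  proof cases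
    case 1
    then obtain \<eta> where \<eta>: "H u = {\<eta>}" by (auto simp: card_1_singleton_iff)
    then have "out \<eta> = 0" using sum_out[of u] by simp
    moreover have "\<eta> \<in> HE" using \<eta> by (auto simp: H_def)
    ultimately show False using out_A3(2) by blast
  next
    case 2
    then obtain \<eta> \<theta> where \<eta>: "H u = {\<eta>, \<theta>}" "\<eta> \<noteq> \<theta>" by (auto simp: card_2_iff)
    then have e: "\<eta> \<in> HE" "\<theta> \<in> HE" "src \<eta> = u" "src \<theta> = u" by (auto simp: H_def)
    have o: "out \<theta> = - out \<eta>" using sum_out[of u] \<eta> by (simp add: add_eq_0_iff)
    \<comment> \<open>Both half-edges would belong to the loop, so \<open>u\<close> would be the
      only representative and \<open>card E = 1\<close>, against
      \<open>card E = card R + 2\<close>.\<close>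
    have loop: "tgt \<zeta> \<noteq> u" if z: "\<zeta> \<in> H u" for \<zeta>
    proof
      assume t: "tgt \<zeta> = u"
      have z': "\<zeta> \<in> HE" using z by (simp add: H_def)
      have "rev \<zeta> \<in> H u" using t z' by (simp add: H_def del: mem_Sigma_iff)
      then have "\<zeta> = \<eta> \<or> \<zeta> = \<theta>" "rev \<zeta> = \<eta> \<or> rev \<zeta> = \<theta>" using \<eta>(1) z by blast+
      then have "(\<zeta> = \<eta> \<and> rev \<zeta> = \<theta>) \<or> (\<zeta> = \<theta> \<and> rev \<zeta> = \<eta>)" using rev_simps(7)[of \<zeta>] by metis
      then have "H u = {\<zeta>, rev \<zeta>}" 
        using \<eta>(1) by (elim disjE conjE) (simp_all add: insert_commute)
      moreover have "src \<zeta> = u" using z by (simp add: H_def)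
      ultimately have "tgt \<xi> = u" if "\<xi> \<in> H u" for \<xi> using that t by auto
      then have "{u} = R" using closed_set_of_reps[of "{u}" u] u by auto
      then have "R = {u}" by simp
      then have "card (H u) = 2 * card E" "card R = 1" using card_HE by simp_all
      then show False using 2 card_E_eq by simp
    qed
    have no: "nb \<zeta> \<notin> vertex_orbit N u" if z: "\<zeta> \<in> H u" for \<zeta>
    proof
      have z': "\<zeta> \<in> HE" using z by (simp add: H_def)
      assume "nb \<zeta> \<in> vertex_orbit N u"
      then have "tgt \<zeta> \<in> vertex_orbit N u"
        using act_vertex_orbit[of "shift \<zeta>" u "tgt \<zeta>"] half_edge[OF z'] u R_V by (auto simp: nb_def)
      then show False using distinct[OF u half_edge(2)[OF z']] loop[OF z] by simp
    qed
    define m n where "m = norm (edge_vec (fst \<eta>))" and "n = norm (edge_vec (fst \<theta>))"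
    let ?f = "frame p q r (out \<eta>)"
    have mn: "m > 0" "n > 0" using e norm_edge_vec_pos unfolding m_def n_def by auto
    have f: "?f \<noteq> 0" using frame_inj[OF ortho] out_A3(2)[OF e(1)] by blast
    have P: "pos N (nb \<eta>) = pos N u + m *\<^sub>R ?f" "pos N (nb \<theta>) = pos N u - n *\<^sub>R ?f"
      using pos_nb[OF e(1)] pos_nb[OF e(2)] e unfolding m_def n_def by (simp_all add: o frame_uminus algebra_simps)
    have "pos N u \<in> open_segment (pos N (nb \<eta>)) (pos N (nb \<theta>))"
      unfolding in_segment
    \<comment> \<open>Opposite directions with lengths \<open>m\<close> and \<open>n\<close> place
      \<open>u\<close> at this ratio on the segment.\<close>
    proof (intro conjI exI[of _ "m / (m + n)"])
      have "m + n \<noteq> 0" using mn by linarith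
      then have "(m + n) *\<^sub>R ?f \<noteq> 0" using f by simp
      then show "pos N (nb \<eta>) \<noteq> pos N (nb \<theta>)" unfolding P by (auto simp: algebra_simps)
      show "0 < m / (m + n)" "m / (m + n) < 1" using mn by auto
      have eq: "1 - m / (m + n) = n / (m + n)" using mn by (simp add: field_simps)
      have "(1 - m / (m + n)) *\<^sub>R pos N (nb \<eta>) + (m / (m + n)) *\<^sub>R pos N (nb \<theta>)
        = (n / (m + n) + m / (m + n)) *\<^sub>R pos N u + (n / (m + n) * m - m / (m + n) * n) *\<^sub>R ?f"
        unfolding P eq by (simp add: scaleR_add_right scaleR_diff_right scaleR_add_left scaleR_diff_left)
      also have "\<dots> = pos N u" using mn by (simp add: add_divide_distrib[symmetric] add.commute)
      finally show "pos N u = (1 - m / (m + n)) *\<^sub>R pos N (nb \<eta>) + (m / (m + n)) *\<^sub>R pos N (nb \<theta>)" by simp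
    qed
    moreover have "neighbours N u = {nb \<eta>, nb \<theta>}" using neighbours_eq[OF u] \<eta> by simp
    moreover have "u \<in> V" using u R_V by auto
    ultimately have "\<exists>M. removes_degree_two N M"
      unfolding removes_degree_two_def using no \<eta> by blast
    then show False using irreducible by simp
  qed
qed

section \<open>Four vertices and six edges\<close>

definition pairs :: "(nat \<times> nat) set" where
  "pairs = {(0,1), (0,2), (0,3), (1,2), (1,3), (2,3)}"

definition class_edge :: "nat \<times> nat \<Rightarrow> 'v set set" where
  "class_edge x = (SOME c. c \<in> E \<and> (v c = eps (fst x) - eps (snd x) \<or> v c = eps (snd x) - eps (fst x)))"

lemma pairs_less: "x \<in> pairs \<Longrightarrow> fst x < 4 \<and> snd x < 4 \<and> fst x < snd x"
  by (auto simp: pairs_def)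

lemma class_edge:
  assumes "x \<in> pairs"
  shows "class_edge x \<in> E" "v (class_edge x) = eps (fst x) - eps (snd x) \<or> v (class_edge x) = eps (snd x) - eps (fst x)"
proof -
  have "\<exists>c. c \<in> E \<and> (v c = eps (fst x) - eps (snd x) \<or> v c = eps (snd x) - eps (fst x))"
    using class_nonempty[of "fst x" "snd x"] pairs_less[OF assms] by (metis less_irrefl)
  from someI_ex[OF this] show "class_edge x \<in> E"
    "v (class_edge x) = eps (fst x) - eps (snd x) \<or> v (class_edge x) = eps (snd x) - eps (fst x)"
    by (simp_all only: class_edge_def)
qed

lemma class_edge_inj: "inj_on class_edge pairs"
proof (rule inj_onI)
  fix x y assume xy: "x \<in> pairs" "y \<in> pairs" "class_edge x = class_edge y"
  have ne: "fst x \<noteq> snd x" "fst y \<noteq> snd y" using pairs_less xy by (metis less_irrefl)+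
  have "eps (fst x) - eps (snd x) = eps (fst y) - eps (snd y) \<or> eps (fst x) - eps (snd x) = eps (snd y) - eps (fst y)
    \<or> eps (snd x) - eps (fst x) = eps (fst y) - eps (snd y) \<or> eps (snd x) - eps (fst x) = eps (snd y) - eps (fst y)"
    using class_edge(2)[OF xy(1)] class_edge(2)[OF xy(2)] xy(3) by metis
  then have "fst x = fst y \<and> snd x = snd y \<or> fst x = snd y \<and> snd x = fst y"
    using eps_diff_eq_iff pairs_less[OF xy(1)] pairs_less[OF xy(2)] ne by metis
  then show "x = y" using pairs_less[OF xy(1)] pairs_less[OF xy(2)] by (auto simp: prod_eq_iff)
qed

lemma card_pairs: "card pairs = 6"
  by (simp add: pairs_def)

text \<open>Degrees at least 3 give \<open>3 * card R \<le> 2 * card E\<close>, so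
  \<open>card E = card R + 2\<close> allows at most six edges, while the six nonempty classes of
  roots supply at least six. Hence all these inequalities are equalities.\<close>

lemma counts: "card R = 4" "card E = 6" "\<And>u. u \<in> R \<Longrightarrow> card (H u) = 3" "class_edge ` pairs = E"
proof -
  have sub: "class_edge ` pairs \<subseteq> E" using class_edge(1) by auto
  have "card (class_edge ` pairs) = 6" using card_image[OF class_edge_inj] card_pairs by simp
  then have ge: "card E \<ge> 6" using card_mono[OF finite_edges sub] by simp
  have "(\<Sum>u\<in>R. 3) \<le> (\<Sum>u\<in>R. card (H u))" by (intro sum_mono card_H_ge)
  then have "3 * card R \<le> 2 * card E" using card_HE by simp
  then show R: "card R = 4" and E: "card E = 6" using ge card_E_eq by linarith+
  show "class_edge ` pairs = E"
    by (rule card_subset_eq[OF finite_edges sub]) (simp add: E \<open>card (class_edge ` pairs) = 6\<close>)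
  have s: "(\<Sum>u\<in>R. card (H u)) = (\<Sum>u\<in>R. 3)" using card_HE R E by simp
  show "card (H u) = 3" if "u \<in> R" for u
  proof (rule ccontr)
    assume "card (H u) \<noteq> 3"
    then have "(\<Sum>u\<in>R. 3) < (\<Sum>u\<in>R. card (H u))"
      using card_H_ge that finite_R by (intro sum_strict_mono_ex1) (auto simp: order_less_le intro!: bexI[of _ u])
    then show False using s by simp
  qed
qed

lemma class_unique:
  assumes "c \<in> E" "c' \<in> E" "v c = v c' \<or> v c = - v c'"
  shows "c = c'"
proof -
  obtain x y where xy: "x \<in> pairs" "y \<in> pairs" "c = class_edge x" "c' = class_edge y"
    using assms counts(4) by (metis imageE)
  have ne: "fst x \<noteq> snd x" using pairs_less xy by (metis less_irrefl)
  have "eps (fst x) - eps (snd x) = eps (fst y) - eps (snd y) \<or> eps (fst x) - eps (snd x) = eps (snd y) - eps (fst y)"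
    using class_edge(2)[OF xy(1)] class_edge(2)[OF xy(2)] assms(3) xy(3,4) by (metis minus_diff_eq minus_minus)
  then have "fst x = fst y \<and> snd x = snd y \<or> fst x = snd y \<and> snd x = fst y"
    using eps_diff_eq_iff pairs_less[OF xy(1)] pairs_less[OF xy(2)] ne by metis
  then have "x = y" using pairs_less[OF xy(1)] pairs_less[OF xy(2)] by (auto simp: prod_eq_iff)
  then show ?thesis using xy by simp
qed

text \<open>Each class consists of a single edge, whose length is therefore the common mass.\<close>

lemma norm_edge_vec_kappa:
  assumes "c \<in> E"
  shows "norm (edge_vec c) = \<kappa>"
proof -
  obtain x where x: "x \<in> pairs" "c = class_edge x" using assms counts(4) by (metis imageE)
  have "{c'. c' \<in> E \<and> (v c' = eps (fst x) - eps (snd x) \<or> v c' = eps (snd x) - eps (fst x))} = {c}"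
    using class_edge[OF x(1)] class_unique x(2) by (auto simp: assms) (metis minus_diff_eq)+
  then show ?thesis using mass[of "fst x" "snd x"] pairs_less[OF x(1)] by simp
qed

text \<open>The choice is unambiguous by \<open>out_unique\<close> below.\<close>

definition he :: "nat \<Rightarrow> nat \<Rightarrow> 'v set set \<times> bool" where
  "he i j = (SOME \<eta>. \<eta> \<in> HE \<and> out \<eta> = eps i - eps j)"

lemma he:
  assumes "i < 4" "j < 4" "i \<noteq> j"
  shows "he i j \<in> HE" "out (he i j) = eps i - eps j"
proof -
  obtain c where c: "c \<in> E" "v c = eps i - eps j \<or> v c = eps j - eps i" by (rule class_nonempty[OF assms])
  have "\<exists>\<eta>. \<eta> \<in> HE \<and> out \<eta> = eps i - eps j"
    using c(2)
  proof
    assume "v c = eps i - eps j"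
    then show ?thesis using c(1) by (intro exI[of _ "(c, True)"]) (simp add: out_def)
  next
    assume "v c = eps j - eps i"
    then show ?thesis using c(1) by (intro exI[of _ "(c, False)"]) (simp add: out_def)
  qed
  from someI_ex[OF this] show "he i j \<in> HE" "out (he i j) = eps i - eps j" by (simp_all only: he_def)
qed

lemma out_unique:
  assumes "\<eta> \<in> HE" "\<theta> \<in> HE" "out \<eta> = out \<theta>"
  shows "\<eta> = \<theta>"
proof -
  obtain c d c' d' where c: "\<eta> = (c, d)" "\<theta> = (c', d')" "c \<in> E" "c' \<in> E" using assms by auto
  have "v c = v c' \<or> v c = - v c'"
    using assms(3) unfolding c out_def by (cases d; cases d') (auto simp: minus_equation_iff)
  then have "c = c'" using class_unique c by blast
  moreover have "d = d'"
  proof (rule ccontr)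
    assume "d \<noteq> d'"
    then have "v c = - v c" using assms(3) \<open>c = c'\<close> by (auto simp: c out_def split: if_splits)
    then have "v c = 0" by (simp add: eq_neg_iff_add_eq_0 flip: scaleR_2)
    then show False using v_nonzero c by blast
  qed
  ultimately show ?thesis using c by simp
qed

lemma he_cases:
  assumes "\<eta> \<in> HE"
  obtains i j where "i < 4" "j < 4" "i \<noteq> j" "\<eta> = he i j"
proof -
  obtain i j where ij: "i < 4" "j < 4" "out \<eta> = eps i - eps j" using out_A3(1)[OF assms] by (auto simp: A3_def)
  then have "i \<noteq> j" using out_A3(2)[OF assms] by auto
  moreover have "\<eta> = he i j" using out_unique[OF assms he(1)] he(2) ij \<open>i \<noteq> j\<close> by simp
  ultimately show thesis using that ij by blast
qed

lemma he_eq_iff: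
  assumes "i < 4" "j < 4" "i \<noteq> j" "k < 4" "l < 4" "k \<noteq> l"
  shows "he i j = he k l \<longleftrightarrow> i = k \<and> j = l"
  using he(2)[OF assms(1-3)] he(2)[OF assms(4-6)] eps_diff_eq_iff[OF assms(1,2,4,5,3)] by metis

lemma rev_he:
  assumes "i < 4" "j < 4" "i \<noteq> j"
  shows "rev (he i j) = he j i"
  using out_unique[of "rev (he i j)" "he j i"] he[OF assms] he[of j i] assms by (simp del: mem_Sigma_iff)

lemma tgt_he:
  assumes "i < 4" "j < 4" "i \<noteq> j"
  shows "tgt (he i j) = src (he j i)"
  using rev_he[OF assms] rev_simps(1)[of "he i j"] by simp

text \<open>The degree is 3 and the roots leaving a vertex have sum 0, so
  \<open>A3_zero_sum_triple\<close> applies; injectivity of \<open>out\<close> carries its result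
  back to half-edges.\<close>

lemma triangle:
  assumes "i < 4" "j < 4" "i \<noteq> j"
  obtains k where "k < 4" "k \<noteq> i" "k \<noteq> j" "H (src (he i j)) = {he i j, he j k, he k i}"
proof -
  let ?u = "src (he i j)"
  have hij: "he i j \<in> H ?u" using he(1)[OF assms] by (simp add: H_def)
  have "card (H ?u) = 3" by (rule counts(3)[OF half_edge(1)[OF he(1)[OF assms]]])
  then have "card (H ?u - {he i j}) = 2" using hij by simp
  then obtain \<eta> \<theta> where \<eta>: "H ?u - {he i j} = {\<eta>, \<theta>}" "\<eta> \<noteq> \<theta>" by (auto simp: card_2_iff)
  have "H ?u = insert (he i j) (H ?u - {he i j})" "he i j \<notin> H ?u - {he i j}" using hij by blast+
  then have Hu: "H ?u = {he i j, \<eta>, \<theta>}" "he i j \<notin> {\<eta>, \<theta>}" unfolding \<eta>(1) .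
  then have e: "\<eta> \<in> HE" "\<theta> \<in> HE" by (auto simp: H_def)
  have "out (he i j) + (out \<eta> + out \<theta>) = 0" using sum_out[of ?u] Hu \<eta>(2) by simp
  then have z: "eps i - eps j + out \<eta> + out \<theta> = 0" using he(2)[OF assms] by (simp add: add.assoc)
  obtain k where k: "k < 4" "k \<noteq> i" "k \<noteq> j" "{out \<eta>, out \<theta>} = {eps j - eps k, eps k - eps i}"
    by (rule A3_zero_sum_triple[OF assms out_A3(1)[OF e(1)] out_A3(1)[OF e(2)] out_A3(2)[OF e(1)] out_A3(2)[OF e(2)] z])
  have "out (he j k) = eps j - eps k" "out (he k i) = eps k - eps i" using he(2) assms k by auto
  then have "{out \<eta>, out \<theta>} = {out (he j k), out (he k i)}" using k(4) by simp
  moreover have "he j k \<in> HE" "he k i \<in> HE" using he(1) assms k by auto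
  ultimately have "{\<eta>, \<theta>} = {he j k, he k i}" using out_unique e by (metis doubleton_eq_iff)
  then have "H ?u = {he i j, he j k, he k i}" using Hu(1) by simp
  then show thesis using that k by blast
qed

lemma H_src: "\<eta> \<in> H u \<Longrightarrow> src \<eta> = u"
  by (simp add: H_def)

text \<open>The two triangles through an edge are traversed in opposite directions, and they are
  different, since otherwise two vertices would form a component.\<close>

lemma tetrahedron:
  obtains k l where "{k, l} = {2, 3 :: nat}"
    "H (src (he 0 1)) = {he 0 1, he 1 k, he k 0}" "H (src (he 1 0)) = {he 1 0, he 0 l, he l 1}"
    "H (src (he 0 k)) = {he 0 k, he k l, he l 0}" "H (src (he k 1)) = {he k 1, he 1 l, he l k}"
proof -
  obtain k where k: "k < 4" "k \<noteq> 0" "k \<noteq> 1" "H (src (he 0 1)) = {he 0 1, he 1 k, he k 0}"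
    by (rule triangle[of 0 1]) auto
  \<comment> \<open>\<open>k\<close> is 2 or 3, and \<open>l\<close> is the other one.\<close>
  define l where "l = 5 - k"
  have kl: "{k, l} = {2, 3}" "l < 4" "l \<noteq> 0" "l \<noteq> 1" "l \<noteq> k" using k(1-3) by (auto simp: l_def less_4_cases)
  have four: "m = 0 \<or> m = 1 \<or> m = k \<or> m = l" if "m < 4" for m using that kl(1) by (auto simp: less_4_cases doubleton_eq_iff)
  have SA: "src (he 1 k) = src (he 0 1)" "src (he k 0) = src (he 0 1)" using k(4) H_src by blast+
  obtain m where m: "m < 4" "m \<noteq> 1" "m \<noteq> 0" "H (src (he 1 0)) = {he 1 0, he 0 m, he m 1}"
    by (rule triangle[of 1 0]) auto
  have "m \<noteq> k"
  proof
    assume mk: "m = k"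
    have SB: "src (he 0 k) = src (he 1 0)" "src (he k 1) = src (he 1 0)" using m(4) H_src mk by blast+
    let ?Q = "{src (he 0 1), src (he 1 0)}"
    have "?Q = R"
    proof (rule closed_set_of_reps[of _ "src (he 0 1)"])
      show "?Q \<subseteq> R" using half_edge(1) he(1)[of 0 1] he(1)[of 1 0] by simp
      fix w \<eta> assume "w \<in> ?Q" "\<eta> \<in> H w"
      then have "\<eta> \<in> {he 0 1, he 1 k, he k 0, he 1 0, he 0 k, he k 1}" using k(4) m(4) mk by auto
      then show "tgt \<eta> \<in> ?Q" using tgt_he k SA SB by auto
    qed simp
    moreover have "card ?Q \<le> 2" by (simp add: card_insert_if)
    ultimately have "card R \<le> 2" by simp
    then show False using counts(1) by simp
  qed
  then have m_l: "m = l" using four m by blast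
  have HB: "H (src (he 1 0)) = {he 1 0, he 0 l, he l 1}" using m(4) m_l by simp
  \<comment> \<open>These two half-edges start at neither of the vertices found so far at which they
    could complete a triangle; this fixes the last index of the triangles \<open>HC\<close> and
    \<open>HD\<close>.\<close>
  have notB: "he 0 k \<notin> H (src (he 1 0))" "he k 1 \<notin> H (src (he 1 0))"
    unfolding HB using he_eq_iff k kl by auto
  obtain m where m: "m < 4" "m \<noteq> 0" "m \<noteq> k" "H (src (he 0 k)) = {he 0 k, he k m, he m 0}"
    by (rule triangle[of 0 k]) (use k in auto)
  have "m \<noteq> 1"
  proof
    assume "m = 1"
    then have "src (he 1 0) = src (he 0 k)" using m(4) H_src by blast
    then show False using notB(1) m(4) by simp
  qed
  then have HC: "H (src (he 0 k)) = {he 0 k, he k l, he l 0}" using m four by blast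
  obtain m where m: "m < 4" "m \<noteq> k" "m \<noteq> 1" "H (src (he k 1)) = {he k 1, he 1 m, he m k}"
    by (rule triangle[of k 1]) (use k in auto)
  have "m \<noteq> 0"
  proof
    assume "m = 0"
    then have "src (he 1 0) = src (he k 1)" using m(4) H_src by blast
    then show False using notB(2) m(4) by simp
  qed
  then have HD: "H (src (he k 1)) = {he k 1, he 1 l, he l k}" using m four by blast
  show thesis by (rule that[OF kl(1) k(4) HB HC HD])
qed

end

subsection \<open>The srs network\<close>

definition srs_g :: "3 \<Rightarrow> real ^ 3" where
  "srs_g i = (if i = 1 then srs_g1 else if i = 2 then srs_g2 else srs_g3)"

lemma srs_g_simps [simp]: "srs_g 1 = srs_g1" "srs_g 2 = srs_g2" "srs_g 3 = srs_g3"
  by (simp_all add: srs_g_def)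

lemma zspan_3:
  fixes g :: "3 \<Rightarrow> real ^ 3"
  shows "zspan g = {of_int a *\<^sub>R g 1 + of_int b *\<^sub>R g 2 + of_int c *\<^sub>R g 3 | a b c. True}"
proof (intro equalityI subsetI)
  fix x assume "x \<in> zspan g"
  then show "x \<in> {of_int a *\<^sub>R g 1 + of_int b *\<^sub>R g 2 + of_int c *\<^sub>R g 3 | a b c. True}"
    by (elim zspanE) (auto simp: sum_3)
next
  fix x assume "x \<in> {of_int a *\<^sub>R g 1 + of_int b *\<^sub>R g 2 + of_int c *\<^sub>R g 3 | a b c. True}"
  then show "x \<in> zspan g" by (auto intro!: zspan_add zspan_int_mult zspan_base)
qed

lemma srs_lattice_zspan: "srs_lattice = zspan srs_g"
  by (simp add: srs_lattice_def zspan_3)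

lemma srs_p_simps: "srs_p 0 = vector [0, 0, 0]" "srs_p 1 = vector [1, 0, 0]"
  "srs_p 2 = vector [- 1 / 2, sqrt 3 / 2, 0]" "srs_p 3 = vector [- 1 / 2, - sqrt 3 / 2, 0]"
  "srs_p (Suc 0) = vector [1, 0, 0]"
  by (simp_all add: srs_p_def eval_nat_numeral)

lemma sqrt_3_divide: "x / sqrt 3 = x * sqrt 3 / 3"
  by (simp add: field_simps)

lemma sqrt_3_mult: "sqrt 3 * sqrt (2 / 3) = sqrt 2" "sqrt 3 * (sqrt (2 / 3) * x) = sqrt 2 * x"
  "sqrt 3 * (sqrt 3 * x) = 3 * x"
proof -
  show "sqrt 3 * sqrt (2 / 3) = sqrt 2" by (simp flip: real_sqrt_mult)
  then show "sqrt 3 * (sqrt (2 / 3) * x) = sqrt 2 * x" by (metis mult.assoc)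
qed simp

lemma det_srs: "\<bar>det (\<chi> i. srs_g i)\<bar> = 8 * sqrt 2"
proof -
  have "det (\<chi> i. srs_g i) = - 8 * (sqrt 3 * sqrt (2 / 3))"
    by (simp add: det_3 srs_g1_def srs_g2_def srs_g3_def sqrt_3_divide algebra_simps)
  then show ?thesis by (simp add: sqrt_3_mult)
qed

lemma srs_basis: "lattice_basis srs_lattice srs_g"
  using det_srs by (auto simp: lattice_basis_iff srs_lattice_zspan)

lemma srs_full: "full_lattice srs_lattice"
  using srs_basis by (auto simp: full_lattice_def)

lemma covolume_srs: "covolume srs_lattice = 8 * sqrt 2"
  using covolume_eq_det[OF srs_basis] det_srs by simp

text \<open>All four base vertices have third coordinate 0, so only this plane section of the
  lattice matters for their congruence.\<close>

lemma srs_lattice_horizontal: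
  assumes "x \<in> srs_lattice" "x $ 3 = 0"
  obtains m n :: int where "x $ 1 = 2 * real_of_int m" "x $ 2 = 2 * sqrt 3 * real_of_int n"
proof -
  obtain a b c :: int where x: "x = of_int a *\<^sub>R srs_g1 + of_int b *\<^sub>R srs_g2 + of_int c *\<^sub>R srs_g3"
    using assms(1) by (auto simp: srs_lattice_def)
  have "sqrt (2 / 3) * (of_int a + of_int b + of_int c) = 0"
    using assms(2) by (simp add: x srs_g1_def srs_g2_def srs_g3_def algebra_simps)
  then have "real_of_int (a + b + c) = 0" by simp
  then have c: "c = - a - b" by linarith
  show thesis
  proof (rule that[of "a - c" b])
    show "x $ 1 = 2 * real_of_int (a - c)" by (simp add: x srs_g1_def srs_g2_def srs_g3_def)
    show "x $ 2 = 2 * sqrt 3 * real_of_int b"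
      by (simp add: x srs_g1_def srs_g2_def srs_g3_def c sqrt_3_divide field_simps)
  qed
qed

lemma srs_p_incongruent:
  assumes "i \<le> 3" "j \<le> 3" "i \<noteq> j"
  shows "srs_p i - srs_p j \<notin> srs_lattice"
proof -
  have *: "srs_p i - srs_p j \<notin> srs_lattice"
    if "i = 0 \<and> j = 1 \<or> i = 0 \<and> j = 2 \<or> i = 0 \<and> j = 3 \<or> i = 1 \<and> j = 2 \<or> i = 1 \<and> j = 3 \<or> i = 2 \<and> j = 3" for i j
  proof
    assume m: "srs_p i - srs_p j \<in> srs_lattice"
    have z: "(srs_p i - srs_p j) $ 3 = 0" using that by (auto simp: srs_p_simps)
    obtain m n :: int where mn: "(srs_p i - srs_p j) $ 1 = 2 * real_of_int m"
      "(srs_p i - srs_p j) $ 2 = 2 * sqrt 3 * real_of_int n"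
      by (rule srs_lattice_horizontal[OF m z])
    \<comment> \<open>Differences of base vertices have first coordinates of absolute value 1, 1/2
      or 3/2, except for the pair 2, 3, which the second coordinate separates.\<close>
    have odd: "2 * real_of_int k \<noteq> 1" "2 * real_of_int k \<noteq> - 1" "4 * real_of_int k \<noteq> 1" "4 * real_of_int k \<noteq> 3" for k :: int
    proof -
      have "2 * k \<noteq> 1" "2 * k \<noteq> - 1" "4 * k \<noteq> 1" "4 * k \<noteq> 3" by presburger+
      then have "real_of_int (2 * k) \<noteq> real_of_int 1" "real_of_int (2 * k) \<noteq> real_of_int (- 1)"
        "real_of_int (4 * k) \<noteq> real_of_int 1" "real_of_int (4 * k) \<noteq> real_of_int 3"
        unfolding of_int_eq_iff by simp_all
      then show "2 * real_of_int k \<noteq> 1" "2 * real_of_int k \<noteq> - 1" "4 * real_of_int k \<noteq> 1" "4 * real_of_int k \<noteq> 3"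
        by simp_all
    qed
    from that show False
    proof (elim disjE conjE)
      assume "i = 2" "j = 3"
      then have "sqrt 3 = sqrt 3 * (2 * real_of_int n)" using mn(2) by (simp add: srs_p_simps)
      then have "2 * real_of_int n = 1" by simp
      then show False using odd by blast
    qed (use mn(1) odd[of m] in \<open>auto simp: srs_p_simps field_simps\<close>)
  qed
  have "i = 0 \<or> i = 1 \<or> i = 2 \<or> i = 3" "j = 0 \<or> j = 1 \<or> j = 2 \<or> j = 3" using assms by auto
  then have "srs_p i - srs_p j \<notin> srs_lattice \<or> srs_p j - srs_p i \<notin> srs_lattice \<and> i \<noteq> j"
    using *[of i j] *[of j i] assms(3) by auto
  then show ?thesis using full_lattice_uminus[OF srs_full, of "srs_p i - srs_p j"] by auto
qed

lemma srs_edge: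
  assumes "{x, y} \<in> srs_base_edges" "g \<in> srs_lattice"
  shows "{x + g, y + g} \<in> edges srs"
proof -
  have "edges srs = {(\<lambda>x. x + g) ` e | g e. g \<in> srs_lattice \<and> e \<in> srs_base_edges}" by (simp add: srs_def)
  then have "(\<lambda>z. z + g) ` {x, y} \<in> edges srs" using assms by blast
  then show ?thesis by simp
qed

lemma srs_gs_lattice: "srs_g1 \<in> srs_lattice" "srs_g2 \<in> srs_lattice" "srs_g3 \<in> srs_lattice"
  using zspan_base[of srs_g 1] zspan_base[of srs_g 2] zspan_base[of srs_g 3] by (simp_all add: srs_lattice_zspan)

text \<open>Every vertex of srs has neighbours in three different orbits, too many for a vertex of
  degree 2.\<close>

lemma srs_irreducible: "\<not> removes_degree_two srs M"
proof
  assume "removes_degree_two srs M"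
  then obtain v a b where v: "v \<in> verts srs" "neighbours srs v = {a, b}"
    unfolding removes_degree_two_def by blast
  obtain i g where i: "i \<le> 3" "g \<in> srs_lattice" "v = srs_p i + g" using v(1) by (auto simp: srs_def)
  note L = full_lattice_add[OF srs_full] full_lattice_diff[OF srs_full] full_lattice_uminus[OF srs_full] srs_gs_lattice i(2)
  have nbI: "y + h \<in> neighbours srs v" if "{x, y} \<in> srs_base_edges" "h \<in> srs_lattice" "v = x + h" for x y h
    using srs_edge[OF that(1,2)] that(3) by (simp add: neighbours_def)
  have B: "{srs_p 0, srs_p 1} \<in> srs_base_edges" "{srs_p 0, srs_p 2} \<in> srs_base_edges" "{srs_p 0, srs_p 3} \<in> srs_base_edges"
    "{srs_p 1, srs_p 2 + srs_g1} \<in> srs_base_edges" "{srs_p 2, srs_p 3 + srs_g2} \<in> srs_base_edges" "{srs_p 3, srs_p 1 + srs_g3} \<in> srs_base_edges"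
    by (auto simp: srs_base_edges_def)
  then have B': "{srs_p 1, srs_p 0} \<in> srs_base_edges" "{srs_p 2, srs_p 0} \<in> srs_base_edges" "{srs_p 3, srs_p 0} \<in> srs_base_edges"
    "{srs_p 2 + srs_g1, srs_p 1} \<in> srs_base_edges" "{srs_p 3 + srs_g2, srs_p 2} \<in> srs_base_edges" "{srs_p 1 + srs_g3, srs_p 3} \<in> srs_base_edges"
    by (simp_all add: insert_commute)
  have ne: "srs_p m + x \<noteq> srs_p n + y" if "m \<le> 3" "n \<le> 3" "m \<noteq> n" "x \<in> srs_lattice" "y \<in> srs_lattice" for m n x y
  proof
    assume "srs_p m + x = srs_p n + y"
    then have "srs_p m - srs_p n = y - x" by (simp add: algebra_simps)
    then show False using srs_p_incongruent[OF that(1-3)] full_lattice_diff[OF srs_full that(5,4)] by simp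
  qed
  have contra: False if jkl: "j \<le> 3" "k \<le> 3" "l \<le> 3" "j \<noteq> k" "k \<noteq> l" "j \<noteq> l"
     "x \<in> srs_lattice" "y \<in> srs_lattice" "z \<in> srs_lattice"
     "srs_p j + x \<in> neighbours srs v" "srs_p k + y \<in> neighbours srs v" "srs_p l + z \<in> neighbours srs v"
    for j k l x y z
    using jkl(10-12) ne[OF jkl(1,2,4,7,8)] ne[OF jkl(2,3,5,8,9)] ne[OF jkl(1,3,6,7,9)] by (auto simp: v(2))
  consider "i = 0" | "i = 1" | "i = 2" | "i = 3" using i(1) by linarith
  then show False
  proof cases
    case 1
    show False
      using nbI[OF B(1), of g] nbI[OF B(2), of g] nbI[OF B(3), of g] L i(3) 1
      by (intro contra[of 1 2 3 g g g]) simp_all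
  next
    case 2
    show False
      using nbI[OF B'(1), of g] nbI[OF B(4), of g] nbI[OF B'(6), of "g - srs_g3"] L i(3) 2
      by (intro contra[of 0 2 3 g "srs_g1 + g" "g - srs_g3"]) (simp_all add: add.assoc)
  next
    case 3
    show False
      using nbI[OF B'(2), of g] nbI[OF B'(4), of "g - srs_g1"] nbI[OF B(5), of g] L i(3) 3
      by (intro contra[of 0 1 3 g "g - srs_g1" "srs_g2 + g"]) (simp_all add: add.assoc)
  next
    case 4
    show False
      using nbI[OF B'(3), of g] nbI[OF B(6), of g] nbI[OF B'(5), of "g - srs_g2"] L i(3) 4
      by (intro contra[of 0 1 2 g "srs_g3 + g" "g - srs_g2"]) (simp_all add: add.assoc)
  qed
qed

lemma srs_removals: "removes_degree_two\<^sup>*\<^sup>* srs M \<Longrightarrow> M = srs"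
  by (induction rule: rtranclp_induct) (auto simp: srs_irreducible)

lemma srs_base_length:
  assumes "e \<in> srs_base_edges" "g \<in> srs_lattice"
  shows "edge_length srs ((\<lambda>x. x + g) ` e) = 1"
proof -
  have len: "edge_length srs {x, y} = dist x y" for x y
    unfolding edge_length_def srs_def by (rule the_equality) (auto simp: doubleton_eq_iff dist_commute)
  have d: "dist x y = 1" if "(x $ 1 - y $ 1)\<^sup>2 + (x $ 2 - y $ 2)\<^sup>2 + (x $ 3 - y $ 3)\<^sup>2 = 1" for x y :: "real ^ 3"
    using that by (simp add: dist_norm norm_eq_sqrt_inner inner_vec_def sum_3 power2_eq_square)
  have "edge_length srs {x + g, y + g} = dist x y" for x y by (simp add: len)
  moreover have "dist (srs_p 0) (srs_p 1) = 1" "dist (srs_p 0) (srs_p 2) = 1" "dist (srs_p 0) (srs_p 3) = 1"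
    "dist (srs_p 1) (srs_p 2 + srs_g1) = 1" "dist (srs_p 2) (srs_p 3 + srs_g2) = 1" "dist (srs_p 3) (srs_p 1 + srs_g3) = 1"
    by (rule d; simp add: srs_p_simps srs_g1_def srs_g2_def srs_g3_def sqrt_3_divide power2_eq_square algebra_simps)+
  ultimately show ?thesis using assms(1) unfolding srs_base_edges_def by auto
qed

lemma srs_edge_orbit: "edge_orbit srs e = {(\<lambda>x. x + g) ` e | g. g \<in> srs_lattice}"
  by (auto simp: edge_orbit_def srs_def)

text \<open>Six base edges of length 1 cover all orbits. The matching lower bound comes from the
  general inequality, in \<open>similar_srs\<close>.\<close>

lemma srs_length_le: "network_length srs \<le> 6"
proof -
  have orbit: "edge_orbit srs ((\<lambda>x. x + g) ` e) = edge_orbit srs e" if g: "g \<in> srs_lattice" for g and e :: "(real ^ 3) set"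
  proof (intro equalityI subsetI)
    fix x assume "x \<in> edge_orbit srs ((\<lambda>x. x + g) ` e)"
    then obtain k where k: "k \<in> srs_lattice" "x = (\<lambda>x. x + k) ` (\<lambda>x. x + g) ` e" by (auto simp: srs_edge_orbit)
    then have "x = (\<lambda>x. x + (g + k)) ` e" by (simp add: image_image add.assoc)
    then show "x \<in> edge_orbit srs e" using full_lattice_add[OF srs_full g k(1)] by (auto simp: srs_edge_orbit)
  next
    fix x assume "x \<in> edge_orbit srs e"
    then obtain k where k: "k \<in> srs_lattice" "x = (\<lambda>x. x + k) ` e" by (auto simp: srs_edge_orbit)
    then have "x = (\<lambda>x. x + (k - g)) ` (\<lambda>x. x + g) ` e" by (simp add: image_image)
    then show "x \<in> edge_orbit srs ((\<lambda>x. x + g) ` e)"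
      using full_lattice_diff[OF srs_full k(1) g] unfolding srs_edge_orbit by blast
  qed
  have "edges srs = {(\<lambda>x. x + g) ` e | g e. g \<in> srs_lattice \<and> e \<in> srs_base_edges}" by (simp add: srs_def)
  then have Q: "quotient_edges srs \<subseteq> edge_orbit srs ` srs_base_edges"
    unfolding quotient_edges_def using orbit by auto
  have fin: "finite srs_base_edges" by (simp add: srs_base_edges_def)
  have card: "card srs_base_edges \<le> 6" unfolding srs_base_edges_def by (simp add: card_insert_if)
  have "edge_length srs (SOME e. e \<in> c) = 1" if c: "c \<in> quotient_edges srs" for c
  proof -
    obtain e where e: "e \<in> srs_base_edges" "c = edge_orbit srs e" using c Q by blast
    have "(\<lambda>x. x + 0) ` e \<in> c" using full_lattice_zero[OF srs_full] unfolding e(2) srs_edge_orbit by blast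
    then have "(SOME e. e \<in> c) \<in> c" by (rule someI)
    then obtain g where "g \<in> srs_lattice" "(SOME e. e \<in> c) = (\<lambda>x. x + g) ` e" unfolding e(2) srs_edge_orbit by blast
    then show ?thesis using srs_base_length[OF e(1)] by simp
  qed
  then have "network_length srs = card (quotient_edges srs)" by (simp add: network_length_def)
  also have "\<dots> \<le> card (edge_orbit srs ` srs_base_edges)" using card_mono[OF _ Q] fin by simp
  also have "card (edge_orbit srs ` srs_base_edges) \<le> 6" using card_image_le[OF fin, of "edge_orbit srs"] card by linarith
  finally show ?thesis by simp
qed

subsection \<open>Similarities\<close>

text \<open>With the vectors as columns of \<open>U\<close> and \<open>W\<close>, the map is
  \<open>W\<close> times the inverse of \<open>U\<close>; equal Gram matrices make it
  orthogonal.\<close>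

lemma isometry_of_bases:
  fixes u w :: "'n::finite \<Rightarrow> real ^ 'n"
  assumes d: "det (\<chi> i. u i) \<noteq> 0" and g: "\<And>i j. u i \<bullet> u j = w i \<bullet> w j"
  obtains A where "orthogonal_transformation A" "\<And>i. A (u i) = w i"
proof -
  let ?U = "transpose (\<chi> i. u i)" and ?W = "transpose (\<chi> i. w i)"
  have col: "?U *v axis i 1 = u i" "?W *v axis i 1 = w i" for i
    by (simp_all add: vec_eq_iff matrix_vector_mult_def transpose_def axis_def if_distrib[of "\<lambda>x. _ * x"] cong: if_cong)
  have gram: "transpose ?U ** ?U = transpose ?W ** ?W"
    using g by (simp add: vec_eq_iff matrix_matrix_mult_def transpose_def inner_vec_def)
  have "det ?U \<noteq> 0" using d by (simp add: det_transpose)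
  then obtain X where X: "?U ** X = mat 1" "X ** ?U = mat 1"
    using invertible_det_nz[of ?U] unfolding invertible_def by blast
  define A where "A = ?W ** X"
  have "transpose A ** A = transpose X ** (transpose ?W ** ?W) ** X"
    by (simp only: A_def matrix_transpose_mul matrix_mul_assoc)
  also have "\<dots> = transpose (?U ** X) ** (?U ** X)"
    unfolding gram[symmetric] by (simp only: matrix_transpose_mul matrix_mul_assoc)
  also have "\<dots> = mat 1" by (simp add: X(1))
  finally have "orthogonal_matrix A" by (simp add: orthogonal_matrix)
  then have "orthogonal_transformation ((*v) A)"
    by (simp add: orthogonal_transformation_matrix)
  moreover have "A *v u i = w i" for i
  proof -
    have "A *v u i = ((?W ** X) ** ?U) *v axis i 1" by (simp only: A_def col(1)[of i, symmetric] matrix_vector_mul_assoc)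
    also have "\<dots> = w i" by (simp only: matrix_mul_assoc[symmetric] X(2) matrix_mul_rid col)
    finally show ?thesis .
  qed
  ultimately show thesis by (rule that)
qed

lemma bcc_similar:
  fixes \<Lambda> :: "(real ^ 3) set" and A :: "real ^ 3 \<Rightarrow> real ^ 3"
  assumes "body_centred_cubic ((\<lambda>g. c *\<^sub>R A g) ` \<Lambda>)" "c > 0" "orthogonal_transformation A"
  shows "body_centred_cubic \<Lambda>"
proof -
  let ?Z = "{x :: real ^ 3. \<forall>i. x $ i \<in> \<int>} \<union> {x. \<forall>i. x $ i - 1 / 2 \<in> \<int>}"
  obtain d B where dB: "d > 0" "orthogonal_transformation B" "(\<lambda>g. c *\<^sub>R A g) ` \<Lambda> = (\<lambda>x. d *\<^sub>R B x) ` ?Z"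
    using assms(1) unfolding body_centred_cubic_def by blast
  have inj: "inj A" using assms(3) orthogonal_transformation_inj by blast
  have iA: "orthogonal_transformation (inv A)" using assms(3) orthogonal_transformation_inv by blast
  have lin: "linear (inv A)" using iA orthogonal_transformation_def by blast
  have "\<Lambda> = (\<lambda>y. (1 / c) *\<^sub>R inv A y) ` (\<lambda>g. c *\<^sub>R A g) ` \<Lambda>"
    using assms(2) inj by (simp add: image_image linear_scale[OF lin])
  also have "\<dots> = (\<lambda>x. (d / c) *\<^sub>R (inv A \<circ> B) x) ` ?Z"
    unfolding dB(3) image_image by (simp add: linear_scale[OF lin])
  finally show ?thesis
    unfolding body_centred_cubic_def
    using dB(1) assms(2) orthogonal_transformation_compose[OF iA dB(2)] by (intro exI[of _ "d / c"] exI[of _ "inv A \<circ> B"]) simp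
qed

lemma bcc_srs: "body_centred_cubic srs_lattice"
proof -
  let ?Z = "{x :: real ^ 3. \<forall>i. x $ i \<in> \<int>} \<union> {x. \<forall>i. x $ i - 1 / 2 \<in> \<int>}"
  \<comment> \<open>Twice the primitive vectors of the body-centred cubic lattice. Their Gram
    matrix, 3 on the diagonal and -1 elsewhere, is half that of \<open>srs_g\<close>.\<close>
  define u :: "3 \<Rightarrow> real ^ 3" where
    "u i = (if i = 1 then vector [-1, 1, 1] else if i = 2 then vector [1, -1, 1] else vector [1, 1, -1])" for i
  have u: "u 1 = vector [-1, 1, 1]" "u 2 = vector [1, -1, 1]" "u 3 = vector [1, 1, -1]" by (simp_all add: u_def)
  define w where "w i = (1 / sqrt 2) *\<^sub>R srs_g i" for i
  have "det (\<chi> i. u i) = 4" by (simp add: det_3 u)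
  then have nz: "det (\<chi> i. u i) \<noteq> 0" by simp
  have "2 * (u i \<bullet> u j) = srs_g i \<bullet> srs_g j" for i j
    using exhaust_3[of i] exhaust_3[of j]
    by (auto simp: u inner_vec_def sum_3 srs_g1_def srs_g2_def srs_g3_def sqrt_3_divide field_simps)
  note gram2 = this
  have gram: "u i \<bullet> u j = w i \<bullet> w j" for i j
  proof -
    have "w i \<bullet> w j = srs_g i \<bullet> srs_g j / 2" by (simp add: w_def)
    then show ?thesis using gram2[of i j] by simp
  qed
  obtain A where A: "orthogonal_transformation A" "\<And>i. A (u i) = w i" by (rule isometry_of_bases[OF nz gram], rule that)
  have lin: "linear A" using A(1) orthogonal_transformation_def by blast
  have g: "srs_g i = sqrt 2 *\<^sub>R A (u i)" for i by (simp add: A(2) w_def)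
  \<comment> \<open>The parity of \<open>a + b + c\<close> decides whether the coordinates are all
    integers or all integers plus 1/2.\<close>
  define z where "z a b c = (1 / 2) *\<^sub>R (of_int a *\<^sub>R u 1 + of_int b *\<^sub>R u 2 + of_int c *\<^sub>R u 3)" for a b c :: int
  have z: "z a b c $ 1 = (a + b + c) / 2 - a" "z a b c $ 2 = (a + b + c) / 2 - b" "z a b c $ 3 = (a + b + c) / 2 - c" for a b c
    by (simp_all add: z_def u field_simps)
  have im: "of_int a *\<^sub>R srs_g 1 + of_int b *\<^sub>R srs_g 2 + of_int c *\<^sub>R srs_g 3 = (2 * sqrt 2) *\<^sub>R A (z a b c)" for a b c
    unfolding z_def g by (simp only: linear_scale[OF lin] linear_add[OF lin]) (simp add: algebra_simps)
  have zZ: "z a b c \<in> ?Z" for a b c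
  proof (cases "even (a + b + c)")
    case True
    then obtain m where "a + b + c = 2 * m" by (elim evenE)
    then have "(real_of_int a + of_int b + of_int c) / 2 = of_int m" by (metis of_int_add of_int_mult of_int_numeral nonzero_mult_div_cancel_left zero_neq_numeral)
    then show ?thesis by (simp add: forall_3 z)
  next
    case False
    then obtain m where "a + b + c = 2 * m + 1" by (elim oddE)
    then have "(real_of_int a + of_int b + of_int c) = 2 * of_int m + 1" by (metis of_int_add of_int_mult of_int_numeral of_int_1)
    then have "(real_of_int a + of_int b + of_int c) / 2 = of_int m + 1 / 2" by simp
    then have "z a b c $ 1 - 1 / 2 = of_int (m - a)" "z a b c $ 2 - 1 / 2 = of_int (m - b)" "z a b c $ 3 - 1 / 2 = of_int (m - c)"
      by (simp_all add: z field_simps)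
    then have "z a b c $ 1 - 1 / 2 \<in> \<int>" "z a b c $ 2 - 1 / 2 \<in> \<int>" "z a b c $ 3 - 1 / 2 \<in> \<int>"
      by (simp_all only: Ints_of_int)
    then show ?thesis unfolding Un_iff mem_Collect_eq forall_3 by blast
  qed
  have Zz: "\<exists>a b c. x = z a b c" if x: "x \<in> ?Z" for x
  proof -
    have "x $ i + x $ j \<in> \<int>" for i j
    proof -
      have "x $ i \<in> \<int> \<and> x $ j \<in> \<int> \<or> x $ i - 1 / 2 \<in> \<int> \<and> x $ j - 1 / 2 \<in> \<int>" using x by blast
      moreover have "x $ i + x $ j = (x $ i - 1 / 2) + (x $ j - 1 / 2) + 1" by simp
      ultimately show ?thesis by (metis Ints_1 Ints_add)
    qed
    \<comment> \<open>Solving for the coefficients of \<open>z\<close> gives the pair sums of the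
      coordinates, which are integral in both cosets.\<close>
    then obtain a b c where abc: "x $ 2 + x $ 3 = of_int a" "x $ 1 + x $ 3 = of_int b" "x $ 1 + x $ 2 = of_int c"
      by (metis Ints_cases)
    have "x = z a b c" unfolding vec_eq_iff forall_3 z abc[symmetric] by (simp add: field_simps)
    then show ?thesis by blast
  qed
  have "srs_lattice = (\<lambda>x. (2 * sqrt 2) *\<^sub>R A x) ` ?Z"
  proof (intro equalityI subsetI)
    fix x assume "x \<in> srs_lattice"
    then obtain a b c where "x = (2 * sqrt 2) *\<^sub>R A (z a b c)" unfolding srs_lattice_zspan zspan_3 im by blast
    then show "x \<in> (\<lambda>x. (2 * sqrt 2) *\<^sub>R A x) ` ?Z" using zZ by blast
  next
    fix x assume "x \<in> (\<lambda>x. (2 * sqrt 2) *\<^sub>R A x) ` ?Z"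
    then obtain a b c where "x = (2 * sqrt 2) *\<^sub>R A (z a b c)" using Zz by blast
    then show "x \<in> srs_lattice" unfolding srs_lattice_zspan zspan_3 im by blast
  qed
  then show ?thesis unfolding body_centred_cubic_def using A(1) by (intro exI[of _ "2 * sqrt 2"] exI[of _ A]) simp
qed

lemma lattice_basis_similar:
  fixes A :: "real ^ 'n::_ \<Rightarrow> real ^ 'n::{finite,wellorder}"
  assumes g: "lattice_basis \<Lambda> g" and "c > 0" "orthogonal_transformation A"
  shows "lattice_basis ((\<lambda>g. c *\<^sub>R A g) ` \<Lambda>) (\<lambda>i. c *\<^sub>R A (g i))"
    and "covolume ((\<lambda>g. c *\<^sub>R A g) ` \<Lambda>) = c ^ CARD('n) * covolume \<Lambda>"
proof -
  let ?f = "\<lambda>x. c *\<^sub>R A x"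
  have lin: "linear A" using assms(3) orthogonal_transformation_def by blast
  have linf: "linear ?f" by (rule linear_compose_scale_right[OF lin])
  have dA: "\<bar>det (matrix ?f)\<bar> = c ^ CARD('n)"
  proof -
    have "matrix ?f = matrix ((*\<^sub>R) c) ** matrix A"
      using matrix_compose[OF lin, of "(*\<^sub>R) c"] by (simp add: o_def)
    then have "det (matrix ?f) = c ^ CARD('n) * det (matrix A)"
      by (simp add: det_mul)
    moreover have "\<bar>det (matrix A)\<bar> = 1"
      using assms(3) orthogonal_transformation_det by blast
    ultimately show ?thesis using assms(2) by (simp add: abs_mult)
  qed
  have rows: "(\<chi> i. ?f (g i)) = (\<chi> i. g i) ** transpose (matrix ?f)"
  proof -
    have "?f (g i) = matrix ?f *v g i" for i using linf by simp
    then show ?thesis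
      by (simp add: vec_eq_iff matrix_matrix_mult_def matrix_vector_mult_def transpose_def mult.commute)
  qed
  have det: "\<bar>det (\<chi> i. ?f (g i))\<bar> = c ^ CARD('n) * \<bar>det (\<chi> i. g i)\<bar>"
    unfolding rows det_mul det_transpose abs_mult dA by simp
  have "?f ` zspan g = zspan (\<lambda>i. ?f (g i))"
  proof -
    have "?f (\<Sum>i\<in>UNIV. of_int (a i) *\<^sub>R g i) = (\<Sum>i\<in>UNIV. of_int (a i) *\<^sub>R ?f (g i))" for a :: "'n \<Rightarrow> int"
      by (simp add: linear_sum[OF lin] linear_scale[OF lin] scaleR_sum_right mult.commute)
    then show ?thesis unfolding zspan_def by (auto simp: image_iff) (metis (no_types, lifting))+
  qed
  then show b: "lattice_basis (?f ` \<Lambda>) (\<lambda>i. ?f (g i))"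
    using g det assms(2) by (auto simp: lattice_basis_iff)
  show "covolume (?f ` \<Lambda>) = c ^ CARD('n) * covolume \<Lambda>"
    unfolding covolume_eq_det[OF b] covolume_eq_det[OF g] det ..
qed

lemma (in periodic_net) similar_network_length:
  assumes c: "c > 0" and A: "orthogonal_transformation A" and f: "bij_betw f V (verts M)"
    and e: "edges M = (\<lambda>e. f ` e) ` edges N"
    and p: "\<forall>v\<in>V. pos M (f v) = c *\<^sub>R A (pos N v) + b"
    and l: "lattice M = (\<lambda>g. c *\<^sub>R A g) ` \<Lambda>"
    and a: "\<forall>g\<in>\<Lambda>. \<forall>v\<in>V. f (act N g v) = act M (c *\<^sub>R A g) (f v)"
  shows "network_length M = c * network_length N"
proof -
  let ?F = "\<lambda>C. (\<lambda>e. f ` e) ` C"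
  have lin: "linear A" using A orthogonal_transformation_def by blast
  have inj: "inj_on f V" using f by (simp add: bij_betw_def)
  have sub: "x \<subseteq> V" if "x \<in> edges N" for x using that by (elim edgeE) auto
  have orbit: "edge_orbit M (f ` x) = ?F (edge_orbit N x)" if x: "x \<in> edges N" for x
  proof -
    have eq: "act M (c *\<^sub>R A g) ` (f ` x) = f ` (act N g ` x)" if "g \<in> \<Lambda>" for g
      unfolding image_image by (rule image_cong[OF refl]) (use a that sub[OF x] in auto)
    have "edge_orbit M (f ` x) = (\<lambda>g. act M (c *\<^sub>R A g) ` (f ` x)) ` \<Lambda>"
      unfolding edge_orbit_def l by (rule image_image)
    also have "\<dots> = (\<lambda>g. f ` (act N g ` x)) ` \<Lambda>" by (rule image_cong[OF refl eq])
    also have "\<dots> = ?F (edge_orbit N x)" unfolding edge_orbit_def by (rule image_image[symmetric])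
    finally show ?thesis .
  qed
  have Q: "quotient_edges M = ?F ` E"
    unfolding quotient_edges_def e image_image using orbit by (intro image_cong) auto
  have len: "edge_length M (f ` x) = c * edge_length N x" if x: "x \<in> edges N" for x
  proof -
    obtain u w where uw: "x = {u, w}" "u \<in> V" "w \<in> V" using x by (rule edgeE)
    have "edge_length M {f u, f w} = dist (pos M (f u)) (pos M (f w))"
      unfolding edge_length_def by (rule the_equality) (auto simp: doubleton_eq_iff dist_commute)
    also have "\<dots> = norm (c *\<^sub>R A (pos N u - pos N w))"
      using uw by (simp add: dist_norm p linear_diff[OF lin] scaleR_diff_right)
    also have "\<dots> = c * dist (pos N u) (pos N w)"
      using c orthogonal_transformation_norm[OF A] by (simp add: dist_norm)
    finally show ?thesis by (simp add: uw(1) edge_length_pair)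
  qed
  have some: "edge_length M (SOME x. x \<in> ?F C) = c * edge_length N (SOME x. x \<in> C)" if C: "C \<in> E" for C
  proof -
    obtain x where "x \<in> C" using C edge_orbit_self by (auto simp: quotient_edges_def)
    then have "f ` x \<in> ?F C" by blast
    then have "(SOME x. x \<in> ?F C) \<in> ?F C" by (rule someI)
    then obtain y where y: "y \<in> C" "(SOME x. x \<in> ?F C) = f ` y" by blast
    then show ?thesis using len[of y] quotient_edge_eq(1)[OF C y(1)] edge_length_quotient[OF C y(1)] by simp
  qed
  have injF: "inj_on ?F E"
  proof (rule inj_onI)
    fix C C' assume C: "C \<in> E" "C' \<in> E" "?F C = ?F C'"
    have "inj_on (\<lambda>x. f ` x) (edges N)"
      using inj sub by (intro inj_onI) (metis inj_on_image_eq_iff)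
    moreover have "C \<subseteq> edges N" "C' \<subseteq> edges N" using C quotient_edge_eq(1) by blast+
    ultimately show "C = C'" using C(3) inj_on_image_eq_iff[of "\<lambda>x. f ` x" "edges N" C C'] by blast
  qed
  have "network_length M = (\<Sum>C\<in>E. edge_length M (SOME x. x \<in> ?F C))"
    unfolding network_length_def Q by (simp add: sum.reindex[OF injF])
  also have "\<dots> = c * network_length N"
    unfolding network_length_def sum_distrib_left using some by (intro sum.cong) auto
  finally show ?thesis .
qed

text \<open>Length at most 6 and covolume \<open>8 * sqrt 2\<close> of srs bound the ratio from
  above, since \<open>6 ^ 3 = (27 / sqrt 2) * (8 * sqrt 2)\<close> and the scaling cancels. The
  general inequality for \<open>N\<close> bounds it from below.\<close>

theorem similar_srs:
  fixes N :: "('v, 3) network"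
  assumes "periodic_network N" "similar_networks N srs"
  shows "network_length N ^ 3 / network_volume N = 27 / sqrt 2" "body_centred_cubic (lattice N)"
proof -
  interpret periodic_net N by unfold_locales (rule assms(1))
  obtain c A b f where s: "c > 0" "orthogonal_transformation A" "bij_betw f V (verts srs)"
    "edges srs = (\<lambda>e. f ` e) ` edges N"
    "\<forall>v\<in>V. pos srs (f v) = c *\<^sub>R A (pos N v) + b"
    "lattice srs = (\<lambda>g. c *\<^sub>R A g) ` \<Lambda>"
    "\<forall>g\<in>\<Lambda>. \<forall>v\<in>V. f (act N g v) = act srs (c *\<^sub>R A g) (f v)"
    using assms(2) unfolding similar_networks_def by - (elim exE conjE, rule that)
  have lat: "srs_lattice = (\<lambda>g. c *\<^sub>R A g) ` \<Lambda>" using s(6) by (simp add: srs_def)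
  have L: "network_length srs = c * network_length N" by (rule similar_network_length[OF s])
  have V: "8 * sqrt 2 = c ^ 3 * network_volume N"
  proof -
    obtain g where "lattice_basis \<Lambda> g" using full by (auto simp: full_lattice_def)
    from lattice_basis_similar(2)[OF this s(1,2)] show ?thesis
      using covolume_srs by (simp add: network_volume_def lat[symmetric])
  qed
  have vp: "network_volume N > 0" and ge: "27 / sqrt 2 \<le> network_length N ^ 3 / network_volume N"
    using length_volume_inequality[OF assms(1)] by auto
  have c3: "c ^ 3 > 0" using s(1) by simp
  have nn: "network_length N \<ge> 0"
  proof -
    have "0 < network_length N ^ 3 / network_volume N" using ge by (smt (verit) divide_pos_pos real_sqrt_gt_zero)
    then have "network_length N ^ 3 > 0" using vp by (simp add: zero_less_divide_iff)
    then show ?thesis by (simp add: zero_less_power_eq)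
  qed
  have "(c * network_length N) ^ 3 \<le> 6 ^ 3"
    using srs_length_le L nn s(1) by (intro power_mono) auto
  then have "c ^ 3 * network_length N ^ 3 \<le> 216" by (simp add: power_mult_distrib)
  also have "216 = (27 / sqrt 2) * (8 * sqrt 2)" by simp
  also have "\<dots> = c ^ 3 * ((27 / sqrt 2) * network_volume N)" unfolding V by simp
  finally have "network_length N ^ 3 \<le> (27 / sqrt 2) * network_volume N"
    using mult_le_cancel_left_pos[OF c3] by blast
  then have "network_length N ^ 3 / network_volume N \<le> 27 / sqrt 2" using vp by (simp add: divide_le_eq)
  then show "network_length N ^ 3 / network_volume N = 27 / sqrt 2" using ge by simp
  show "body_centred_cubic (lattice N)"
    by (rule bcc_similar[OF _ s(1,2)]) (simp add: bcc_srs flip: lat)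
qed

subsection \<open>Recognition of the srs network\<close>

lemma inner_unit_triangle:
  fixes a b c :: "'a::real_inner"
  assumes "norm (a - b) = 1" "norm (c - b) = 1" "norm (a - c) = 1"
  shows "(a - b) \<bullet> (c - b) = 1 / 2"
proof -
  have "(norm (a - c))\<^sup>2 = (norm ((a - b) - (c - b)))\<^sup>2" by simp
  also have "\<dots> = (norm (a - b))\<^sup>2 - 2 * ((a - b) \<bullet> (c - b)) + (norm (c - b))\<^sup>2"
    unfolding power2_norm_eq_inner by (simp only: inner_diff_left inner_diff_right inner_commute) (simp add: algebra_simps inner_commute)
  finally show ?thesis using assms by simp
qed

text \<open>The edges of srs are parallel to those of a regular tetrahedron. Three independent edge
  vectors have the same Gram matrix as the corresponding differences of the \<open>e i\<close>,
  which determines the isometry.\<close>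

lemma tetrahedron_isometry:
  fixes e :: "nat \<Rightarrow> real ^ 3"
  assumes "\<forall>i<4. \<forall>j<4. i \<noteq> j \<longrightarrow> norm (e i - e j) = 1"
  obtains B where "orthogonal_transformation B" "B (srs_p 1) = e 0 - e 1" "B (srs_p 2) = e 1 - e 2"
    "B (srs_p 2 + srs_g1 - srs_p 1) = e 3 - e 1"
proof -
  have e: "norm (e i - e j) = 1" if "i < 4" "j < 4" "i \<noteq> j" for i j using assms that by blast
  define w :: "3 \<Rightarrow> real ^ 3" where
    "w i = (if i = 1 then srs_p 1 else if i = 2 then srs_p 2 else srs_p 2 + srs_g1 - srs_p 1)" for i
  define u :: "3 \<Rightarrow> real ^ 3" where
    "u i = (if i = 1 then e 0 - e 1 else if i = 2 then e 1 - e 2 else e 3 - e 1)" for i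
  have w: "w 1 = vector [1, 0, 0]" "w 2 = vector [- 1 / 2, sqrt 3 / 2, 0]"
    "w 3 = vector [1 / 2, - sqrt 3 / 6, - sqrt (2 / 3)]"
    by (simp_all add: w_def srs_p_simps srs_g1_def vec_eq_iff forall_3 sqrt_3_divide)
  have u: "u 1 = e 0 - e 1" "u 2 = e 1 - e 2" "u 3 = e 3 - e 1" by (simp_all add: u_def)
  have "det (\<chi> i. w i) = - (sqrt 3 * sqrt (2 / 3)) / 2" by (simp add: det_3 w)
  then have nz: "det (\<chi> i. w i) \<noteq> 0" by simp
  have I: "(e i - e j) \<bullet> (e k - e j) = 1 / 2" if "i < 4" "j < 4" "k < 4" "i \<noteq> j" "k \<noteq> j" "i \<noteq> k" for i j k
    using e that by (intro inner_unit_triangle) auto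
  have S: "(e i - e j) \<bullet> (e i - e j) = 1" if "i < 4" "j < 4" "i \<noteq> j" for i j
    using e[OF that] by (simp add: dot_square_norm)
  have neg: "e 1 - e 2 = - (e 2 - e 1)" by simp
  have G: "u 1 \<bullet> u 1 = 1" "u 2 \<bullet> u 2 = 1" "u 3 \<bullet> u 3 = 1" "u 1 \<bullet> u 2 = - 1 / 2" "u 1 \<bullet> u 3 = 1 / 2" "u 2 \<bullet> u 3 = - 1 / 2"
  proof -
    show "u 1 \<bullet> u 1 = 1" "u 2 \<bullet> u 2 = 1" "u 3 \<bullet> u 3 = 1" unfolding u by (rule S; simp)+
    show "u 1 \<bullet> u 2 = - 1 / 2" unfolding u neg inner_minus_right using I[of 0 1 2] by simp
    show "u 1 \<bullet> u 3 = 1 / 2" unfolding u using I[of 0 1 3] by simp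
    show "u 2 \<bullet> u 3 = - 1 / 2" unfolding u neg inner_minus_left using I[of 2 1 3] by simp
  qed
  have W: "w 1 \<bullet> w 1 = 1" "w 2 \<bullet> w 2 = 1" "w 3 \<bullet> w 3 = 1" "w 1 \<bullet> w 2 = - 1 / 2" "w 1 \<bullet> w 3 = 1 / 2" "w 2 \<bullet> w 3 = - 1 / 2"
    unfolding w by (simp_all add: inner_vec_def sum_3)
  have gram: "w i \<bullet> w j = u i \<bullet> u j" for i j
    using exhaust_3[of i] exhaust_3[of j] G W inner_commute[of "w 2" "w 1"] inner_commute[of "w 3" "w 1"] inner_commute[of "w 3" "w 2"]
      inner_commute[of "u 2" "u 1"] inner_commute[of "u 3" "u 1"] inner_commute[of "u 3" "u 2"] by (elim disjE) simp_all
  obtain B where B: "orthogonal_transformation B" "\<And>i. B (w i) = u i"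
    by (rule isometry_of_bases[OF nz gram], rule that)
  show thesis
    by (rule that[OF B(1)]) (use B(2)[of 1] B(2)[of 2] B(2)[of 3] in \<open>simp_all add: u_def w_def\<close>)
qed

text \<open>The edge vectors are \<open>\<kappa>\<close> times the edges of the tetrahedron
  \<open>e\<close>, arranged as in srs, so one isometry matches them all. The volume then forces
  \<open>g1\<close>, \<open>g2\<close>, \<open>g3\<close> to generate the whole lattice.\<close>

theorem srs_recognition:
  fixes N :: "('v, 3) network" and b :: "nat \<Rightarrow> 'v" and e :: "nat \<Rightarrow> real ^ 3"
  assumes per: "periodic_network N" and \<kappa>: "\<kappa> > 0" and vol: "network_volume N = 8 * sqrt 2 * \<kappa> ^ 3"
    and b: "\<And>i. i \<le> 3 \<Longrightarrow> b i \<in> verts N"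
    and g: "g1 \<in> lattice N" "g2 \<in> lattice N" "g3 \<in> lattice N"
    and V: "verts N \<subseteq> {act N g (b i) | g i. g \<in> lattice N \<and> i \<le> 3}"
    and E: "edges N = {act N g ` x | g x. g \<in> lattice N \<and>
      x \<in> {{b 0, b 1}, {b 0, b 2}, {b 0, b 3}, {b 1, act N g1 (b 2)}, {b 2, act N g2 (b 3)}, {b 3, act N g3 (b 1)}}}"
    and e: "\<And>i j. i < 4 \<Longrightarrow> j < 4 \<Longrightarrow> i \<noteq> j \<Longrightarrow> norm (e i - e j) = 1"
    and p: "pos N (b 1) - pos N (b 0) = \<kappa> *\<^sub>R (e 0 - e 1)" "pos N (b 2) - pos N (b 0) = \<kappa> *\<^sub>R (e 1 - e 2)"
      "pos N (b 3) - pos N (b 0) = \<kappa> *\<^sub>R (e 2 - e 0)" "pos N (b 2) + g1 - pos N (b 1) = \<kappa> *\<^sub>R (e 3 - e 1)"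
      "pos N (b 3) + g2 - pos N (b 2) = \<kappa> *\<^sub>R (e 3 - e 2)" "pos N (b 1) + g3 - pos N (b 3) = \<kappa> *\<^sub>R (e 3 - e 0)"
  shows "similar_networks N srs"
proof -
  interpret periodic_net N by unfold_locales (rule per)
  obtain B where B: "orthogonal_transformation B" "B (srs_p 1) = e 0 - e 1" "B (srs_p 2) = e 1 - e 2"
    "B (srs_p 2 + srs_g1 - srs_p 1) = e 3 - e 1"
    by (rule tetrahedron_isometry[of e], use e in blast, rule that)
  have linB: "linear B" using B(1) orthogonal_transformation_def by blast
  have Bp0: "B (srs_p 0) = 0"
  proof -
    have "srs_p 0 = 0" by (simp add: srs_p_simps vec_eq_iff forall_3)
    then show ?thesis using linear_0[OF linB] by simp
  qed
  have Bp3: "B (srs_p 3) = e 2 - e 0"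
  proof -
    have "srs_p 3 = - (srs_p 1 + srs_p 2)" by (simp add: srs_p_simps vec_eq_iff forall_3)
    then have "B (srs_p 3) = - (B (srs_p 1) + B (srs_p 2))"
      by (simp only: linear_neg[OF linB] linear_add[OF linB])
    then show ?thesis using B(2,3) by simp
  qed
  \<comment> \<open>The vector of the fourth base edge; \<open>srs_g2\<close> and
    \<open>srs_g3\<close> are combinations of it and the base points.\<close>
  define X where "X = srs_p 2 + srs_g1 - srs_p 1"
  have BX: "B X = e 3 - e 1" using B(4) by (simp only: X_def)
  have Bg1: "B srs_g1 = (e 3 - e 1) - (e 1 - e 2) + (e 0 - e 1)"
  proof -
    have "srs_g1 = X - srs_p 2 + srs_p 1" by (simp add: X_def)
    then have "B srs_g1 = B (X - srs_p 2 + srs_p 1)" by (rule arg_cong)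
    also have "\<dots> = B X - B (srs_p 2) + B (srs_p 1)"
      by (simp only: linear_diff[OF linB] linear_add[OF linB])
    finally show ?thesis unfolding B(2,3) BX .
  qed
  have Bg2: "B srs_g2 = (e 3 - e 2) - (e 2 - e 0) + (e 1 - e 2)"
  proof -
    have "srs_g2 = X + srs_p 2 - srs_p 3 + srs_p 2"
      by (simp add: X_def srs_p_simps srs_g1_def srs_g2_def vec_eq_iff forall_3 sqrt_3_divide)
    then have "B srs_g2 = B (X + srs_p 2 - srs_p 3 + srs_p 2)" by (rule arg_cong)
    also have "\<dots> = B X + B (srs_p 2) - B (srs_p 3) + B (srs_p 2)"
      by (simp only: linear_diff[OF linB] linear_add[OF linB])
    finally show ?thesis unfolding B(3) Bp3 BX by simp
  qed
  have Bg3: "B srs_g3 = (e 3 - e 0) - (e 0 - e 1) + (e 2 - e 0)"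
  proof -
    have "srs_g3 = X - srs_p 1 - srs_p 1 + srs_p 3"
      by (simp add: X_def srs_p_simps srs_g1_def srs_g3_def vec_eq_iff forall_3 sqrt_3_divide)
    then have "B srs_g3 = B (X - srs_p 1 - srs_p 1 + srs_p 3)" by (rule arg_cong)
    also have "\<dots> = B X - B (srs_p 1) - B (srs_p 1) + B (srs_p 3)"
      by (simp only: linear_diff[OF linB] linear_add[OF linB])
    finally show ?thesis unfolding B(2) Bp3 BX by simp
  qed
  have kB: "\<kappa> *\<^sub>R B srs_g1 = g1" "\<kappa> *\<^sub>R B srs_g2 = g2" "\<kappa> *\<^sub>R B srs_g3 = g3"
    unfolding Bg1 Bg2 Bg3 scaleR_add_right scaleR_diff_right[of \<kappa> "_ - _" "_ - _"] p[symmetric] by simp_all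
  have lat: "\<Lambda> = (\<lambda>x. \<kappa> *\<^sub>R B x) ` srs_lattice"
  proof -
    have bas: "lattice_basis ((\<lambda>x. \<kappa> *\<^sub>R B x) ` srs_lattice) (\<lambda>i. \<kappa> *\<^sub>R B (srs_g i))"
      and cov: "covolume ((\<lambda>x. \<kappa> *\<^sub>R B x) ` srs_lattice) = \<kappa> ^ 3 * (8 * sqrt 2)"
      using lattice_basis_similar[OF srs_basis \<kappa> B(1)] covolume_srs by simp_all
    have "\<kappa> *\<^sub>R B (srs_g i) \<in> \<Lambda>" for i
      using exhaust_3[of i] g kB by auto
    moreover have "\<bar>det (\<chi> i. \<kappa> *\<^sub>R B (srs_g i))\<bar> = covolume \<Lambda>"
      using covolume_eq_det[OF bas] cov vol by (simp add: network_volume_def mult_ac)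
    ultimately have "\<Lambda> = zspan (\<lambda>i. \<kappa> *\<^sub>R B (srs_g i))" by (rule full_lattice_eq_zspan[OF full])
    then show ?thesis using bas by (simp add: lattice_basis_iff)
  qed
  define A where "A = inv B"
  have A: "orthogonal_transformation A" unfolding A_def by (rule orthogonal_transformation_inv[OF B(1)])
  have linA: "linear A" using A orthogonal_transformation_def by blast
  have AB: "A (B x) = x" for x using orthogonal_transformation_inj[OF B(1)] by (simp add: A_def)
  have BA: "B (A x) = x" for x using orthogonal_transformation_surj[OF B(1)] by (simp add: A_def surj_f_inv_f)
  define G where "G x = (1 / \<kappa>) *\<^sub>R A x" for x
  have GB: "G (\<kappa> *\<^sub>R B x) = x" for x using \<kappa> by (simp add: G_def linear_scale[OF linA] AB)
  have BG: "\<kappa> *\<^sub>R B (G x) = x" for x using \<kappa> by (simp add: G_def linear_scale[OF linB] BA)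
  have Gadd: "G (x + y) = G x + G y" "G (x - y) = G x - G y" for x y
    by (simp_all add: G_def linear_add[OF linA] linear_diff[OF linA] algebra_simps)
  have Glat: "srs_lattice = G ` \<Lambda>" unfolding lat image_image GB by simp
  have Ginj: "x = y" if "G x = G y" for x y using BG that by metis
  \<comment> \<open>Vertices of srs are their own positions, so the isomorphism is read off from
    positions; incongruence of the \<open>srs_p i\<close> makes it injective.\<close>
  define f where "f v = G (pos N v - pos N (b 0))" for v
  have f_act: "f (act N g v) = f v + G g" if "g \<in> \<Lambda>" "v \<in> V" for g v
    using that by (simp add: f_def Gadd)
  have fb: "f (b i) = srs_p i" if "i \<le> 3" for i
  proof -
    have "pos N (b i) - pos N (b 0) = \<kappa> *\<^sub>R B (srs_p i)"
      using that p(1-3) Bp0 Bp3 B(2,3) by (auto simp: le_Suc_eq numeral_3_eq_3 numeral_2_eq_2)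
    then show ?thesis by (simp add: f_def GB)
  qed
  have srsV: "verts srs = {srs_p i + x | i x. i \<le> 3 \<and> x \<in> srs_lattice}"
    and srsE: "edges srs = {(\<lambda>x. x + g) ` y | g y. g \<in> srs_lattice \<and> y \<in> srs_base_edges}"
    by (simp_all add: srs_def)
  have "bij_betw f V (verts srs)"
  proof (rule bij_betw_imageI)
    show "inj_on f V"
    proof (rule inj_onI)
      fix v w assume vw: "v \<in> V" "w \<in> V" "f v = f w"
      obtain g i where v: "v = act N g (b i)" "g \<in> \<Lambda>" "i \<le> 3" using V vw(1) by blast
      obtain k j where w: "w = act N k (b j)" "k \<in> \<Lambda>" "j \<le> 3" using V vw(2) by blast
      have eq: "srs_p i + G g = srs_p j + G k" using vw(3) v w b by (simp add: f_act fb)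
      then have "srs_p i - srs_p j = G (k - g)" by (simp add: Gadd algebra_simps)
      moreover have "G (k - g) \<in> srs_lattice" using Glat v w by auto
      ultimately have "i = j" using srs_p_incongruent[of i j] v(3) w(3) by metis
      then have "G g = G k" using eq by simp
      then have "g = k" by (rule Ginj)
      then show "v = w" using v w \<open>i = j\<close> by simp
    qed
    have fa: "f (act N g (b i)) = srs_p i + G g" if "g \<in> \<Lambda>" "i \<le> 3" for g i using that b by (simp add: f_act fb)
    show "f ` V = verts srs"
    proof (intro equalityI subsetI)
      fix x assume "x \<in> f ` V"
      then obtain g i where gi: "x = f (act N g (b i))" "g \<in> \<Lambda>" "i \<le> 3" using V by blast
      then show "x \<in> verts srs" unfolding srsV Glat using fa by blast
    next
      fix x assume "x \<in> verts srs"
      then obtain g i where gi: "x = srs_p i + G g" "g \<in> \<Lambda>" "i \<le> 3" unfolding srsV Glat by blast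
      then have "x = f (act N g (b i))" "act N g (b i) \<in> V" using fa b by simp_all
      then show "x \<in> f ` V" by blast
    qed
  qed
  moreover have "edges srs = (\<lambda>x. f ` x) ` edges N"
  proof -
    define base where "base = {{b 0, b 1}, {b 0, b 2}, {b 0, b 3}, {b 1, act N g1 (b 2)}, {b 2, act N g2 (b 3)}, {b 3, act N g3 (b 1)}}"
    have Eb: "edges N = {act N g ` x | g x. g \<in> \<Lambda> \<and> x \<in> base}" unfolding E base_def ..
    have Gg: "G g1 = srs_g1" "G g2 = srs_g2" "G g3 = srs_g3" using GB kB by metis+
    have image_base: "(\<lambda>x. f ` x) ` base = srs_base_edges"
      unfolding srs_base_edges_def base_def using b g by (simp add: f_act fb Gg)
    have sub: "x \<subseteq> V" if "x \<in> base" for x using that b g by (auto simp: base_def)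
    have fa: "f ` (act N g ` x) = (\<lambda>y. y + G g) ` (f ` x)" if "g \<in> \<Lambda>" "x \<in> base" for g x
      unfolding image_image by (rule image_cong[OF refl]) (use f_act that(1) sub[OF that(2)] in auto)
    show ?thesis
    proof (intro equalityI subsetI)
      fix x assume "x \<in> edges srs"
      then obtain g y where gy: "g \<in> \<Lambda>" "y \<in> base" "x = (\<lambda>x. x + G g) ` (f ` y)"
        unfolding srsE Glat image_base[symmetric] by blast
      then have "x = f ` (act N g ` y)" "act N g ` y \<in> edges N" using fa Eb by (simp, blast)
      then show "x \<in> (\<lambda>x. f ` x) ` edges N" by blast
    next
      fix x assume "x \<in> (\<lambda>x. f ` x) ` edges N"
      then obtain g y where gy: "g \<in> \<Lambda>" "y \<in> base" "x = f ` (act N g ` y)" unfolding Eb by blast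
      then have "x = (\<lambda>x. x + G g) ` (f ` y)" using fa by simp
      then show "x \<in> edges srs" unfolding srsE Glat image_base[symmetric] using gy(1,2) by blast
    qed
  qed
  moreover have "\<forall>v\<in>V. pos srs (f v) = (1 / \<kappa>) *\<^sub>R A (pos N v) + - G (pos N (b 0))"
    by (simp add: srs_def f_def G_def linear_diff[OF linA] algebra_simps)
  moreover have "lattice srs = (\<lambda>g. (1 / \<kappa>) *\<^sub>R A g) ` \<Lambda>"
    using Glat by (simp add: srs_def G_def)
  moreover have "\<forall>g\<in>\<Lambda>. \<forall>v\<in>V. f (act N g v) = act srs ((1 / \<kappa>) *\<^sub>R A g) (f v)"
    using f_act by (simp add: srs_def G_def)
  ultimately show ?thesis
    unfolding similar_networks_def using \<kappa> A by (intro exI[of _ "1 / \<kappa>"] exI[of _ A] exI[of _ "- G (pos N (b 0))"] exI[of _ f]) simp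
qed

section \<open>Matching a reduced minimal network with srs\<close>

context net_min_reduced
begin

lemma rev_half_edge_set:
  assumes "\<eta> \<in> HE"
  shows "{src (rev \<eta>), nb (rev \<eta>)} = act N (- shift \<eta>) ` {src \<eta>, nb \<eta>}"
  using half_edge[OF assms] by (simp add: nb_def insert_commute)

lemma edge_half_edge:
  assumes "x \<in> edges N"
  obtains g i j where "g \<in> \<Lambda>" "i < 4" "j < 4" "i \<noteq> j" "x = act N g ` {src (he i j), nb (he i j)}"
proof -
  obtain u w where uw: "x = {u, w}" using assms by (rule edgeE)
  obtain c g where c: "c \<in> E" "g \<in> \<Lambda>"
    "(u = act N g (s c) \<and> w = act N (g + h c) (t c)) \<or> (w = act N g (s c) \<and> u = act N (g + h c) (t c))"
    using edge_form[of u w] assms uw by metis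
  have HE: "(c, True) \<in> HE" using c by simp
  have "x = act N g ` {src (c, True), nb (c, True)}"
    using c h_lattice by (auto simp: uw src_def nb_def shift_def tgt_def)
  then show thesis using he_cases[OF HE] that c(2) by metis
qed

theorem similar_srs: "similar_networks N srs"
proof -
  obtain k l where kl: "{k, l} = {2, 3 :: nat}"
    and HA: "H (src (he 0 1)) = {he 0 1, he 1 k, he k 0}" and HB: "H (src (he 1 0)) = {he 1 0, he 0 l, he l 1}"
    and HC: "H (src (he 0 k)) = {he 0 k, he k l, he l 0}" and HD: "H (src (he k 1)) = {he k 1, he 1 l, he l k}"
    by (rule tetrahedron, rule that)
  have ne: "k < 4" "l < 4" "k \<noteq> 0" "k \<noteq> 1" "l \<noteq> 0" "l \<noteq> 1" "k \<noteq> l" using kl by (auto simp: doubleton_eq_iff)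
  have four: "i = 0 \<or> i = 1 \<or> i = k \<or> i = l" if "i < 4" for i using that kl by (auto simp: less_4_cases doubleton_eq_iff)
  define vA vB vC vD where "vA = src (he 0 1)" and "vB = src (he 1 0)" and "vC = src (he 0 k)" and "vD = src (he k 1)"
  note vdefs = vA_def[symmetric] vB_def[symmetric] vC_def[symmetric] vD_def[symmetric]
  note HA = HA[unfolded vdefs] and HB = HB[unfolded vdefs] and HC = HC[unfolded vdefs] and HD = HD[unfolded vdefs]
  have S: "src (he 0 1) = vA" "src (he 1 0) = vB" "src (he 0 k) = vC" "src (he k 1) = vD"
    "src (he 1 k) = vA" "src (he k 0) = vA" "src (he 0 l) = vB" "src (he l 1) = vB"
    "src (he k l) = vC" "src (he l 0) = vC" "src (he 1 l) = vD" "src (he l k) = vD"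
    by (rule H_src; simp add: HA HB HC HD)+
  note S = S S[unfolded One_nat_def]
  have he': "he i j \<in> HE" if "i < 4" "j < 4" "i \<noteq> j" for i j using he(1)[OF that] .
  have T: "tgt (he i j) = src (he j i)" if "i < 4" "j < 4" "i \<noteq> j" for i j using tgt_he[OF that] .
  have R4: "vA \<in> R" "vB \<in> R" "vC \<in> R" "vD \<in> R" using half_edge(1) he' ne unfolding vA_def vB_def vC_def vD_def by auto
  then have V4 [simp]: "vA \<in> V" "vB \<in> V" "vC \<in> V" "vD \<in> V" using R_V by auto
  have "{vA, vB, vC, vD} = R"
  proof (rule closed_set_of_reps[of _ vA])
    show "{vA, vB, vC, vD} \<subseteq> R" using R4 by simp
    fix w \<eta> assume "w \<in> {vA, vB, vC, vD}" "\<eta> \<in> H w"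
    then have "\<eta> \<in> {he 0 1, he 1 k, he k 0} \<union> {he 1 0, he 0 l, he l 1} \<union> {he 0 k, he k l, he l 0} \<union> {he k 1, he 1 l, he l k}"
      using HA HB HC HD by blast
    then show "tgt \<eta> \<in> {vA, vB, vC, vD}" using T S ne by auto
  qed simp
  then have R: "R = {vA, vB, vC, vD}" by simp
  define y1 y2 y3 z1 z2 z3 where "y1 = shift (he 0 1)" and "y2 = shift (he 1 k)" and "y3 = shift (he k 0)"
    and "z1 = shift (he l 1)" and "z2 = shift (he l k)" and "z3 = shift (he l 0)"
  have yz [simp]: "y1 \<in> \<Lambda>" "y2 \<in> \<Lambda>" "y3 \<in> \<Lambda>" "z1 \<in> \<Lambda>" "z2 \<in> \<Lambda>" "z3 \<in> \<Lambda>"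
    using half_edge(3) he' ne by (auto simp: y1_def y2_def y3_def z1_def z2_def z3_def)
  have nbs: "nb (he 0 1) = act N y1 vB" "nb (he 1 k) = act N y2 vD" "nb (he k 0) = act N y3 vC"
    "nb (he l 1) = act N z1 vD" "nb (he l k) = act N z2 vC" "nb (he l 0) = act N z3 vB"
    using T S ne by (simp_all add: nb_def y1_def y2_def y3_def z1_def z2_def z3_def)
  note nbs = nbs nbs[unfolded One_nat_def]
  \<comment> \<open>\<open>vA\<close> plays the role of \<open>srs_p 0\<close>. The other
    representatives are translated to become its neighbours and play the roles of
    \<open>srs_p 1\<close>, \<open>srs_p 2\<close>, \<open>srs_p 3\<close>.\<close>
  define b where "b i = (if i = 0 then vA else if i = 1 then act N y1 vB else if i = 2 then act N y2 vD else act N y3 vC)" for i :: nat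
  have b: "b 0 = vA" "b 1 = act N y1 vB" "b 2 = act N y2 vD" "b 3 = act N y3 vC"
    "b (Suc 0) = act N y1 vB" by (simp_all add: b_def)
  \<comment> \<open>The half-edges \<open>he l 1\<close>, \<open>he l k\<close>,
    \<open>he l 0\<close> join the orbits of the three neighbours of \<open>vA\<close> in a cycle;
    these are their shifts relative to the translated representatives.\<close>
  define g1 g2 g3 where "g1 = y1 + z1 - y2" and "g2 = y2 + z2 - y3" and "g3 = y3 + z3 - y1"
  have g [simp]: "g1 \<in> \<Lambda>" "g2 \<in> \<Lambda>" "g3 \<in> \<Lambda>" by (simp_all add: g1_def g2_def g3_def)
  have gb: "act N g1 (b 2) = act N (y1 + z1) vD" "act N g2 (b 3) = act N (y2 + z2) vC" "act N g3 (b 1) = act N (y3 + z3) vB"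
    by (simp_all add: b g1_def g2_def g3_def)
  let ?base = "{{b 0, b 1}, {b 0, b 2}, {b 0, b 3}, {b 1, act N g1 (b 2)}, {b 2, act N g2 (b 3)}, {b 3, act N g3 (b 1)}}"
  have base: "{b 0, b 1} = {src (he 0 1), nb (he 0 1)}" "{b 0, b 2} = {src (he 1 k), nb (he 1 k)}"
    "{b 0, b 3} = {src (he k 0), nb (he k 0)}" "{b 1, act N g1 (b 2)} = act N y1 ` {src (he l 1), nb (he l 1)}"
    "{b 2, act N g2 (b 3)} = act N y2 ` {src (he l k), nb (he l k)}" "{b 3, act N g3 (b 1)} = act N y3 ` {src (he l 0), nb (he l 0)}"
    unfolding gb unfolding nbs S b by simp_all
  \<comment> \<open>Renames the root indices \<open>k\<close> and \<open>l\<close> to 2 and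
    3.\<close>
  define e where "e i = frame p q r (eps (if i = 2 then k else if i = 3 then l else i))" for i :: nat
  have e: "e 0 = frame p q r (eps 0)" "e 1 = frame p q r (eps 1)" "e 2 = frame p q r (eps k)" "e 3 = frame p q r (eps l)"
    "e (Suc 0) = frame p q r (eps 1)"
    by (simp_all add: e_def)
  have len: "pos N (nb (he i j)) - pos N (src (he i j)) = \<kappa> *\<^sub>R (frame p q r (eps i) - frame p q r (eps j))"
    if "i < 4" "j < 4" "i \<noteq> j" for i j
    using pos_nb[OF he'[OF that]] norm_edge_vec_kappa[of "fst (he i j)"] he'[OF that] he(2)[OF that]
    by (auto simp: frame_diff)
  note ne' = ne ne(3-7)[symmetric] ne(4,6)[unfolded One_nat_def] ne(4,6)[symmetric, unfolded One_nat_def]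
  show ?thesis
  proof (rule srs_recognition[of N \<kappa> b g1 g2 g3 e])
    show "periodic_network N" by (rule periodic)
    show "\<kappa> > 0" by (rule kappa_pos)
    show "network_volume N = 8 * sqrt 2 * \<kappa> ^ 3" by (rule volume_kappa)
    show "b i \<in> V" if "i \<le> 3" for i by (simp add: b_def)
    show "g1 \<in> \<Lambda>" "g2 \<in> \<Lambda>" "g3 \<in> \<Lambda>" by simp_all
    show "V \<subseteq> {act N g (b i) | g i. g \<in> \<Lambda> \<and> i \<le> 3}"
    proof
      fix v assume "v \<in> V"
      then obtain a where "a \<in> R" "v \<in> vertex_orbit N a" using cover by blast
      then obtain g where a: "a \<in> R" "g \<in> \<Lambda>" "v = act N g a" by (auto simp: mem_vertex_orbit)
      have "vB = act N (- y1) (b 1)" "vD = act N (- y2) (b 2)" "vC = act N (- y3) (b 3)" by (simp_all add: b)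
      moreover have bV: "b 1 \<in> V" "b 2 \<in> V" "b 3 \<in> V" by (simp_all add: b)
      ultimately have vb: "v = act N g (b 0) \<or> v = act N (g - y1) (b 1) \<or> v = act N (g - y2) (b 2) \<or> v = act N (g - y3) (b 3)"
        using a R by (auto simp: b(1))
      show "v \<in> {act N g (b i) | g i. g \<in> \<Lambda> \<and> i \<le> 3}"
      proof -
        have I: "act N m (b i) \<in> {act N g (b i) | g i. g \<in> \<Lambda> \<and> i \<le> 3}" if "m \<in> \<Lambda>" "i \<le> 3" for m i
          using that by blast
        show ?thesis
          using vb I[of g 0] I[of "g - y1" 1] I[of "g - y2" 2] I[of "g - y3" 3] a(2)
          by (elim disjE) simp_all
      qed
    qed
    show "norm (e i - e j) = 1" if "i < 4" "j < 4" "i \<noteq> j" for i j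
      unfolding e_def frame_diff[symmetric] using that ne'
      by (intro norm_frame_root[OF ortho]) (auto simp: less_4_cases)
    show "edges N = {act N g ` x | g x. g \<in> \<Lambda> \<and> x \<in> ?base}"
    proof (intro equalityI subsetI)
      fix x assume "x \<in> {act N g ` x | g x. g \<in> \<Lambda> \<and> x \<in> ?base}"
      then obtain g x' where x: "x = act N g ` x'" "g \<in> \<Lambda>" "x' \<in> ?base" by blast
      have "{src (he i j), nb (he i j)} \<in> edges N" if "i < 4" "j < 4" "i \<noteq> j" for i j using nb_edge(1)[OF he'[OF that]] .
      then have "x' \<in> edges N"
        using x(3) unfolding base insert_iff empty_iff by (elim disjE) (simp_all add: act_edges ne' del: image_insert)
      then show "x \<in> edges N" using act_edges x by simp
    next
      fix x assume "x \<in> edges N"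
      then obtain g i j where x: "g \<in> \<Lambda>" "i < 4" "j < 4" "i \<noteq> j" "x = act N g ` {src (he i j), nb (he i j)}"
        by (rule edge_half_edge)
      \<comment> \<open>\<open>?base\<close> lists each edge class with one orientation, so the
        reversed half-edge has to be available too.\<close>
      have flip: "\<exists>g\<in>\<Lambda>. x = act N g ` {src (he j i), nb (he j i)}"
      proof
        have V: "src (he j i) \<in> V" "nb (he j i) \<in> V"
          using half_edge[OF he'[of j i]] x by (auto simp: nb_def)
        have "{src (he i j), nb (he i j)} = act N (- shift (he j i)) ` {src (he j i), nb (he j i)}"
          using rev_half_edge_set[OF he'[of j i]] rev_he[of j i] x by simp
        then show "x = act N (g - shift (he j i)) ` {src (he j i), nb (he j i)}"
          using x V half_edge(3)[OF he'[of j i]] by simp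
        show "g - shift (he j i) \<in> \<Lambda>" using x half_edge(3)[OF he'[of j i]] by simp
      qed
      have fin: "x \<in> {act N g ` x | g x. g \<in> \<Lambda> \<and> x \<in> ?base}"
        if m: "m \<in> \<Lambda>" "x = act N m ` {src (he a c), nb (he a c)}"
          and ac: "(a, c) \<in> {(0, 1), (1, k), (k, 0), (l, 1), (l, k), (l, 0)}" for m a c
      proof -
        have un: "\<exists>g\<in>\<Lambda>. act N m ` z = act N g ` (act N y ` z)" if "y \<in> \<Lambda>" "z \<subseteq> V" for y z
        proof
          show "act N m ` z = act N (m - y) ` (act N y ` z)"
            unfolding image_image by (rule image_cong[OF refl]) (use that m(1) in auto)
          show "m - y \<in> \<Lambda>" using that m(1) by simp
        qed
        have V: "{src (he a c), nb (he a c)} \<subseteq> V"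
          using half_edge[OF he'[of a c]] ac ne' by (auto simp: nb_def)
        have "\<exists>y\<in>\<Lambda>. act N y ` {src (he a c), nb (he a c)} \<in> ?base"
        proof -
          have z: "act N 0 ` {src (he a c), nb (he a c)} = {src (he a c), nb (he a c)}" using V by simp
          from ac consider "a = 0 \<and> c = 1" | "a = 1 \<and> c = k" | "a = k \<and> c = 0" | "a = l \<and> c = 1"
            | "a = l \<and> c = k" | "a = l \<and> c = 0" by auto
          then show ?thesis
          proof cases
            case 1
            then have "act N 0 ` {src (he a c), nb (he a c)} = {b 0, b 1}" using z base(1) by simp
            then show ?thesis by (intro bexI[of _ 0]) (simp_all only: insert_iff yz lattice_zero simp_thms)
          next
            case 2
            then have "act N 0 ` {src (he a c), nb (he a c)} = {b 0, b 2}" using z base(2) by simp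
            then show ?thesis by (intro bexI[of _ 0]) (simp_all only: insert_iff yz lattice_zero simp_thms)
          next
            case 3
            then have "act N 0 ` {src (he a c), nb (he a c)} = {b 0, b 3}" using z base(3) by simp
            then show ?thesis by (intro bexI[of _ 0]) (simp_all only: insert_iff yz lattice_zero simp_thms)
          next
            case 4
            then have "act N y1 ` {src (he a c), nb (he a c)} = {b 1, act N g1 (b 2)}" using base(4) by simp
            then show ?thesis by (intro bexI[of _ y1]) (simp_all only: insert_iff yz lattice_zero simp_thms)
          next
            case 5
            then have "act N y2 ` {src (he a c), nb (he a c)} = {b 2, act N g2 (b 3)}" using base(5) by simp
            then show ?thesis by (intro bexI[of _ y2]) (simp_all only: insert_iff yz lattice_zero simp_thms)
          next
            case 6
            then have "act N y3 ` {src (he a c), nb (he a c)} = {b 3, act N g3 (b 1)}" using base(6) by simp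
            then show ?thesis by (intro bexI[of _ y3]) (simp_all only: insert_iff yz lattice_zero simp_thms)
          qed
        qed
        then obtain y where y: "y \<in> \<Lambda>" "act N y ` {src (he a c), nb (he a c)} \<in> ?base" by (elim bexE)
        obtain g where "g \<in> \<Lambda>" "x = act N g ` (act N y ` {src (he a c), nb (he a c)})"
          using un[OF y(1) V] unfolding m(2) by (elim bexE)
        then show ?thesis using y(2) by (intro CollectI exI conjI)
      qed
      obtain m where m: "m \<in> \<Lambda>" "x = act N m ` {src (he j i), nb (he j i)}" using flip by blast
      have "(i, j) \<in> {(0, 1), (1, k), (k, 0), (l, 1), (l, k), (l, 0)} \<or> (j, i) \<in> {(0, 1), (1, k), (k, 0), (l, 1), (l, k), (l, 0)}"
        using four[OF x(2)] four[OF x(3)] x(4) by auto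
      then show "x \<in> {act N g ` x | g x. g \<in> \<Lambda> \<and> x \<in> ?base}"
        using fin[OF x(1,5)] fin[OF m] by blast
    qed
    show "pos N (b 1) - pos N (b 0) = \<kappa> *\<^sub>R (e 0 - e 1)" using len[of 0 1] by (simp add: b e nbs S)
    show "pos N (b 2) - pos N (b 0) = \<kappa> *\<^sub>R (e 1 - e 2)" using len[of 1 k] ne' by (simp add: b e nbs S)
    show "pos N (b 3) - pos N (b 0) = \<kappa> *\<^sub>R (e 2 - e 0)" using len[of k 0] ne' by (simp add: b e nbs S)
    show "pos N (b 2) + g1 - pos N (b 1) = \<kappa> *\<^sub>R (e 3 - e 1)"
      using len[of l 1] ne' by (simp add: b e nbs S g1_def algebra_simps)
    show "pos N (b 3) + g2 - pos N (b 2) = \<kappa> *\<^sub>R (e 3 - e 2)"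
      using len[of l k] ne' by (simp add: b e nbs S g2_def algebra_simps)
    show "pos N (b 1) + g3 - pos N (b 3) = \<kappa> *\<^sub>R (e 3 - e 0)"
      using len[of l 0] ne' by (simp add: b e nbs S g3_def algebra_simps)
  qed
qed

end

theorem theorem1:
  fixes N :: "('v, 3) network"
  assumes "periodic_network N"
  shows "network_length N ^ 3 / network_volume N \<ge> 27 / sqrt 2 \<and>
         (network_length N ^ 3 / network_volume N = 27 / sqrt 2 \<longleftrightarrow> essentially_similar N srs) \<and>
         (network_length N ^ 3 / network_volume N = 27 / sqrt 2 \<longrightarrow> body_centred_cubic (lattice N))"
proof -
  \<comment> \<open>Removing as many vertices as possible keeps length and lattice, so the
    classification of reduced minimal networks applies.\<close>
  have sim: "\<exists>N'. removes_degree_two\<^sup>*\<^sup>* N N' \<and> similar_networks N' srs"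
    if eq: "network_length N ^ 3 / network_volume N = 27 / sqrt 2"
  proof -
    obtain N' where N': "removes_degree_two\<^sup>*\<^sup>* N N'" "\<nexists>N''. removes_degree_two N' N''"
      using removals_terminate[OF assms] by blast
    have inv: "periodic_network N'" "lattice N' = lattice N" "network_length N' = network_length N"
      using removals_invariants[OF assms N'(1)] by auto
    then have "network_length N' ^ 3 / network_volume N' = 27 / sqrt 2"
      using eq by (simp add: network_volume_def)
    then obtain R s t h v p q r \<kappa> where "net_min N' R s t h v p q r \<kappa>"
      using net_min_exists[OF inv(1)] by blast
    then have "net_min_reduced N' R s t h v p q r \<kappa>"
      using N'(2) by (simp add: net_min_reduced_def net_min_reduced_axioms_def)
    then have "similar_networks N' srs" by (rule net_min_reduced.similar_srs)
    then show ?thesis using N'(1) by blast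
  qed
  have conv: "network_length N ^ 3 / network_volume N = 27 / sqrt 2 \<and> body_centred_cubic (lattice N)"
    if N': "removes_degree_two\<^sup>*\<^sup>* N N'" "similar_networks N' srs" for N'
  proof -
    have inv: "periodic_network N'" "lattice N' = lattice N" "network_length N' = network_length N"
      using removals_invariants[OF assms N'(1)] by auto
    show ?thesis using similar_srs[OF inv(1) N'(2)] inv(2,3) by (simp add: network_volume_def)
  qed
  \<comment> \<open>No removal applies to srs, so all removals take place on the side of
    \<open>N\<close>.\<close>
  have ess: "essentially_similar N srs \<longleftrightarrow> (\<exists>N'. removes_degree_two\<^sup>*\<^sup>* N N' \<and> similar_networks N' srs)"
    unfolding essentially_similar_def using srs_removals by blast
  show ?thesis using length_volume_inequality(1)[OF assms] sim conv unfolding ess by blast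
qed

end
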